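(* Let $X$ be a CAT(0) 2-complex. Suppose each 2-cell of $X$ is convex. Then $X$ is $3$-collapsing.
   Context: All 2-complexes are combinatorial: the attaching map of each 2-cell $R$ is a closed combinatorial path $\partial_{\mathsf p}R$ in the 1-skeleton. A CAT(0) 2-complex is a 2-complex with a polyhedral metric (2-cells are metric polygons) that is CAT(0). For a 2-complex $Z$, duplicate 2-cells are 2-cells with the same boundary cycle, and $\underline Z$ denotes the quotient of $Z$ identifying duplicate 2-cells. A 2-cell $R$ of $Y$ collapses along a free face $e$ if $e$ is a 1-cell traversed exactly once by $\partial_{\mathsf p}R$ and not traversed by the boundary path of any other 2-cell of $Y$. A 2-complex $X$ with universal cover $\widetilde X$ (here $\widetilde X=X$) is $n$-collapsing if for every $m\le n$, each compact subcomplex $Y$ of $\underline{\widetilde X}$ having at least $m$ 2-cells has at least $m$ distinct collapses, i.e. at least $m$ distinct 2-cells that collapse along free faces of $Y$. *)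

theory Defs
  imports "HOL-Analysis.Analysis"
begin

section \<open>Combinatorial 2-complexes\<close>

text \<open>An oriented 1-cell is a pair \<open>(e, b)\<close>, where \<open>b\<close> says whether the 1-cell \<open>e\<close> is traversed
  from \<open>src e\<close> to \<open>tgt e\<close> or backwards. Loops, multiple 1-cells, and attaching paths that are
  not embedded are all allowed.\<close>

record ('v, 'e, 'f) complex2 =
  verts :: "'v set"
  edges :: "'e set"
  faces :: "'f set"
  src :: "'e \<Rightarrow> 'v"
  tgt :: "'e \<Rightarrow> 'v"
  bdry :: "'f \<Rightarrow> ('e \<times> bool) list"

fun initial :: "('v, 'e, 'f) complex2 \<Rightarrow> 'e \<times> bool \<Rightarrow> 'v" where
  "initial X (e, b) = (if b then src X e else tgt X e)"

fun terminal :: "('v, 'e, 'f) complex2 \<Rightarrow> 'e \<times> bool \<Rightarrow> 'v" where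
  "terminal X (e, b) = (if b then tgt X e else src X e)"

definition closed_path :: "('v, 'e, 'f) complex2 \<Rightarrow> ('e \<times> bool) list \<Rightarrow> bool" where
  "closed_path X p \<longleftrightarrow> p \<noteq> [] \<and> fst ` set p \<subseteq> edges X \<and>
     (\<forall>i < length p. terminal X (p ! i) = initial X (p ! ((i + 1) mod length p)))"

definition is_complex2 :: "('v, 'e, 'f) complex2 \<Rightarrow> bool" where
  "is_complex2 X \<longleftrightarrow>
     src X ` edges X \<subseteq> verts X \<and> tgt X ` edges X \<subseteq> verts X \<and>
     (\<forall>R \<in> faces X. closed_path X (bdry X R))"

definition subcomplex :: "('v, 'e, 'f) complex2 \<Rightarrow> ('v, 'e, 'f) complex2 \<Rightarrow> bool" where
  "subcomplex Y X \<longleftrightarrow> is_complex2 Y \<and>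
     verts Y \<subseteq> verts X \<and> edges Y \<subseteq> edges X \<and> faces Y \<subseteq> faces X \<and>
     src Y = src X \<and> tgt Y = tgt X \<and> bdry Y = bdry X"

subsection \<open>Topological realization\<close>

text \<open>A realization is the disjoint union of its open cells, so every point has exactly one name:
  a vertex, a parameter in an open interval, or a point of an open planar disc. The same names
  serve for the CW realization (unit intervals, unit discs) and for the metric realization below
  (intervals of prescribed lengths, polygons).\<close>

datatype ('v, 'e, 'f) point = Vtx 'v | Edg 'e real | Fac 'f complex

definition edge_map :: "('v, 'e, 'f) complex2 \<Rightarrow> ('e \<Rightarrow> real) \<Rightarrow> 'e \<Rightarrow> real \<Rightarrow> ('v, 'e, 'f) point" where
  "edge_map X l e t =
     (if t \<le> 0 then Vtx (src X e) else if l e \<le> t then Vtx (tgt X e) else Edg e t)"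

fun oriented_edge_map ::
  "('v, 'e, 'f) complex2 \<Rightarrow> ('e \<Rightarrow> real) \<Rightarrow> 'e \<times> bool \<Rightarrow> real \<Rightarrow> ('v, 'e, 'f) point" where
  "oriented_edge_map X l (e, b) t = edge_map X l e (if b then t else l e - t)"

definition realization :: "('v, 'e, 'f) complex2 \<Rightarrow> ('v, 'e, 'f) point set" where
  "realization X =
     Vtx ` verts X \<union> {Edg e t | e t. e \<in> edges X \<and> 0 < t \<and> t < 1} \<union>
     {Fac R z | R z. R \<in> faces X \<and> norm z < 1}"

text \<open>The unit circle is divided into as many equal arcs as the boundary path has edges, and the
  \<open>i\<close>-th arc runs along the \<open>i\<close>-th edge of the path.\<close>

definition disc_map :: "('v, 'e, 'f) complex2 \<Rightarrow> 'f \<Rightarrow> complex \<Rightarrow> ('v, 'e, 'f) point" where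
  "disc_map X R z =
     (if norm z < 1 then Fac R z
      else let s = real (length (bdry X R)) * Arg2pi z / (2 * pi)
           in oriented_edge_map X (\<lambda>_. 1) (bdry X R ! nat \<lfloor>s\<rfloor>) (frac s))"

definition weakly_open :: "('v, 'e, 'f) complex2 \<Rightarrow> ('v, 'e, 'f) point set \<Rightarrow> bool" where
  "weakly_open X U \<longleftrightarrow> U \<subseteq> realization X \<and>
     (\<forall>e \<in> edges X. openin (top_of_set {0..1}) ({0..1} \<inter> edge_map X (\<lambda>_. 1) e -` U)) \<and>
     (\<forall>R \<in> faces X. openin (top_of_set (cball 0 1)) (cball 0 1 \<inter> disc_map X R -` U))"

definition weak_topology :: "('v, 'e, 'f) complex2 \<Rightarrow> ('v, 'e, 'f) point topology" where
  "weak_topology X = topology (weakly_open X)"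

lemma istopology_weakly_open: "istopology (weakly_open X)"
  unfolding istopology_def
proof (intro conjI allI impI)
  fix S T assume ST: "weakly_open X S" "weakly_open X T"
  have eq: "A \<inter> f -` (S \<inter> T) = (A \<inter> f -` S) \<inter> (A \<inter> f -` T)"
    for A :: "'z set" and f by blast
  show "weakly_open X (S \<inter> T)"
    unfolding weakly_open_def eq
  proof (intro conjI ballI)
    show "S \<inter> T \<subseteq> realization X" using ST by (auto simp: weakly_open_def)
  qed (rule openin_Int; use ST in \<open>simp add: weakly_open_def\<close>)+
next
  fix \<K> assume K: "\<forall>U \<in> \<K>. weakly_open X U"
  have eq: "A \<inter> f -` \<Union>\<K> = \<Union>((\<lambda>U. A \<inter> f -` U) ` \<K>)" for A :: "'z set" and f by blast
  show "weakly_open X (\<Union>\<K>)"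
    unfolding weakly_open_def eq
  proof (intro conjI ballI)
    show "\<Union>\<K> \<subseteq> realization X" using K by (auto simp: weakly_open_def)
  qed (rule openin_Union; use K in \<open>auto simp: weakly_open_def\<close>)+
qed

lemma openin_weak_topology: "openin (weak_topology X) U \<longleftrightarrow> weakly_open X U"
  by (simp add: weak_topology_def topology_inverse' istopology_weakly_open)

definition compact_subcomplex ::
  "('v, 'e, 'f) complex2 \<Rightarrow> ('v, 'e, 'f) complex2 \<Rightarrow> bool" where
  "compact_subcomplex Y X \<longleftrightarrow>
     subcomplex Y X \<and> compactin (weak_topology X) (realization Y)"

subsection \<open>Duplicate 2-cells, collapses\<close>

definition inverse_path :: "('e \<times> bool) list \<Rightarrow> ('e \<times> bool) list" where
  "inverse_path p = rev (map (\<lambda>(e, b). (e, \<not> b)) p)"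

text \<open>A boundary cycle is a closed path up to the choice of starting point and of orientation.\<close>

definition same_cycle :: "('e \<times> bool) list \<Rightarrow> ('e \<times> bool) list \<Rightarrow> bool" where
  "same_cycle p q \<longleftrightarrow> (\<exists>k. q = rotate k p \<or> q = rotate k (inverse_path p))"

definition duplicates :: "('v, 'e, 'f) complex2 \<Rightarrow> ('f \<times> 'f) set" where
  "duplicates X =
     {(R, R'). R \<in> faces X \<and> R' \<in> faces X \<and> same_cycle (bdry X R) (bdry X R')}"

text \<open>The members of a class of duplicates have the same boundary cycle; the choice of a member
  only fixes the starting point and the orientation of the boundary path of the identified
  2-cell.\<close>

definition identify_duplicates :: "('v, 'e, 'f) complex2 \<Rightarrow> ('v, 'e, 'f set) complex2" where
  "identify_duplicates X =
     \<lparr>verts = verts X, edges = edges X, faces = faces X // duplicates X,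
      src = src X, tgt = tgt X, bdry = (\<lambda>C. bdry X (SOME R. R \<in> C))\<rparr>"

definition free_face_of :: "('v, 'e, 'f) complex2 \<Rightarrow> 'e \<Rightarrow> 'f \<Rightarrow> bool" where
  "free_face_of Y e R \<longleftrightarrow> e \<in> edges Y \<and>
     count_list (map fst (bdry Y R)) e = 1 \<and>
     (\<forall>R' \<in> faces Y. R' \<noteq> R \<longrightarrow> e \<notin> fst ` set (bdry Y R'))"

definition collapsing_faces :: "('v, 'e, 'f) complex2 \<Rightarrow> 'f set" where
  "collapsing_faces Y = {R \<in> faces Y. \<exists>e. free_face_of Y e R}"

definition has_at_least :: "nat \<Rightarrow> 'a set \<Rightarrow> bool" where
  "has_at_least m A \<longleftrightarrow> (\<exists>B \<subseteq> A. finite B \<and> card B = m)"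

text \<open>For a general complex the condition is imposed on its universal cover. Here \<open>X\<close> has to be
  simply connected (as CAT(0) complexes are), so that \<open>X\<close> is its own universal cover.\<close>

definition n_collapsing :: "nat \<Rightarrow> ('v, 'e, 'f) complex2 \<Rightarrow> bool" where
  "n_collapsing n X \<longleftrightarrow>
     (\<forall>m \<le> n. \<forall>Y. compact_subcomplex Y (identify_duplicates X) \<and> has_at_least m (faces Y)
        \<longrightarrow> has_at_least m (collapsing_faces Y))"


section \<open>CAT(0) spaces\<close>

definition geodesic_segment :: "'a set \<Rightarrow> ('a \<Rightarrow> 'a \<Rightarrow> real) \<Rightarrow> 'a \<Rightarrow> 'a \<Rightarrow> 'a set \<Rightarrow> bool" where
  "geodesic_segment M d p q S \<longleftrightarrow>
     (\<exists>c :: real \<Rightarrow> 'a. c ` {0..d p q} \<subseteq> M \<and> c 0 = p \<and> c (d p q) = q \<and>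
        (\<forall>s \<in> {0..d p q}. \<forall>t \<in> {0..d p q}. d (c s) (c t) = \<bar>s - t\<bar>) \<and>
        S = c ` {0..d p q})"

definition geodesic_space :: "'a set \<Rightarrow> ('a \<Rightarrow> 'a \<Rightarrow> real) \<Rightarrow> bool" where
  "geodesic_space M d \<longleftrightarrow>
     Metric_space M d \<and> (\<forall>p \<in> M. \<forall>q \<in> M. \<exists>S. geodesic_segment M d p q S)"

text \<open>\<open>p', q', r'\<close> is a comparison triangle in the Euclidean plane, and \<open>x', y'\<close> are the comparison
  points of \<open>x, y\<close>. Two distinct sides of a triangle share a vertex, here called \<open>p\<close>; for two
  points on the same side the inequality is an identity.\<close>

definition CAT0_space :: "'a set \<Rightarrow> ('a \<Rightarrow> 'a \<Rightarrow> real) \<Rightarrow> bool" where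
  "CAT0_space M d \<longleftrightarrow> geodesic_space M d \<and>
     (\<forall>p \<in> M. \<forall>q \<in> M. \<forall>r \<in> M. \<forall>S T.
        geodesic_segment M d p q S \<and> geodesic_segment M d p r T \<longrightarrow>
        (\<forall>p' q' r' :: complex.
           dist p' q' = d p q \<and> dist p' r' = d p r \<and> dist q' r' = d q r \<longrightarrow>
           (\<forall>x \<in> S. \<forall>y \<in> T. \<forall>x' \<in> closed_segment p' q'. \<forall>y' \<in> closed_segment p' r'.
              dist p' x' = d p x \<and> dist p' y' = d p y \<longrightarrow> d x y \<le> dist x' y')))"

definition geodesically_convex :: "'a set \<Rightarrow> ('a \<Rightarrow> 'a \<Rightarrow> real) \<Rightarrow> 'a set \<Rightarrow> bool" where
  "geodesically_convex M d C \<longleftrightarrow> C \<subseteq> M \<and>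
     (\<forall>p \<in> C. \<forall>q \<in> C. \<forall>S. geodesic_segment M d p q S \<longrightarrow> S \<subseteq> C)"


section \<open>Polyhedral metrics\<close>

text \<open>The simply connected surface of constant curvature \<open>k \<le> 0\<close>: for \<open>k = 0\<close> the Euclidean plane,
  for \<open>k < 0\<close> the Beltrami--Klein disc, in which geodesic segments are ordinary straight segments.
  Positive curvature is left out because a CAT(0) space contains no positively curved disc.\<close>

definition model_plane :: "real \<Rightarrow> complex set" where
  "model_plane k = {z. 0 < 1 + k * (norm z)\<^sup>2}"

definition model_dist :: "real \<Rightarrow> complex \<Rightarrow> complex \<Rightarrow> real" where
  "model_dist k z w =
     (if k = 0 then dist z w
      else arcosh ((1 + k * (z \<bullet> w)) / (sqrt (1 + k * (norm z)\<^sup>2) * sqrt (1 + k * (norm w)\<^sup>2)))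
             / sqrt (- k))"

definition side :: "complex list \<Rightarrow> nat \<Rightarrow> complex set" where
  "side ps i = closed_segment (ps ! i) (ps ! ((i + 1) mod length ps))"

definition polygon_boundary :: "complex list \<Rightarrow> complex set" where
  "polygon_boundary ps = (\<Union>i < length ps. side ps i)"

definition polygon_interior :: "complex list \<Rightarrow> complex set" where
  "polygon_interior ps = inside (polygon_boundary ps)"

definition polygon :: "complex list \<Rightarrow> complex set" where
  "polygon ps = polygon_boundary ps \<union> polygon_interior ps"

text \<open>A simple closed polygon: two sides meet at most in common corners. It need not be convex, and
  angles equal to \<open>\<pi>\<close> are allowed.\<close>

definition simple_polygon :: "complex list \<Rightarrow> bool" where
  "simple_polygon ps \<longleftrightarrow> 3 \<le> length ps \<and> distinct ps \<and>
     (\<forall>i < length ps. \<forall>j < length ps. i \<noteq> j \<longrightarrow>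
        side ps i \<inter> side ps j =
          {ps ! i, ps ! ((i + 1) mod length ps)} \<inter> {ps ! j, ps ! ((j + 1) mod length ps)})"

record ('e, 'f) shape =
  curv :: real
  len :: "'e \<Rightarrow> real"
  corners :: "'f \<Rightarrow> complex list"

definition polyhedral_shape :: "('v, 'e, 'f) complex2 \<Rightarrow> ('e, 'f) shape \<Rightarrow> bool" where
  "polyhedral_shape X P \<longleftrightarrow> curv P \<le> 0 \<and> (\<forall>e \<in> edges X. 0 < len P e) \<and>
     (\<forall>R \<in> faces X. let ps = corners P R; n = length ps in
        simple_polygon ps \<and> set ps \<subseteq> model_plane (curv P) \<and> n = length (bdry X R) \<and>
        (\<forall>i < n. model_dist (curv P) (ps ! i) (ps ! ((i + 1) mod n)) = len P (fst (bdry X R ! i))))"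

definition metric_realization ::
  "('v, 'e, 'f) complex2 \<Rightarrow> ('e, 'f) shape \<Rightarrow> ('v, 'e, 'f) point set" where
  "metric_realization X P =
     Vtx ` verts X \<union> {Edg e t | e t. e \<in> edges X \<and> 0 < t \<and> t < len P e} \<union>
     {Fac R z | R z. R \<in> faces X \<and> z \<in> polygon_interior (corners P R)}"

text \<open>The \<open>i\<close>-th side of the polygon is glued isometrically along the \<open>i\<close>-th edge of the boundary
  path. At a corner, where two sides meet, both give the same vertex.\<close>

definition polygon_map ::
  "('v, 'e, 'f) complex2 \<Rightarrow> ('e, 'f) shape \<Rightarrow> 'f \<Rightarrow> complex \<Rightarrow> ('v, 'e, 'f) point" where
  "polygon_map X P R z =
     (if z \<in> polygon_interior (corners P R) then Fac R z
      else let i = (LEAST i. z \<in> side (corners P R) i)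
           in oriented_edge_map X (len P) (bdry X R ! i)
                (model_dist (curv P) (corners P R ! i) z))"

definition closed_cell ::
  "('v, 'e, 'f) complex2 \<Rightarrow> ('e, 'f) shape \<Rightarrow> 'f \<Rightarrow> ('v, 'e, 'f) point set" where
  "closed_cell X P R = polygon_map X P R ` polygon (corners P R)"

text \<open>\<open>chain X P x y L\<close>: the points \<open>x\<close> and \<open>y\<close> are joined by a finite chain of straight segments,
  each contained in one closed cell, of total length \<open>L\<close>.\<close>

inductive chain ::
  "('v, 'e, 'f) complex2 \<Rightarrow> ('e, 'f) shape \<Rightarrow>
     ('v, 'e, 'f) point \<Rightarrow> ('v, 'e, 'f) point \<Rightarrow> real \<Rightarrow> bool"
  for X :: "('v, 'e, 'f) complex2" and P :: "('e, 'f) shape" where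
  refl: "x \<in> metric_realization X P \<Longrightarrow> chain X P x x 0"
| edge_step:
    "\<lbrakk>chain X P x (edge_map X (len P) e s) L; e \<in> edges X; s \<in> {0..len P e}; t \<in> {0..len P e}\<rbrakk>
     \<Longrightarrow> chain X P x (edge_map X (len P) e t) (L + \<bar>s - t\<bar>)"
| face_step:
    "\<lbrakk>chain X P x (polygon_map X P R z) L; R \<in> faces X;
      closed_segment z w \<subseteq> polygon (corners P R)\<rbrakk>
     \<Longrightarrow> chain X P x (polygon_map X P R w) (L + model_dist (curv P) z w)"

text \<open>The value \<open>0\<close> for points not joined by a chain is a dummy; it makes a disconnected complex fail
  to be a metric space, hence fail to be CAT(0).\<close>

definition path_dist ::
  "('v, 'e, 'f) complex2 \<Rightarrow> ('e, 'f) shape \<Rightarrow>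
     ('v, 'e, 'f) point \<Rightarrow> ('v, 'e, 'f) point \<Rightarrow> real" where
  "path_dist X P x y = (if \<exists>L. chain X P x y L then Inf {L. chain X P x y L} else 0)"

definition CAT0_complex2 :: "('v, 'e, 'f) complex2 \<Rightarrow> ('e, 'f) shape \<Rightarrow> bool" where
  "CAT0_complex2 X P \<longleftrightarrow> is_complex2 X \<and> polyhedral_shape X P \<and>
     CAT0_space (metric_realization X P) (path_dist X P)"

definition convex_cell :: "('v, 'e, 'f) complex2 \<Rightarrow> ('e, 'f) shape \<Rightarrow> 'f \<Rightarrow> bool" where
  "convex_cell X P R \<longleftrightarrow>
     geodesically_convex (metric_realization X P) (path_dist X P) (closed_cell X P R)"

end

theory Submission
  imports Defs
begin

text \<open>
  Suppose that at most two 2-cells \<open>A\<close> and \<open>B\<close> of a compact \<open>Y\<close> collapse, and let \<open>q\<close> be a point in the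
  interior of a further cell \<open>C\<close> of \<open>Y\<close>. From \<open>q\<close> one draws a geodesic inside \<open>Y\<close>, starting in a
  direction \<open>u\<close>: it is straight in every cell, and at an edge that is not a free face it is continued,
  still as a geodesic, into another side of a cell of \<open>Y\<close> that is glued to this edge (\<open>crossing\<close>).
  Geodesics from \<open>q\<close> to the finitely many vertices start in finitely many directions; for the other
  directions no vertex is ever met. In a CAT(0) space a local geodesic is a geodesic
  (\<open>btw_extend\<close>), and a geodesic that leaves an edge through a cell does not return to it
  (\<open>edge_met_once\<close>). As \<open>Y\<close> has finitely many edges (\<open>compact_subcomplex_finite_edges\<close>), the process
  ends, and it can only end at a free face (\<open>geodesic_to_free_face\<close>), hence in \<open>A\<close> or in \<open>B\<close>.

  A convex cell that does not contain \<open>q\<close> is not met in both directions \<open>u\<close> and \<open>- u\<close>, because the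
  geodesic through \<open>q\<close> would then join two points of it. By a comparison estimate (\<open>almost_straight\<close>)
  this remains true for all pairs of directions that are opposite up to some fixed error. So if \<open>u\<close> leads to
  \<open>A\<close>, then \<open>- u\<close> leads to \<open>B\<close> and directions near \<open>u\<close> do not lead to \<open>B\<close>. The directions near
  those leading to \<open>A\<close> and the directions near those leading to \<open>B\<close> would disconnect the circle of
  directions (\<open>two_free_cells_impossible\<close>).

  All local geometry is derived from the metric, since \<open>X\<close> is not assumed to be locally
  finite and an edge may lie on infinitely many, arbitrarily thin cells. A truncated distance that is
  1-Lipschitz along chains shows that open cells are locally isometric to the model plane
  (\<open>uniform_neighbourhood\<close>). Since local geodesics are geodesics, every convex subset of an open
  cell is embedded isometrically, and by continuity so is its closure (\<open>d_closure_convex\<close>); in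
  particular edges are geodesic (\<open>d_edge\<close>). Geodesics are continued across an edge without developing
  cells into the model plane: the endpoint of a geodesic is moved along an arc from one half of the edge
  to the other, and connectedness provides a position for which the geodesic crosses the edge at the
  prescribed point (\<open>crossing_by_connectedness\<close>).

  The cells of \<open>Y\<close> are classes of duplicates. Replacing each class by a representative gives a set of
  cells of \<open>X\<close> with the same boundary paths, and the geometry takes place there.
\<close>

section \<open>The model planes\<close>

text \<open>The Lorentz form of the vectors \<open>(1, z)\<close> and \<open>(1, w)\<close>. For \<open>k < 0\<close> it has signature \<open>(1, 2)\<close>, the Klein disc
  consists of the lines on which it is positive, and the distance is the \<open>arcosh\<close> of the form on normalized
  vectors.\<close>

definition lorentz :: "real \<Rightarrow> complex \<Rightarrow> complex \<Rightarrow> real" where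
  "lorentz k z w = 1 + k * (z \<bullet> w)"

lemma lorentz_self: "lorentz k z z = 1 + k * (norm z)\<^sup>2"
  by (simp add: lorentz_def power2_norm_eq_inner)

lemma lorentz_self_pos: "z \<in> model_plane k \<Longrightarrow> 0 < lorentz k z z"
  by (simp add: lorentz_self model_plane_def)

text \<open>Twice the signed area of the triangle \<open>u v w\<close>, that is, the determinant of the vectors \<open>(1, u)\<close>, \<open>(1, v)\<close>,
  \<open>(1, w)\<close>.\<close>

definition signed_area :: "complex \<Rightarrow> complex \<Rightarrow> complex \<Rightarrow> real" where
  "signed_area u v w = (Re v - Re u) * (Im w - Im u) - (Im v - Im u) * (Re w - Re u)"

text \<open>The left-hand side is the Gram determinant of three vectors. That it is a square yields the
  triangle inequality, and that it vanishes only for collinear points yields the case of equality.\<close>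

lemma Gram_determinant:
  "lorentz k z z * lorentz k w w * lorentz k v v + 2 * lorentz k z w * lorentz k w v * lorentz k z v
     - lorentz k z z * (lorentz k w v)\<^sup>2 - lorentz k w w * (lorentz k z v)\<^sup>2 - lorentz k v v * (lorentz k z w)\<^sup>2
   = (k * signed_area z w v)\<^sup>2"
  unfolding lorentz_def signed_area_def inner_complex_def by (simp add: power2_eq_square) algebra

lemma reverse_Cauchy_Schwarz_gap:
  "(lorentz k z w)\<^sup>2 - lorentz k z z * lorentz k w w = - k * ((norm (z - w))\<^sup>2 * lorentz k z z - k * ((z - w) \<bullet> z)\<^sup>2)"
  unfolding lorentz_def inner_complex_def cmod_power2 by (simp add: power2_eq_square) algebra

text \<open>Points of the Klein disc are timelike vectors, for which the Cauchy--Schwarz inequality is reversed.\<close>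

lemma reverse_Cauchy_Schwarz_strict:
  assumes "k < 0" "z \<in> model_plane k" "z \<noteq> w"
  shows "lorentz k z z * lorentz k w w < (lorentz k z w)\<^sup>2"
proof -
  have "0 < (norm (z - w))\<^sup>2 * lorentz k z z"
    using assms lorentz_self_pos by simp
  moreover have "0 \<le> - k * ((z - w) \<bullet> z)\<^sup>2"
    using assms(1) by (simp add: mult_nonpos_nonneg)
  ultimately have "0 < - k * ((norm (z - w))\<^sup>2 * lorentz k z z - k * ((z - w) \<bullet> z)\<^sup>2)"
    using assms(1) by (intro mult_pos_pos) auto
  thus ?thesis using reverse_Cauchy_Schwarz_gap[of k z w] by linarith
qed

lemma lorentz_pos:
  assumes "k \<le> 0" "z \<in> model_plane k" "w \<in> model_plane k"
  shows "0 < lorentz k z w"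
proof -
  have 1: "2 * (z \<bullet> w) \<le> z \<bullet> z + w \<bullet> w"
    using inner_ge_zero[of "z - w"] by (simp add: inner_diff inner_commute)
  have "k * (z \<bullet> z + w \<bullet> w) \<le> k * (2 * (z \<bullet> w))"
    using 1 assms(1) by (rule mult_left_mono_neg)
  hence "lorentz k z z + lorentz k w w \<le> 2 * lorentz k z w" by (simp add: lorentz_def algebra_simps)
  thus ?thesis using lorentz_self_pos[OF assms(2)] lorentz_self_pos[OF assms(3)] by linarith
qed

text \<open>The hyperbolic cosine of \<open>sqrt (- k)\<close> times the distance, for \<open>k < 0\<close>.\<close>

definition cosh_dist :: "real \<Rightarrow> complex \<Rightarrow> complex \<Rightarrow> real" where
  "cosh_dist k z w = lorentz k z w / (sqrt (lorentz k z z) * sqrt (lorentz k w w))"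

lemma model_dist_cosh_dist:
  "k < 0 \<Longrightarrow> model_dist k z w = arcosh (cosh_dist k z w) / sqrt (- k)"
  by (simp add: model_dist_def cosh_dist_def lorentz_self) (simp add: lorentz_def)

lemma cosh_dist_squared:
  assumes "z \<in> model_plane k" "w \<in> model_plane k"
  shows "(cosh_dist k z w)\<^sup>2 * (lorentz k z z * lorentz k w w) = (lorentz k z w)\<^sup>2"
  using lorentz_self_pos[OF assms(1)] lorentz_self_pos[OF assms(2)]
  by (simp add: cosh_dist_def power_divide power_mult_distrib)

lemma cosh_dist_self: "z \<in> model_plane k \<Longrightarrow> cosh_dist k z z = 1"
  using lorentz_self_pos[of z k] by (simp add: cosh_dist_def)

lemma cosh_dist_gt_1:
  assumes "k < 0" "z \<in> model_plane k" "w \<in> model_plane k" "z \<noteq> w"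
  shows "1 < cosh_dist k z w"
proof -
  note p = lorentz_self_pos[OF assms(2)] lorentz_self_pos[OF assms(3)]
  have pos: "0 < cosh_dist k z w"
    using lorentz_pos[of k z w] assms p by (simp add: cosh_dist_def)
  have "lorentz k z z * lorentz k w w * 1 < (lorentz k z z * lorentz k w w) * (cosh_dist k z w)\<^sup>2"
    using reverse_Cauchy_Schwarz_strict[OF assms(1,2,4)] cosh_dist_squared[OF assms(2,3)]
    by (simp add: mult.commute)
  hence "1 < (cosh_dist k z w)\<^sup>2" using p by (simp add: mult_less_cancel_left_pos)
  thus ?thesis using pos by (metis one_power2 power_less_imp_less_base less_imp_le)
qed

lemma cosh_dist_ge_1:
  assumes "k < 0" "z \<in> model_plane k" "w \<in> model_plane k"
  shows "1 \<le> cosh_dist k z w"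
  using cosh_dist_gt_1[OF assms] cosh_dist_self[OF assms(2)] by (cases "z = w") auto

text \<open>The Gram determinant in terms of distances. If \<open>a\<close>, \<open>b\<close>, \<open>c\<close> are the hyperbolic cosines of the sides, then
  \<open>a * b + sqrt ((a\<^sup>2 - 1) * (b\<^sup>2 - 1))\<close> is the hyperbolic cosine of the sum of the first two sides, so the
  triangle inequality is a comparison of \<open>(a * b - c)\<^sup>2\<close> with \<open>(a\<^sup>2 - 1) * (b\<^sup>2 - 1)\<close>.\<close>

lemma cosh_dist_Gram:
  assumes "z \<in> model_plane k" "w \<in> model_plane k" "v \<in> model_plane k"
  shows "(cosh_dist k z w * cosh_dist k w v - cosh_dist k z v)\<^sup>2
           + (k * signed_area z w v)\<^sup>2 / (lorentz k z z * lorentz k w w * lorentz k v v)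
         = ((cosh_dist k z w)\<^sup>2 - 1) * ((cosh_dist k w v)\<^sup>2 - 1)"
proof -
  define x y t where "x = sqrt (lorentz k z z)" "y = sqrt (lorentz k w w)" "t = sqrt (lorentz k v v)"
  have p: "0 < x" "0 < y" "0 < t" using assms lorentz_self_pos by (simp_all add: x_y_t_def)
  have s: "lorentz k z z = x\<^sup>2" "lorentz k w w = y\<^sup>2" "lorentz k v v = t\<^sup>2"
    using assms lorentz_self_pos by (simp_all add: x_y_t_def less_imp_le)
  define a b c where "a = cosh_dist k z w" "b = cosh_dist k w v" "c = cosh_dist k z v"
  have q: "lorentz k z w = a * x * y" "lorentz k w v = b * y * t" "lorentz k z v = c * x * t"
    using p by (simp_all add: a_b_c_def cosh_dist_def x_y_t_def)
  have "(k * signed_area z w v)\<^sup>2 = x\<^sup>2 * y\<^sup>2 * t\<^sup>2 * (1 + 2 * a * b * c - a\<^sup>2 - b\<^sup>2 - c\<^sup>2)"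
    unfolding Gram_determinant[symmetric] s q by (simp add: power2_eq_square algebra_simps)
  hence "(k * signed_area z w v)\<^sup>2 / (x\<^sup>2 * y\<^sup>2 * t\<^sup>2) = 1 + 2 * a * b * c - a\<^sup>2 - b\<^sup>2 - c\<^sup>2"
    using p by simp
  thus ?thesis unfolding s a_b_c_def[symmetric] by (simp add: power2_eq_square algebra_simps)
qed

lemma cosh_arcosh_sum:
  assumes "1 \<le> (a::real)" "1 \<le> b"
  shows "cosh (arcosh a + arcosh b) = a * b + sqrt ((a\<^sup>2 - 1) * (b\<^sup>2 - 1))"
proof -
  have s: "sinh (arcosh x) = sqrt (x\<^sup>2 - 1)" if "1 \<le> x" for x :: real
  proof -
    have "(sinh (arcosh x))\<^sup>2 = x\<^sup>2 - 1"
      using cosh_square_eq[of "arcosh x"] that by (simp add: cosh_arcosh_real)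
    moreover have "0 \<le> sinh (arcosh x)" using that by (simp add: arcosh_nonneg_real)
    ultimately show ?thesis by (metis real_sqrt_unique)
  qed
  show ?thesis using assms s by (simp add: cosh_add cosh_arcosh_real real_sqrt_mult)
qed

lemma arcosh_triangle:
  fixes a b c G :: real
  assumes "1 \<le> a" "1 \<le> b" "1 \<le> c" and G: "(a * b - c)\<^sup>2 + G = (a\<^sup>2 - 1) * (b\<^sup>2 - 1)"
  shows "0 \<le> G \<Longrightarrow> arcosh c \<le> arcosh a + arcosh b"
    and "G = 0 \<Longrightarrow> a * b \<le> c \<Longrightarrow> arcosh c = arcosh a + arcosh b"
    and "0 \<le> G \<Longrightarrow> arcosh c = arcosh a + arcosh b \<Longrightarrow> G = 0"
proof -
  let ?S = "sqrt ((a\<^sup>2 - 1) * (b\<^sup>2 - 1))"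
  have nn: "0 \<le> arcosh a" "0 \<le> arcosh b" "0 \<le> arcosh c"
    using assms by (auto intro: arcosh_nonneg_real)
  have cc: "cosh (arcosh c) = c" using assms by (simp add: cosh_arcosh_real)
  note cs = cosh_arcosh_sum[OF assms(1,2)]
  show "arcosh c \<le> arcosh a + arcosh b" if "0 \<le> G"
  proof -
    have "c - a * b \<le> ?S"
      by (rule real_le_rsqrt) (use G that in \<open>simp add: power2_commute\<close>)
    hence "cosh (arcosh c) \<le> cosh (arcosh a + arcosh b)" unfolding cs cc by simp
    thus ?thesis using nn by (simp add: cosh_real_nonneg_le_iff)
  qed
  show "arcosh c = arcosh a + arcosh b" if "G = 0" "a * b \<le> c"
  proof -
    have "?S = c - a * b"
      using G that by (intro real_sqrt_unique) (simp_all add: power2_commute)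
    hence "cosh (arcosh c) = cosh (arcosh a + arcosh b)" unfolding cs cc by simp
    thus ?thesis using nn by (metis add_nonneg_nonneg arcosh_cosh_real)
  qed
  show "G = 0" if "0 \<le> G" "arcosh c = arcosh a + arcosh b"
  proof -
    have S: "?S = c - a * b" using cs cc that(2) by simp
    have "0 \<le> (a\<^sup>2 - 1) * (b\<^sup>2 - 1)" using assms by (simp add: one_le_power)
    hence "(c - a * b)\<^sup>2 = (a\<^sup>2 - 1) * (b\<^sup>2 - 1)" by (metis S real_sqrt_pow2)
    thus ?thesis using G by (simp add: power2_commute)
  qed
qed

lemma model_plane_0 [simp]: "model_plane 0 = UNIV"
  by (auto simp: model_plane_def)

lemma convex_model_plane: "k \<le> 0 \<Longrightarrow> convex (model_plane k)"
proof (cases "k = 0")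
  case False
  assume "k \<le> 0"
  hence k: "k < 0" using False by simp
  have "z \<in> model_plane k \<longleftrightarrow> z \<in> ball 0 (1 / sqrt (- k))" for z :: complex
  proof -
    have "z \<in> model_plane k \<longleftrightarrow> (sqrt (- k) * norm z)\<^sup>2 < 1"
      using k by (auto simp: model_plane_def power_mult_distrib)
    also have "\<dots> \<longleftrightarrow> sqrt (- k) * norm z < 1"
      using k by (simp add: abs_square_less_1 abs_mult)
    also have "\<dots> \<longleftrightarrow> norm z < 1 / sqrt (- k)"
      using k by (simp add: pos_less_divide_eq mult.commute)
    finally show ?thesis by simp
  qed
  hence "model_plane k = ball 0 (1 / sqrt (- k))" by blast
  thus ?thesis by simp
qed simp

lemma open_model_plane: "open (model_plane k)"
  unfolding model_plane_def by (intro open_Collect_less continuous_intros)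

context
  fixes k :: real
  assumes k: "k \<le> 0"
begin

lemma model_dist_commute: "model_dist k z w = model_dist k w z"
  by (simp add: model_dist_def dist_commute inner_commute mult.commute)

lemma model_dist_self [simp]: "z \<in> model_plane k \<Longrightarrow> model_dist k z z = 0"
  using k by (cases "k = 0") (simp_all add: model_dist_cosh_dist cosh_dist_self, simp add: model_dist_def)

lemma model_dist_nonneg: "z \<in> model_plane k \<Longrightarrow> w \<in> model_plane k \<Longrightarrow> 0 \<le> model_dist k z w"
  using k cosh_dist_ge_1[of k z w]
  by (cases "k = 0") (simp_all add: model_dist_cosh_dist arcosh_nonneg_real, simp add: model_dist_def)

lemma model_dist_pos:
  assumes "z \<in> model_plane k" "w \<in> model_plane k" "z \<noteq> w" shows "0 < model_dist k z w"
proof (cases "k = 0")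
  case True
  thus ?thesis using assms by (simp add: model_dist_def)
next
  case False
  hence "0 < arcosh (cosh_dist k z w)"
    using cosh_dist_gt_1[of k z w] assms k arcosh_real_strict_mono[of 1 "cosh_dist k z w"] by simp
  thus ?thesis using False k by (simp add: model_dist_cosh_dist)
qed

lemma model_dist_triangle:
  assumes "z \<in> model_plane k" "w \<in> model_plane k" "v \<in> model_plane k"
  shows "model_dist k z v \<le> model_dist k z w + model_dist k w v"
proof (cases "k = 0")
  case True
  thus ?thesis by (simp add: model_dist_def dist_triangle)
next
  case False
  hence k': "k < 0" using k by simp
  have "arcosh (cosh_dist k z v) \<le> arcosh (cosh_dist k z w) + arcosh (cosh_dist k w v)"
    by (rule arcosh_triangle(1)[OF _ _ _ cosh_dist_Gram[OF assms]])
       (use assms k' cosh_dist_ge_1 lorentz_self_pos in \<open>auto simp: less_imp_le\<close>)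
  thus ?thesis using k' by (simp add: model_dist_cosh_dist flip: add_divide_distrib)
                           (simp add: divide_right_mono)
qed

lemma signed_area_closed_segment:
  assumes "w \<in> closed_segment z v" shows "signed_area z w v = 0"
proof -
  obtain u where w: "w = (1 - u) *\<^sub>R z + u *\<^sub>R v" using assms by (auto simp: in_segment)
  show ?thesis unfolding w signed_area_def by simp algebra
qed

lemma model_dist_additive:
  assumes zv: "z \<in> model_plane k" "v \<in> model_plane k" and w: "w \<in> closed_segment z v"
  shows "model_dist k z v = model_dist k z w + model_dist k w v"
proof (cases "k = 0")
  case True
  thus ?thesis using w by (simp add: model_dist_def between_mem_segment[symmetric] between)
next
  case False
  hence k': "k < 0" using k by simp
  have wm: "w \<in> model_plane k"
    using closed_segment_subset[OF zv convex_model_plane[OF k]] w by blast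
  obtain u where u: "0 \<le> u" "u \<le> 1" "w = (1 - u) *\<^sub>R z + u *\<^sub>R v"
    using w by (auto simp: in_segment)
  \<comment> \<open>the sign that excludes the other root, where the sides are subtracted\<close>
  have 1: "lorentz k z v * lorentz k w w - lorentz k z w * lorentz k w v = u * (1 - u) * ((lorentz k z v)\<^sup>2 - lorentz k z z * lorentz k v v)"
    unfolding lorentz_def inner_complex_def u(3) by (simp add: power2_eq_square) algebra
  have 2: "0 \<le> (lorentz k z v)\<^sup>2 - lorentz k z z * lorentz k v v"
    using reverse_Cauchy_Schwarz_strict[OF k' zv(1)] by (cases "z = v") (auto simp: power2_eq_square less_imp_le)
  have 3: "lorentz k z w * lorentz k w v \<le> lorentz k z v * lorentz k w w"
    using 1 2 u(1,2) by (smt (verit) mult_nonneg_nonneg)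
  have "cosh_dist k z w * cosh_dist k w v \<le> cosh_dist k z v"
  proof -
    define x y t where "x = sqrt (lorentz k z z)" "y = sqrt (lorentz k w w)" "t = sqrt (lorentz k v v)"
    have p: "0 < x" "0 < y" "0 < t" using zv wm lorentz_self_pos by (simp_all add: x_y_t_def)
    have "lorentz k w w = y * y" using wm lorentz_self_pos by (simp add: x_y_t_def less_imp_le)
    thus ?thesis using 3 p unfolding cosh_dist_def x_y_t_def[symmetric]
      by (simp add: field_simps)
  qed
  hence "arcosh (cosh_dist k z v) = arcosh (cosh_dist k z w) + arcosh (cosh_dist k w v)"
    by (intro arcosh_triangle(2)[OF _ _ _ cosh_dist_Gram[OF zv(1) wm zv(2)]])
       (use zv wm k' cosh_dist_ge_1 signed_area_closed_segment[OF w] in auto)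
  thus ?thesis using k' by (simp add: model_dist_cosh_dist add_divide_distrib)
qed

lemma collinear_signed_area:
  assumes "signed_area z w v = 0" shows "collinear {z, w, v}"
proof (cases "z = v")
  case True thus ?thesis by (metis collinear_2 insert_absorb2 insert_commute)
next
  case False
  have e: "(Re w - Re z) * (Im v - Im z) = (Im w - Im z) * (Re v - Re z)"
    using assms by (simp add: signed_area_def)
  have "\<exists>c. w - z = c *\<^sub>R (v - z)"
  proof (cases "Re v = Re z")
    case True
    hence n: "Im v \<noteq> Im z" using False complex_eq_iff by metis
    have "w - z = ((Im w - Im z) / (Im v - Im z)) *\<^sub>R (v - z)"
      using e n True by (simp add: complex_eq_iff)
    thus ?thesis by blast
  next
    case n: False
    have "w - z = ((Re w - Re z) / (Re v - Re z)) *\<^sub>R (v - z)"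
      using e n by (simp add: complex_eq_iff)
    thus ?thesis by blast
  qed
  hence "collinear {0, v - z, w - z}" by (simp add: collinear_lemma)
  hence "collinear {v, z, w}" by (subst collinear_3) auto
  thus ?thesis by (simp add: insert_commute)
qed

text \<open>Equality makes the Gram determinant vanish, so the points are collinear, and additivity along segments
  rules out the other two orders of collinear points.\<close>

lemma model_dist_eq_imp_segment:
  assumes "z \<in> model_plane k" "w \<in> model_plane k" "v \<in> model_plane k"
    and eq: "model_dist k z v = model_dist k z w + model_dist k w v"
  shows "w \<in> closed_segment z v"
proof (cases "k = 0")
  case True
  thus ?thesis using eq by (simp add: model_dist_def between_mem_segment[symmetric] between)
next
  case False
  hence k': "k < 0" using k by simp
  have "arcosh (cosh_dist k z v) = arcosh (cosh_dist k z w) + arcosh (cosh_dist k w v)"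
    using eq k' by (simp add: model_dist_cosh_dist flip: add_divide_distrib)
  hence "(k * signed_area z w v)\<^sup>2 / (lorentz k z z * lorentz k w w * lorentz k v v) = 0"
    by (intro arcosh_triangle(3)[OF _ _ _ cosh_dist_Gram[OF assms(1-3)]])
       (use assms k' cosh_dist_ge_1 lorentz_self_pos in \<open>auto simp: less_imp_le\<close>)
  hence "signed_area z w v = 0"
    using k' lorentz_self_pos[OF assms(1)] lorentz_self_pos[OF assms(2)] lorentz_self_pos[OF assms(3)] by auto
  hence "collinear {z, w, v}" by (rule collinear_signed_area)
  then consider "between (w, v) z" | "between (v, z) w" | "between (z, w) v"
    using collinear_between_cases by blast
  thus ?thesis
  proof cases
    case 1
    hence "model_dist k w v = model_dist k w z + model_dist k z v"
      using model_dist_additive assms by (simp add: between_mem_segment)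
    hence "model_dist k z w = 0"
      using eq model_dist_commute[of w z] model_dist_nonneg[OF assms(1,2)] by linarith
    hence "z = w" using model_dist_pos[OF assms(1,2)] by force
    thus ?thesis by simp
  next
    case 2
    thus ?thesis by (simp add: between_mem_segment closed_segment_commute)
  next
    case 3
    hence "model_dist k z w = model_dist k z v + model_dist k v w"
      using model_dist_additive assms by (simp add: between_mem_segment)
    hence "model_dist k w v = 0"
      using eq model_dist_commute[of w v] model_dist_nonneg[OF assms(2,3)] by linarith
    hence "w = v" using model_dist_pos[OF assms(2,3)] by force
    thus ?thesis by simp
  qed
qed

lemma continuous_on_model_dist:
  "continuous_on (model_plane k \<times> model_plane k) (\<lambda>p. model_dist k (fst p) (snd p))"
proof (cases "k = 0")
  case True
  thus ?thesis by (simp add: model_dist_def) (intro continuous_intros)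
next
  case False
  hence k': "k < 0" using k by simp
  have "continuous_on (model_plane k \<times> model_plane k)
          (\<lambda>p. arcosh (cosh_dist k (fst p) (snd p)) / sqrt (- k))"
  proof -
    have "continuous_on (model_plane k \<times> model_plane k) (\<lambda>p. cosh_dist k (fst p) (snd p))"
      unfolding cosh_dist_def lorentz_def
      by (intro continuous_intros) (auto simp: lorentz_def[symmetric] dest: lorentz_self_pos)
    hence "continuous_on (model_plane k \<times> model_plane k) (\<lambda>p. arcosh (cosh_dist k (fst p) (snd p)))"
      by (rule continuous_on_compose2[OF continuous_on_arcosh[OF order_refl]]) (use k' cosh_dist_ge_1 in auto)
    thus ?thesis using k' by (intro continuous_intros) auto
  qed
  thus ?thesis using k' by (simp add: model_dist_cosh_dist)
qed

lemma continuous_on_model_dist_comp: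
  assumes "continuous_on A f" "continuous_on A g" "f ` A \<subseteq> model_plane k" "g ` A \<subseteq> model_plane k"
  shows "continuous_on A (\<lambda>x. model_dist k (f x) (g x))"
  using continuous_on_compose2[OF continuous_on_model_dist continuous_on_Pair[OF assms(1,2)]] assms(3,4)
  by auto

lemma tendsto_model_dist:
  assumes "(f \<longlongrightarrow> z) F" "(g \<longlongrightarrow> w) F" "z \<in> model_plane k" "w \<in> model_plane k"
  shows "((\<lambda>x. model_dist k (f x) (g x)) \<longlongrightarrow> model_dist k z w) F"
proof -
  have "open (model_plane k \<times> model_plane k)" by (intro open_Times open_model_plane)
  hence "isCont (\<lambda>p. model_dist k (fst p) (snd p)) (z, w)"
    using continuous_on_model_dist assms(3,4) continuous_on_eq_continuous_at by blast
  from isCont_tendsto_compose[OF this tendsto_Pair[OF assms(1,2)]] show ?thesis by simp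
qed

end

section \<open>Betweenness in CAT(0) spaces\<close>

locale CAT0 =
  fixes M :: "'a set" and d :: "'a \<Rightarrow> 'a \<Rightarrow> real"
  assumes CAT0: "CAT0_space M d"
begin

sublocale Metric_space M d
  using CAT0 by (simp add: CAT0_space_def geodesic_space_def)

text \<open>In a geodesic space this says that \<open>x\<close> lies on a geodesic from \<open>a\<close> to \<open>b\<close>. Concatenating and prolonging
  geodesics becomes arithmetic with this relation, without parametrizations.\<close>

definition btw :: "'a \<Rightarrow> 'a \<Rightarrow> 'a \<Rightarrow> bool" where
  "btw a x b \<longleftrightarrow> a \<in> M \<and> x \<in> M \<and> b \<in> M \<and> d a x + d x b = d a b"

lemma btw_M: "btw a x b \<Longrightarrow> a \<in> M" "btw a x b \<Longrightarrow> x \<in> M" "btw a x b \<Longrightarrow> b \<in> M"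
  by (auto simp: btw_def)

lemma btw_sym: "btw a x b \<Longrightarrow> btw b x a"
  by (simp add: btw_def commute)

lemma btw_right: "a \<in> M \<Longrightarrow> b \<in> M \<Longrightarrow> btw a b b"
  by (simp add: btw_def)

lemma btw_trans: "btw a x b \<Longrightarrow> btw a b c \<Longrightarrow> btw a x c"
  unfolding btw_def using triangle[of x b c] triangle[of a x c] by auto

lemma btw_inner: "btw a x b \<Longrightarrow> btw a b c \<Longrightarrow> btw x b c"
  unfolding btw_def using triangle[of x b c] triangle[of a x c] by auto

lemma geodesic_exists:
  assumes "p \<in> M" "q \<in> M" obtains S where "geodesic_segment M d p q S"
  using CAT0 assms unfolding CAT0_space_def geodesic_space_def by blast

text \<open>A geodesic from \<open>p\<close> to \<open>x\<close> followed by one from \<open>x\<close> to \<open>q\<close> has the length \<open>d p q\<close>, so it is a geodesic.\<close>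

lemma geodesic_through:
  assumes "btw p x q"
  obtains S where "geodesic_segment M d p q S" "x \<in> S"
proof -
  note M = btw_M[OF assms] and eq = assms[unfolded btw_def]
  obtain S1 where "geodesic_segment M d p x S1" using geodesic_exists M by blast
  then obtain c1 where c1: "c1 ` {0..d p x} \<subseteq> M" "c1 0 = p" "c1 (d p x) = x"
    "\<And>s t. s \<in> {0..d p x} \<Longrightarrow> t \<in> {0..d p x} \<Longrightarrow> d (c1 s) (c1 t) = \<bar>s - t\<bar>"
    unfolding geodesic_segment_def by metis
  obtain S2 where "geodesic_segment M d x q S2" using geodesic_exists M by blast
  then obtain c2 where c2: "c2 ` {0..d x q} \<subseteq> M" "c2 0 = x" "c2 (d x q) = q"
    "\<And>s t. s \<in> {0..d x q} \<Longrightarrow> t \<in> {0..d x q} \<Longrightarrow> d (c2 s) (c2 t) = \<bar>s - t\<bar>"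
    unfolding geodesic_segment_def by metis
  define c where "c t = (if t \<le> d p x then c1 t else c2 (t - d p x))" for t
  have cM: "c t \<in> M" if "t \<in> {0..d p q}" for t
  proof (cases "t \<le> d p x")
    case True thus ?thesis using c1(1) that by (auto simp: c_def)
  next
    case False thus ?thesis using c2(1) that eq by (auto simp: c_def image_subset_iff)
  qed
  have c0: "c 0 = p" using c1 by (simp add: c_def)
  have cq: "c (d p q) = q"
  proof (cases "d p q \<le> d p x")
    case True
    hence "d x q = 0" using eq nonneg[of x q] by linarith
    thus ?thesis using True c1 c2 M eq by (simp add: c_def)
  next
    case False thus ?thesis using c2 eq by (simp add: c_def) (metis add_diff_cancel_left')
  qed
  have iso: "d (c s) (c t) = \<bar>s - t\<bar>" if st: "s \<in> {0..d p q}" "t \<in> {0..d p q}" "s \<le> t" for s t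
  proof -
    consider "t \<le> d p x" | "d p x < s" | "s \<le> d p x" "d p x < t" by linarith
    thus ?thesis
    proof cases
      case 1 thus ?thesis using c1(4)[of s t] st by (simp add: c_def)
    next
      case 2 thus ?thesis using c2(4)[of "s - d p x" "t - d p x"] st eq by (simp add: c_def)
    next
      case 3
      have in1: "s \<in> {0..d p x}" "0 \<in> {0..d p x}" "d p x \<in> {0..d p x}" using st 3 by auto
      have in2: "t - d p x \<in> {0..d x q}" "0 \<in> {0..d x q}" "d x q \<in> {0..d x q}" using st 3 eq by auto
      have a: "d (c s) x = d p x - s" "d p (c s) = s"
        using c1(4)[OF in1(1,3)] c1(4)[OF in1(2,1)] c1(2,3) 3 st by (simp_all add: c_def)
      have b: "d x (c t) = t - d p x" "d (c t) q = d p q - t"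
        using c2(4)[OF in2(2,1)] c2(4)[OF in2(1,3)] c2(2,3) 3 st eq by (simp_all add: c_def)
      note Ms = cM[OF st(1)] cM[OF st(2)]
      have "d (c s) (c t) \<le> t - s" using triangle[OF Ms(1) M(2) Ms(2)] a b by simp
      moreover have "d p q \<le> d p (c s) + d (c s) (c t) + d (c t) q"
        using triangle[OF M(1) Ms(1) M(3)] triangle[OF Ms(1,2) M(3)] by linarith
      ultimately show ?thesis using a b st by linarith
    qed
  qed
  have iso': "d (c s) (c t) = \<bar>s - t\<bar>" if st: "s \<in> {0..d p q}" "t \<in> {0..d p q}" for s t
    using iso[OF st] iso[OF st(2,1)] commute[of "c s" "c t"] by (cases "s \<le> t") auto
  have "geodesic_segment M d p q (c ` {0..d p q})"
    unfolding geodesic_segment_def using cM c0 cq iso' by blast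
  moreover have "d p x \<le> d p q" using eq nonneg[of x q] by linarith
  hence "x \<in> c ` {0..d p q}"
    using c1(3) by (intro image_eqI[of _ _ "d p x"]) (auto simp: c_def)
  ultimately show thesis using that by blast
qed

lemma comparison:
  fixes p' q' r' x' y' :: complex
  assumes "btw p x q" "btw p y r"
    and "dist p' q' = d p q" "dist p' r' = d p r" "dist q' r' = d q r"
    and "x' \<in> closed_segment p' q'" "y' \<in> closed_segment p' r'"
    and "dist p' x' = d p x" "dist p' y' = d p y"
  shows "d x y \<le> dist x' y'"
proof -
  obtain S where "geodesic_segment M d p q S" "x \<in> S" using geodesic_through[OF assms(1)] .
  moreover obtain T where "geodesic_segment M d p r T" "y \<in> T" using geodesic_through[OF assms(2)] .
  ultimately show ?thesis
    using CAT0 assms btw_M[OF assms(1)] btw_M[OF assms(2)] unfolding CAT0_space_def by blast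
qed

lemma convex_btw:
  assumes "geodesically_convex M d C" "p \<in> C" "q \<in> C" "btw p x q" shows "x \<in> C"
proof -
  obtain S where "geodesic_segment M d p q S" "x \<in> S" using geodesic_through[OF assms(4)] .
  thus ?thesis using assms(1-3) unfolding geodesically_convex_def by blast
qed

text \<open>Uniqueness of geodesics: the comparison triangle of \<open>p\<close>, \<open>q\<close>, \<open>q\<close> is degenerate, and it bounds
  \<open>d x y\<close> by the difference of the distances to \<open>p\<close>.\<close>

lemma btw_linear:
  assumes "btw p x q" "btw p y q" "d p x \<le> d p y"
  shows "btw p x y"
proof -
  note M = btw_M[OF assms(1)] btw_M[OF assms(2)]
  have le: "d p x \<le> d p q" "d p y \<le> d p q"
    using assms nonneg[of x q] nonneg[of y q] unfolding btw_def by linarith+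
  have seg: "complex_of_real t \<in> closed_segment 0 (complex_of_real (d p q))" if "0 \<le> t" "t \<le> d p q" for t
  proof (cases "d p q = 0")
    case False
    hence "complex_of_real t = (t / d p q) *\<^sub>R complex_of_real (d p q)"
      by (simp add: scaleR_conv_of_real)
    moreover have "0 \<le> t / d p q" "t / d p q \<le> 1" using that by (auto simp: divide_le_eq_1)
    ultimately show ?thesis unfolding in_segment by (intro exI[of _ "t / d p q"]) simp
  qed (use that in auto)
  have "d x y \<le> dist (complex_of_real (d p x)) (complex_of_real (d p y))"
    by (rule comparison[OF assms(1,2), where p' = 0 and q' = "complex_of_real (d p q)"
          and r' = "complex_of_real (d p q)"])
       (use le seg M in \<open>auto simp: mdist_zero\<close>)
  also have "\<dots> = d p y - d p x"
    using assms(3) by (metis abs_minus_commute abs_of_nonneg diff_ge_0_iff_ge dist_norm norm_of_real of_real_diff)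
  finally have "d p x + d x y \<le> d p y" by simp
  thus ?thesis using triangle[of p x y] M unfolding btw_def by force
qed

text \<open>Both \<open>u\<close> and \<open>v\<close> lie on the geodesic from \<open>p\<close> to \<open>q\<close>, hence so does the geodesic between them.\<close>

lemma btw_merge:
  assumes u: "btw p u q" and v: "btw p v q" and y: "btw u y v" shows "btw p y q"
proof -
  have *: "btw p y q" if "btw p u q" "btw p v q" "btw u y v" "d p u \<le> d p v" for u v
  proof -
    have "btw p u v" using btw_linear that by blast
    thus ?thesis using that triangle[of p u y] triangle[of y v q] triangle[of p y q] unfolding btw_def by force
  qed
  show ?thesis using *[OF u v y] *[OF v u btw_sym[OF y]] by (cases "d p u \<le> d p v") auto
qed

lemma btw_point_exists:
  assumes "a \<in> M" "b \<in> M" "0 \<le> t" "t \<le> d a b"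
  obtains x where "btw a x b" "d a x = t"
proof -
  obtain S where "geodesic_segment M d a b S" using geodesic_exists assms by blast
  then obtain c where c: "c ` {0..d a b} \<subseteq> M" "c 0 = a" "c (d a b) = b"
    "\<And>s t. s \<in> {0..d a b} \<Longrightarrow> t \<in> {0..d a b} \<Longrightarrow> d (c s) (c t) = \<bar>s - t\<bar>"
    unfolding geodesic_segment_def by metis
  have "c t \<in> M" "d (c 0) (c t) = t" "d (c t) (c (d a b)) = d a b - t"
    using c(1) c(4)[of 0 t] c(4)[of t "d a b"] assms by auto
  thus thesis using that[of "c t"] assms c by (auto simp: btw_def)
qed

text \<open>If the two sides issuing from a corner are almost opposite, the corner is almost on the third
  side; the estimate is the Euclidean one for the comparison triangle.\<close>

lemma almost_straight:
  assumes x: "btw q x a" "x \<noteq> q" and y: "btw q y b" "y \<noteq> q"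
    and xy: "d q x + d q y - \<eta> \<le> d x y" and D: "d q a \<le> D" "d q b \<le> D"
  obtains p where "btw a p b"
    "d q p \<le> D * sqrt (2 * \<eta> * (d q x + d q y) / (d q x * d q y))"
proof -
  note M = btw_M[OF x(1)] btw_M[OF y(1)]
  define \<alpha> \<beta> s t where "\<alpha> = d q a" "\<beta> = d q b" "s = d q x" "t = d q y"
  have st: "0 < s" "0 < t" using x(2) y(2) M nonneg[of q x] nonneg[of q y] zero[of q x] zero[of q y]
    unfolding \<alpha>_\<beta>_s_t_def by (metis less_eq_real_def)+
  have le: "s \<le> \<alpha>" "t \<le> \<beta>"
    using x y nonneg[of x a] nonneg[of y b] unfolding btw_def \<alpha>_\<beta>_s_t_def by linarith+
  have pos: "0 < \<alpha>" "0 < \<beta>" using st le by linarith+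
  define \<gamma> where "\<gamma> = d a b"
  have tri: "\<gamma> \<le> \<alpha> + \<beta>" "\<alpha> \<le> \<beta> + \<gamma>" "\<beta> \<le> \<alpha> + \<gamma>"
    using triangle[of a q b] triangle[of q b a] triangle[of q a b] M
    by (simp_all add: \<alpha>_\<beta>_s_t_def \<gamma>_def commute)
  \<comment> \<open>\<open>C\<close> is the cosine of the angle at \<open>q\<close> of the comparison triangle \<open>0\<close>, \<open>?a\<close>, \<open>?b\<close>\<close>
  define C where "C = (\<alpha>\<^sup>2 + \<beta>\<^sup>2 - \<gamma>\<^sup>2) / (2 * \<alpha> * \<beta>)"
  have C1: "-1 \<le> C"
  proof -
    have "\<gamma>\<^sup>2 \<le> (\<alpha> + \<beta>)\<^sup>2" using tri(1) by (intro power_mono) (auto simp: \<gamma>_def)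
    thus ?thesis using pos by (simp add: C_def field_simps power2_eq_square)
  qed
  have C2: "C \<le> 1"
  proof -
    have "\<bar>\<alpha> - \<beta>\<bar>\<^sup>2 \<le> \<gamma>\<^sup>2" using tri by (intro power_mono) auto
    thus ?thesis using pos by (simp add: C_def field_simps power2_eq_square)
  qed
  define \<theta> where "\<theta> = arccos C"
  define u where "u = cis \<theta>"
  have Cu: "Re u = C" "norm u = 1" using C1 C2 by (simp_all add: u_def \<theta>_def)
  have lawC: "(dist (complex_of_real m) (n *\<^sub>R u))\<^sup>2 = m\<^sup>2 + n\<^sup>2 - 2 * m * n * C" for m n
  proof -
    have "(Re u)\<^sup>2 + (Im u)\<^sup>2 = 1" using Cu(2) by (metis cmod_power2 one_power2)
    hence "n\<^sup>2 * ((Re u)\<^sup>2 + (Im u)\<^sup>2) = n\<^sup>2" by simp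
    thus ?thesis unfolding dist_norm cmod_power2 using Cu(1) by (simp add: power2_eq_square algebra_simps)
  qed
  let ?a = "complex_of_real \<alpha>" and ?b = "\<beta> *\<^sub>R u"
  have ab: "dist ?a ?b = \<gamma>"
  proof -
    have "(dist ?a ?b)\<^sup>2 = \<gamma>\<^sup>2" unfolding lawC using pos by (simp add: C_def field_simps)
    thus ?thesis by (simp add: \<gamma>_def)
  qed
  have seg: "(m/n) *\<^sub>R (n *\<^sub>R w) \<in> closed_segment 0 (n *\<^sub>R w)" if "0 \<le> m" "m \<le> n" "0 < n" for m n and w :: complex
    unfolding in_segment by (rule exI[of _ "m / n"]) (use that in simp)
  have x': "complex_of_real s \<in> closed_segment 0 ?a"
    using seg[of s \<alpha> 1] st le pos by (simp add: scaleR_conv_of_real)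
  have y': "t *\<^sub>R u \<in> closed_segment 0 ?b" using seg[of t \<beta> u] st le pos by simp
  have "d x y \<le> dist (complex_of_real s) (t *\<^sub>R u)"
    by (rule comparison[OF x(1) y(1), where p' = 0 and q' = ?a and r' = ?b])
       (use x' y' ab Cu st pos in \<open>simp_all add: \<gamma>_def, simp_all add: \<alpha>_\<beta>_s_t_def\<close>)
  hence 1: "s + t - \<eta> \<le> dist (complex_of_real s) (t *\<^sub>R u)" using xy by (simp add: \<alpha>_\<beta>_s_t_def)
  define L where "L = dist (complex_of_real s) (t *\<^sub>R u)"
  have Lst: "L \<le> s + t" using norm_triangle_ineq4[of "complex_of_real s" "t *\<^sub>R u"] Cu st
    by (simp add: L_def dist_norm)
  have "2 * s * t * (1 + C) = (s + t)\<^sup>2 - L\<^sup>2" unfolding L_def lawC by (simp add: power2_eq_square algebra_simps)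
  also have "\<dots> = (s + t - L) * (s + t + L)" by (simp add: power2_eq_square algebra_simps)
  also have "\<dots> \<le> \<eta> * (2 * (s + t))"
    by (rule mult_mono) (use 1 Lst st in \<open>auto simp: L_def\<close>)
  finally have "2 * (s * t) * (1 + C) \<le> 2 * (\<eta> * (s + t))"
    by (simp add: algebra_simps)
  hence C3: "2 * (1 + C) \<le> 2 * \<eta> * (s + t) / (s * t)"
    by (subst pos_le_divide_eq) (use st in \<open>simp_all add: algebra_simps\<close>)
  \<comment> \<open>the foot of the bisector of the angle at \<open>q\<close>, which is short because \<open>u\<close> is close to \<open>- 1\<close>\<close>
  let ?p = "complex_of_real (\<alpha> * \<beta> / (\<alpha> + \<beta>)) * (1 + u)"
  define \<tau> where "\<tau> = \<alpha> / (\<alpha> + \<beta>)"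
  have \<tau>: "0 \<le> \<tau>" "\<tau> \<le> 1" "1 - \<tau> = \<beta> / (\<alpha> + \<beta>)" using pos by (auto simp: \<tau>_def field_simps)
  have pp: "?p = (1 - \<tau>) *\<^sub>R ?a + \<tau> *\<^sub>R ?b"
    unfolding \<tau>(3)
    by (simp add: \<tau>_def scaleR_conv_of_real add_divide_distrib algebra_simps)
  hence pseg: "?p \<in> closed_segment ?a ?b" unfolding in_segment using \<tau> by blast
  have dap: "dist ?a ?p = \<tau> * \<gamma>"
  proof -
    have "?a - ?p = \<tau> *\<^sub>R (?a - ?b)" unfolding pp by (simp add: algebra_simps)
    thus ?thesis using \<tau>(1) ab by (metis abs_of_nonneg dist_norm norm_scaleR)
  qed
  have "\<tau> * \<gamma> \<le> 1 * \<gamma>" by (rule mult_right_mono) (use \<tau> in \<open>auto simp: \<gamma>_def\<close>)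
  moreover have "0 \<le> \<tau> * \<gamma>" using \<tau> by (simp add: \<gamma>_def)
  ultimately obtain p where p: "btw a p b" "d a p = \<tau> * \<gamma>"
    using btw_point_exists[of a b "\<tau> * \<gamma>"] M by (auto simp: \<gamma>_def)
  have "d q p \<le> dist 0 ?p"
    by (rule comparison[OF btw_right[OF M(3,1)] p(1), where p' = ?a and q' = 0 and r' = ?b])
       (use ab pseg dap p(2) pos Cu in \<open>simp_all add: \<gamma>_def dist_commute, simp_all add: \<alpha>_\<beta>_s_t_def commute\<close>)
  also have "\<dots> = \<alpha> * \<beta> / (\<alpha> + \<beta>) * norm (1 + u)"
    unfolding dist_0_norm norm_mult norm_of_real using pos by simp
  also have "norm (1 + u) = sqrt (2 * (1 + C))"
  proof -
    have "(Im u)\<^sup>2 = 1 - C\<^sup>2" using Cu cmod_power2[of u] by simp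
    hence "(norm (1 + u))\<^sup>2 = 2 * (1 + C)"
      unfolding cmod_power2 using Cu(1) by (simp add: power2_eq_square algebra_simps)
    thus ?thesis by (metis norm_ge_zero real_sqrt_unique)
  qed
  also have "\<alpha> * \<beta> / (\<alpha> + \<beta>) * sqrt (2 * (1 + C)) \<le> D * sqrt (2 * \<eta> * (s + t) / (s * t))"
  proof (rule mult_mono)
    have "\<alpha> * \<beta> \<le> \<alpha> * (\<alpha> + \<beta>)" using pos by (simp add: distrib_left)
    hence "\<alpha> * \<beta> / (\<alpha> + \<beta>) \<le> \<alpha>"
      by (subst pos_divide_le_eq) (use pos in simp_all)
    thus "\<alpha> * \<beta> / (\<alpha> + \<beta>) \<le> D" using D by (simp add: \<alpha>_\<beta>_s_t_def)
    show "0 \<le> D" using D pos by (simp add: \<alpha>_\<beta>_s_t_def)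
    show "sqrt (2 * (1 + C)) \<le> sqrt (2 * \<eta> * (s + t) / (s * t))"
      using C3 by (rule real_sqrt_le_mono)
    show "0 \<le> sqrt (2 * (1 + C))" using C1 by simp
  qed
  finally show thesis using that p(1) by (simp add: \<alpha>_\<beta>_s_t_def)
qed

text \<open>Without error the corner lies on the third side: two geodesics that fit together near their common
  end form a geodesic.\<close>

lemma btw_extend:
  assumes "btw a x q" "x \<noteq> q" "btw q y b" "y \<noteq> q" "btw x q y"
  shows "btw a q b"
proof -
  have "d q x + d q y - 0 \<le> d x y" using assms(5) by (simp add: btw_def commute)
  then obtain p where "btw a p b"
    "d q p \<le> max (d q a) (d q b) * sqrt (2 * 0 * (d q x + d q y) / (d q x * d q y))"
    by (rule almost_straight[OF btw_sym[OF assms(1)] assms(2-4) _ max.cobounded1 max.cobounded2])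
  moreover from this have "q = p"
    using zero[of q p] nonneg[of q p] assms(5) by (auto simp: btw_def)
  ultimately show ?thesis by simp
qed

text \<open>Geodesics that overlap are joined by \<open>btw_extend\<close>, \<open>\<delta>\<close> being added to the length of the interval in each
  step. The strictly increasing \<open>l\<close> spares a change to arc length.\<close>

lemma local_geodesic:
  fixes c :: "real \<Rightarrow> 'a" and l :: "real \<Rightarrow> real"
  assumes cM: "\<And>s. s \<in> {0..1} \<Longrightarrow> c s \<in> M"
    and mono: "\<And>s t. 0 \<le> s \<Longrightarrow> s < t \<Longrightarrow> t \<le> 1 \<Longrightarrow> l s < l t"
    and "0 < \<delta>"
    and loc: "\<And>s t. 0 \<le> s \<Longrightarrow> s \<le> t \<Longrightarrow> t \<le> 1 \<Longrightarrow> t - s \<le> 2 * \<delta> \<Longrightarrow> d (c s) (c t) = l t - l s"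
    and "0 \<le> s" "s \<le> t" "t \<le> 1"
  shows "d (c s) (c t) = l t - l s"
proof -
  have "d (c s) (c t) = l t - l s" if "0 \<le> s" "s \<le> t" "t \<le> 1" "t - s \<le> real (Suc n) * \<delta>" for s t n
    using that
  proof (induction n arbitrary: s t)
    case 0
    thus ?case using loc[of s t] \<open>0 < \<delta>\<close> by auto
  next
    case (Suc n)
    show ?case
    proof (cases "t - s \<le> \<delta>")
      case True thus ?thesis using Suc loc[of s t] \<open>0 < \<delta>\<close> by auto
    next
      case False
      \<comment> \<open>the interval from \<open>s\<close> to \<open>m\<close> is known, and so is the short one from \<open>r\<close> to \<open>t\<close>; they overlap between \<open>r\<close> and \<open>m\<close>\<close>
      define m where "m = t - \<delta>"
      define r where "r = max s (m - \<delta>)"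
      have m: "s < m" "m < t" using False \<open>0 < \<delta>\<close> by (auto simp: m_def)
      have r: "s \<le> r" "r < m" "t - r \<le> 2 * \<delta>" using m \<open>0 < \<delta>\<close> by (auto simp: r_def m_def)
      note in01 = Suc.prems m r
      have sm: "m - s \<le> real (Suc n) * \<delta>" using Suc.prems(4) by (simp add: m_def algebra_simps)
      have rm: "m - r \<le> real (Suc n) * \<delta>" "r - s \<le> real (Suc n) * \<delta>" using sm r by linarith+
      have a: "d (c s) (c m) = l m - l s" "d (c s) (c r) = l r - l s" "d (c r) (c m) = l m - l r"
        using Suc.IH[OF _ _ _ sm] Suc.IH[OF _ _ _ rm(1)] Suc.IH[OF _ _ _ rm(2)] in01 by auto
      have b: "d (c r) (c t) = l t - l r" "d (c m) (c t) = l t - l m"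
        using loc[of r t] loc[of m t] in01 by auto
      have Ms: "c s \<in> M" "c r \<in> M" "c m \<in> M" "c t \<in> M" using cM in01 by auto
      have "btw (c s) (c m) (c t)"
      proof (rule btw_extend[of _ "c r" _ "c t"])
        show "c r \<noteq> c m" using a(3) mono[of r m] in01 Ms by force
        show "c t \<noteq> c m" using b(2) mono[of m t] in01 Ms by force
      qed (use a b Ms in \<open>auto simp: btw_def\<close>)
      thus ?thesis using a b by (simp add: btw_def)
    qed
  qed
  moreover obtain n where "t - s \<le> real (Suc n) * \<delta>"
  proof -
    obtain n where "(t - s) / \<delta> \<le> real n" using real_arch_simple by blast
    hence "t - s \<le> real n * \<delta>" using \<open>0 < \<delta>\<close> by (simp add: field_simps)
    thus thesis using that[of n] \<open>0 < \<delta>\<close> by (simp add: algebra_simps)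
  qed
  ultimately show ?thesis using assms by blast
qed

end

section \<open>Simple polygons in the plane\<close>

locale plane_polygon =
  fixes ps :: "complex list"
  assumes simple: "simple_polygon ps"
begin

abbreviation n :: nat where "n \<equiv> length ps"
abbreviation nxt :: "nat \<Rightarrow> nat" where "nxt i \<equiv> (i + 1) mod n"
abbreviation intr :: "complex set" where "intr \<equiv> polygon_interior ps"
abbreviation bd :: "complex set" where "bd \<equiv> polygon_boundary ps"

definition open_side :: "nat \<Rightarrow> complex set" where
  "open_side i = open_segment (ps ! i) (ps ! nxt i)"

lemma n3: "3 \<le> n" and dist_ps: "distinct ps"
  and sides_Int: "i < n \<Longrightarrow> j < n \<Longrightarrow> i \<noteq> j \<Longrightarrow>
    side ps i \<inter> side ps j = {ps ! i, ps ! nxt i} \<inter> {ps ! j, ps ! nxt j}"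
  using simple by (auto simp: simple_polygon_def)

lemma n_pos: "0 < n" using n3 by linarith

lemma ps_nonempty [simp]: "ps \<noteq> []" using n3 by auto

lemma nxt_less: "nxt i < n" by (rule mod_less_divisor) (rule n_pos)

lemma nxt_neq: "i < n \<Longrightarrow> nxt i \<noteq> i"
  using n3 by (cases "i + 1 < n") (auto simp: mod_if)

lemma prev_exists:
  assumes "i < n" obtains j where "j < n" "j \<noteq> i" "nxt j = i"
proof (cases "i = 0")
  case True
  thus ?thesis using n3 by (intro that[of "n - 1"]) auto
next
  case False
  thus ?thesis using that[of "i - 1"] assms by simp
qed

lemma corner_neq: "i < n \<Longrightarrow> ps ! i \<noteq> ps ! nxt i"
  using dist_ps nxt_less nxt_neq by (metis nth_eq_iff_index_eq)

lemma side_cases: "z \<in> side ps i \<longleftrightarrow> z \<in> open_side i \<or> z = ps ! i \<or> z = ps ! nxt i"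
  by (auto simp: side_def open_side_def open_segment_def)

lemma open_side_subset: "open_side i \<subseteq> side ps i"
  by (auto simp: side_def open_side_def open_segment_def)

lemma open_side_disjoint:
  assumes "i < n" "j < n" "i \<noteq> j" "z \<in> open_side i" shows "z \<notin> side ps j"
  using sides_Int[OF assms(1-3)] assms(4) by (auto simp: side_def open_side_def open_segment_def)

lemma corner_in_other_side:
  assumes "i < n"
  obtains j where "j < n" "j \<noteq> i" "ps ! i \<in> side ps j"
proof -
  obtain j where "j < n" "j \<noteq> i" "nxt j = i" using prev_exists[OF assms] .
  thus thesis using that[of j] by (auto simp: side_def)
qed

text \<open>Consecutive sides meet only in their common corner, so they can be joined to an arc; the last side closes
  it to a simple closed curve, to which the Jordan curve theorem applies.\<close>

lemma polygonal_arc: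
  assumes "1 \<le> k" "k < n"
  shows "\<exists>g. arc g \<and> pathstart g = ps ! 0 \<and> pathfinish g = ps ! k \<and> path_image g = (\<Union>i<k. side ps i)"
  using assms
proof (induction k rule: nat_induct_at_least)
  case base
  have "ps ! 0 \<noteq> ps ! 1" using nth_eq_iff_index_eq[OF dist_ps, of 0 1] base by simp
  hence "arc (linepath (ps ! 0) (ps ! 1))" by (rule arc_linepath)
  moreover have "path_image (linepath (ps ! 0) (ps ! 1)) = (\<Union>i<1. side ps i)"
    using base by (simp add: side_def lessThan_Suc)
  ultimately show ?case by (metis pathstart_linepath pathfinish_linepath)
next
  case (Suc k)
  then obtain g where g: "arc g" "pathstart g = ps ! 0" "pathfinish g = ps ! k"
    "path_image g = (\<Union>i<k. side ps i)" by auto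
  let ?l = "linepath (ps ! k) (ps ! Suc k)"
  have sk: "side ps k = path_image ?l" using Suc by (simp add: side_def)
  have "path_image g \<inter> path_image ?l \<subseteq> {pathstart ?l}"
  proof
    fix z assume "z \<in> path_image g \<inter> path_image ?l"
    then obtain i where i: "i < k" "z \<in> side ps i \<inter> side ps k" using g(4) sk by auto
    hence "z \<in> {ps ! i, ps ! Suc i} \<inter> {ps ! k, ps ! Suc k}"
      using sides_Int[of i k] Suc.prems by simp
    moreover have "ps ! i \<noteq> ps ! k" "ps ! i \<noteq> ps ! Suc k" "ps ! Suc i \<noteq> ps ! Suc k"
      using dist_ps i(1) Suc.prems by (simp_all add: nth_eq_iff_index_eq)
    ultimately show "z \<in> {pathstart ?l}" by auto
  qed
  moreover have "ps ! k \<noteq> ps ! Suc k" using nth_eq_iff_index_eq[OF dist_ps, of k "Suc k"] Suc.prems by simp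
  hence "arc ?l" by (rule arc_linepath)
  ultimately have "arc (g +++ ?l)" using g by (intro arc_join) auto
  moreover have "path_image (g +++ ?l) = (\<Union>i<Suc k. side ps i)"
    using g sk by (simp add: path_image_join lessThan_Suc Un_commute)
  ultimately show ?case using g(2)
    by (metis pathfinish_join pathfinish_linepath pathstart_join)
qed

lemma bd_Jordan_curve:
  obtains c where "simple_path c" "pathfinish c = pathstart c" "path_image c = bd"
proof -
  let ?m = "n - 1"
  have m: "1 \<le> ?m" "?m < n" "Suc ?m = n" using n3 by auto
  then obtain g where g: "arc g" "pathstart g = ps ! 0" "pathfinish g = ps ! ?m"
    "path_image g = (\<Union>i<?m. side ps i)" using polygonal_arc by meson
  let ?l = "linepath (ps ! ?m) (ps ! 0)"
  have sm: "side ps ?m = path_image ?l" using m by (simp add: side_def)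
  have "path_image g \<inter> path_image ?l \<subseteq> {pathstart g, pathstart ?l}"
  proof
    fix z assume "z \<in> path_image g \<inter> path_image ?l"
    then obtain i where i: "i < ?m" "z \<in> side ps i \<inter> side ps ?m" using g(4) sm by auto
    hence "z \<in> {ps ! ?m, ps ! nxt ?m}"
      using sides_Int[of i ?m] m(2) less_trans[OF i(1) m(2)] by auto
    thus "z \<in> {pathstart g, pathstart ?l}" using m g by auto
  qed
  moreover have "ps ! ?m \<noteq> ps ! 0" using nth_eq_iff_index_eq[OF dist_ps, of ?m 0] m by simp
  hence "arc ?l" by (rule arc_linepath)
  ultimately have "simple_path (g +++ ?l)" using g by (intro simple_path_join_loop) auto
  moreover have "path_image (g +++ ?l) = bd"
  proof -
    have "{..<n} = insert ?m {..<?m}" using m by (metis lessThan_Suc)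
    thus ?thesis using g sm by (simp add: path_image_join polygon_boundary_def Un_commute)
  qed
  ultimately show thesis using that[of "g +++ ?l"] g by simp
qed

lemma intr_facts: "open intr" "bounded intr" "frontier intr = bd" "intr \<inter> bd = {}" "intr \<noteq> {}"
proof -
  obtain c where c: "simple_path c" "pathfinish c = pathstart c" "path_image c = bd"
    using bd_Jordan_curve .
  from Jordan_inside_outside[OF c(1,2)]
  show "open intr" "bounded intr" "frontier intr = bd" "intr \<noteq> {}"
    unfolding c(3) polygon_interior_def by blast+
  show "intr \<inter> bd = {}" by (simp add: polygon_interior_def)
qed

lemma polygon_closure: "polygon ps = closure intr"
  using intr_facts by (simp add: polygon_def closure_Un_frontier Un_commute)

lemma compact_polygon: "compact (polygon ps)"
  unfolding polygon_closure using intr_facts by simp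

lemma polygon_subset_convex:
  assumes "convex T" "set ps \<subseteq> T" shows "polygon ps \<subseteq> T"
proof -
  have "bd \<subseteq> T"
    unfolding polygon_boundary_def side_def
    using assms n3 by (intro UN_least closed_segment_subset) (auto simp: subset_iff nxt_less[simplified])
  moreover from outside_subset_convex[OF assms(1) this] have "intr \<subseteq> T"
    unfolding polygon_interior_def inside_outside by blast
  ultimately show ?thesis by (simp add: polygon_def)
qed

lemma interior_component:
  assumes "connected H" "H \<inter> bd = {}" "x \<in> H" "x \<in> intr" shows "H \<subseteq> intr"
proof
  fix y assume "y \<in> H"
  hence "connected_component (- bd) x y" using assms unfolding connected_component_def by blast
  thus "y \<in> intr" using assms(4) inside_same_component unfolding polygon_interior_def by blast
qed

text \<open>The signed distance from the line through the \<open>i\<close>-th side, multiplied by the length of this side.\<close>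

definition height :: "nat \<Rightarrow> complex \<Rightarrow> real" where
  "height i x = (\<i> * (ps ! nxt i - ps ! i)) \<bullet> (x - ps ! i)"

lemma height_side: "x \<in> side ps i \<Longrightarrow> height i x = 0"
proof -
  assume "x \<in> side ps i"
  then obtain u where x: "x = (1 - u) *\<^sub>R ps ! i + u *\<^sub>R ps ! nxt i"
    unfolding side_def in_segment by blast
  show ?thesis unfolding height_def x inner_complex_def by simp algebra
qed

lemma height_zero:
  assumes "i < n" "height i x = 0"
  obtains t where "x = ps ! i + t *\<^sub>R (ps ! nxt i - ps ! i)"
proof -
  let ?v = "ps ! nxt i - ps ! i"
  have v: "?v \<noteq> 0" using corner_neq[OF assms(1)] by simp
  have N: "(Re ?v)\<^sup>2 + (Im ?v)\<^sup>2 \<noteq> 0" using v by (simp add: complex_eq_0)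
  have e: "Re ?v * Im (x - ps ! i) = Im ?v * Re (x - ps ! i)"
    using assms(2) by (simp add: height_def inner_complex_def algebra_simps)
  let ?t = "(?v \<bullet> (x - ps ! i)) / (?v \<bullet> ?v)"
  have vv: "?v \<bullet> ?v = (Re ?v)\<^sup>2 + (Im ?v)\<^sup>2" by (simp only: inner_complex_def power2_eq_square)
  have "(?v \<bullet> ?v) *\<^sub>R (x - ps ! i) = (?v \<bullet> (x - ps ! i)) *\<^sub>R ?v"
  proof -
    have "(a * a + b * b) * c = (a * c + b * e) * a" "(a * a + b * b) * e = (a * c + b * e) * b"
      if "a * e = b * c" for a b c e :: real
      using that by algebra+
    from this[OF e] show ?thesis by (simp add: complex_eq_iff inner_complex_def)
  qed
  hence "inverse (?v \<bullet> ?v) *\<^sub>R (?v \<bullet> ?v) *\<^sub>R (x - ps ! i)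
      = inverse (?v \<bullet> ?v) *\<^sub>R (?v \<bullet> (x - ps ! i)) *\<^sub>R ?v" by (rule arg_cong)
  moreover have "?v \<bullet> ?v \<noteq> 0" using v by simp
  ultimately have "x - ps ! i = ?t *\<^sub>R ?v" by (simp add: divide_inverse mult.commute)
  hence "x = ps ! i + ?t *\<^sub>R ?v" by (simp only: diff_eq_eq add.commute)
  thus thesis by (rule that)
qed

text \<open>Within distance \<open>\<rho>\<close> of the segment \<open>a b\<close> of the \<open>i\<close>-th side, the boundary of the polygon is the line through
  this side.\<close>

definition strip_width :: "nat \<Rightarrow> complex \<Rightarrow> complex \<Rightarrow> real \<Rightarrow> bool" where
  "strip_width i a b \<rho> \<longleftrightarrow> 0 < \<rho> \<and> (\<forall>y \<in> closed_segment a b. \<forall>x. dist x y \<le> \<rho> \<longrightarrow>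
     (if height i x = 0 then x \<in> open_side i else x \<notin> bd))"

lemma strip_width_exists:
  assumes i: "i < n" and ab: "a \<in> open_side i" "b \<in> open_side i"
  obtains \<rho> where "strip_width i a b \<rho>"
proof -
  let ?P = "ps ! i" and ?Q = "ps ! nxt i"
  let ?S = "\<Union>j\<in>{..<n} - {i}. side ps j"
  have K: "closed_segment a b \<subseteq> open_side i"
    using ab unfolding open_side_def by (intro closed_segment_subset) auto
  have "compact ?S" unfolding side_def by (intro compact_UN) auto
  moreover have "closed_segment a b \<inter> ?S = {}"
    using K open_side_disjoint[OF i] by fastforce
  ultimately have "\<exists>d>0. \<forall>x\<in>closed_segment a b. \<forall>y\<in>?S. d \<le> dist x y"
    by (intro separate_compact_closed compact_imp_closed) auto
  then obtain \<delta> where \<delta>: "0 < \<delta>" "\<And>x y. x \<in> closed_segment a b \<Longrightarrow> y \<in> ?S \<Longrightarrow> \<delta> \<le> dist x y"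
    by blast
  have "if height i x = 0 then x \<in> open_side i else x \<notin> bd"
    if y: "y \<in> closed_segment a b" and d: "dist x y \<le> \<delta> / 2" for x y
  proof (cases "height i x = 0")
    case h: False
    have "x \<notin> bd"
    proof
      assume "x \<in> bd"
      then obtain j where j: "j < n" "x \<in> side ps j" by (auto simp: polygon_boundary_def)
      hence "x \<in> ?S" using height_side h by (cases "j = i") auto
      thus False using \<delta>(2)[OF y] d \<delta>(1) dist_commute[of x y] by fastforce
    qed
    thus ?thesis using h by simp
  next
    case h: True
    have "x \<in> open_side i"
    proof (rule ccontr)
      assume out: "x \<notin> open_side i"
      \<comment> \<open>outside the side, \<open>x\<close> is farther from \<open>y\<close> than one of the corners, and each corner lies on another side\<close>
      obtain t where t: "x = ?P + t *\<^sub>R (?Q - ?P)" using height_zero[OF i h] .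
      obtain s where s: "0 < s" "s < 1" "y = ?P + s *\<^sub>R (?Q - ?P)"
      proof -
        have "y \<in> open_segment ?P ?Q" using K y by (auto simp: open_side_def)
        then obtain s where s: "0 < s" "s < 1" "y = (1 - s) *\<^sub>R ?P + s *\<^sub>R ?Q"
          by (auto simp: in_segment(2))
        thus thesis using that[of s] by (simp add: algebra_simps)
      qed
      have "t \<le> 0 \<or> 1 \<le> t"
      proof (rule ccontr)
        assume "\<not> ?thesis"
        hence "x \<in> open_side i" unfolding open_side_def in_segment(2) using corner_neq[OF i]
          by (auto simp: t algebra_simps intro!: exI[of _ t])
        thus False using out by simp
      qed
      have dyx: "dist y x = \<bar>s - t\<bar> * norm (?Q - ?P)"
      proof -
        have "y - x = (s - t) *\<^sub>R (?Q - ?P)" by (simp add: s t algebra_simps)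
        thus ?thesis by (simp add: dist_norm)
      qed
      have dP: "dist y ?P = s * norm (?Q - ?P)" using s by (simp add: dist_norm)
      have dQ: "dist y ?Q = (1 - s) * norm (?Q - ?P)"
      proof -
        have "y - ?Q = (s - 1) *\<^sub>R (?Q - ?P)" by (simp add: s algebra_simps)
        thus ?thesis using s(2) unfolding dist_norm by (simp only:) simp
      qed
      have PS: "?P \<in> ?S" using corner_in_other_side[OF i] by fastforce
      have QS: "?Q \<in> ?S" using nxt_less nxt_neq[OF i] by (auto simp: side_def intro!: bexI[of _ "nxt i"])
      from \<open>t \<le> 0 \<or> 1 \<le> t\<close> show False
      proof
        assume "t \<le> 0"
        hence "dist y ?P \<le> dist y x" unfolding dyx dP using s by (intro mult_right_mono) auto
        thus False using \<delta>(2)[OF y PS] \<delta>(1) d by (simp add: dist_commute)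
      next
        assume "1 \<le> t"
        hence "dist y ?Q \<le> dist y x" unfolding dyx dQ using s by (intro mult_right_mono) auto
        thus False using \<delta>(2)[OF y QS] \<delta>(1) d by (simp add: dist_commute)
      qed
    qed
    thus ?thesis using h by simp
  qed
  hence "strip_width i a b (\<delta> / 2)" unfolding strip_width_def using \<delta>(1) by auto
  thus thesis by (rule that)
qed

lemma strip_widthD:
  assumes "strip_width i a b \<rho>" "y \<in> closed_segment a b" "dist x y \<le> \<rho>"
  shows "height i x = 0 \<Longrightarrow> x \<in> open_side i" "height i x \<noteq> 0 \<Longrightarrow> x \<notin> bd"
  using assms unfolding strip_width_def by (meson | presburger)+

text \<open>The half of the \<open>\<rho>\<close>-neighbourhood of the segment \<open>a b\<close> that lies to the left or to the right of the \<open>i\<close>-th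
  side, according to the sign of \<open>\<sigma>\<close>. It is convex, so it can serve as a piece of the cell that is
  embedded isometrically. For \<open>a = b\<close> it is a half disc.\<close>

definition half_strip :: "nat \<Rightarrow> real \<Rightarrow> complex \<Rightarrow> complex \<Rightarrow> real \<Rightarrow> complex set" where
  "half_strip i \<sigma> a b \<rho> = {x. (\<exists>y\<in>closed_segment a b. dist x y < \<rho>) \<and> 0 < \<sigma> * height i x}"

lemma convex_half_strip: "convex (half_strip i \<sigma> a b \<rho>)"
proof -
  have 1: "{x. \<exists>y\<in>closed_segment a b. dist x y < \<rho>} = (\<Union>y\<in>closed_segment a b. \<Union>v\<in>ball 0 \<rho>. {y + v})"
    by (force simp: dist_norm norm_minus_commute intro: bexI[of _ "_ - _"])
  have "{x. 0 < \<sigma> * height i x} = {x. (\<sigma> *\<^sub>R (\<i> * (ps ! nxt i - ps ! i))) \<bullet> ps ! i <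
          (\<sigma> *\<^sub>R (\<i> * (ps ! nxt i - ps ! i))) \<bullet> x}"
    by (auto simp: height_def inner_diff_right algebra_simps)
  hence "convex {x. 0 < \<sigma> * height i x}" using convex_halfspace_gt by (simp only:)
  moreover have "convex {x. \<exists>y\<in>closed_segment a b. dist x y < \<rho>}"
    unfolding 1 by (intro convex_sums) auto
  moreover have "half_strip i \<sigma> a b \<rho> = {x. \<exists>y\<in>closed_segment a b. dist x y < \<rho>} \<inter> {x. 0 < \<sigma> * height i x}"
    by (auto simp: half_strip_def)
  ultimately show ?thesis by (simp add: convex_Int)
qed

lemma continuous_height: "continuous_on UNIV (height i)"
  unfolding height_def by (intro continuous_intros)

lemma open_half_strip: "open (half_strip i \<sigma> a b \<rho>)"
proof -
  have "half_strip i \<sigma> a b \<rho> = (\<Union>y\<in>closed_segment a b. ball y \<rho>) \<inter> {x. 0 < \<sigma> * height i x}"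
    by (auto simp: half_strip_def dist_commute)
  moreover have "open {x. 0 < \<sigma> * height i x}"
    by (intro open_Collect_less continuous_intros continuous_height)
  ultimately show ?thesis by auto
qed

lemma half_strip_interior:
  assumes "i < n" and nb: "strip_width i a b \<rho>" and "x \<in> half_strip i \<sigma> a b \<rho>" "x \<in> intr"
  shows "half_strip i \<sigma> a b \<rho> \<subseteq> intr"
proof (rule interior_component[OF _ _ assms(3,4)])
  show "connected (half_strip i \<sigma> a b \<rho>)" by (intro convex_connected convex_half_strip)
  show "half_strip i \<sigma> a b \<rho> \<inter> bd = {}" 
  proof (intro equals0I, elim IntE)
    fix x assume x: "x \<in> half_strip i \<sigma> a b \<rho>" "x \<in> bd"
    then obtain y where "y \<in> closed_segment a b" "dist x y < \<rho>" "height i x \<noteq> 0"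
      unfolding half_strip_def by force
    thus False using strip_widthD(2)[OF nb, of y x] x by simp
  qed
qed

text \<open>Interior points of the polygon accumulate at \<open>a\<close>, since the boundary is the frontier of the interior;
  the half strip containing one of them lies in the interior.\<close>

lemma half_strip_sign:
  assumes i: "i < n" and ab: "a \<in> open_side i" and nb: "strip_width i a b \<rho>"
  obtains \<sigma> where "\<sigma> \<noteq> 0" "half_strip i \<sigma> a b \<rho> \<subseteq> intr"
proof -
  have "a \<in> bd" using i ab open_side_subset by (auto simp: polygon_boundary_def)
  hence "a \<in> closure intr" using intr_facts(3) by (metis Diff_iff frontier_def)
  then obtain x where x: "x \<in> intr" "dist x a < \<rho>"
    using nb closure_approachable unfolding strip_width_def by blast
  have "height i x \<noteq> 0"
  proof
    assume "height i x = 0"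
    hence "x \<in> open_side i" using strip_widthD(1)[OF nb, of a x] x by simp
    hence "x \<in> bd" using i open_side_subset by (auto simp: polygon_boundary_def)
    thus False using x intr_facts by blast
  qed
  moreover from this have "x \<in> half_strip i (height i x) a b \<rho>"
    unfolding half_strip_def using x by (auto intro!: bexI[of _ a] simp: zero_less_mult_iff)
  ultimately show thesis
    using that[of "height i x"] half_strip_interior[OF i nb] x by blast
qed

lemma half_strip_closure:
  assumes i: "i < n" and y: "y \<in> closed_segment a b" "height i y = 0" and "0 < \<rho>" "\<sigma> \<noteq> 0"
  shows "y \<in> closure (half_strip i \<sigma> a b \<rho>)"
  unfolding closure_approachable
proof (intro allI impI)
  fix e :: real assume e: "0 < e"
  define \<nu> where "\<nu> = \<i> * (ps ! nxt i - ps ! i)"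
  have \<nu>: "\<nu> \<noteq> 0" using corner_neq[OF i] by (simp add: \<nu>_def)
  define t where "t = min e \<rho> / (2 * norm \<nu>)"
  have t: "0 < t" "t * norm \<nu> < e" "t * norm \<nu> < \<rho>"
    using e \<open>0 < \<rho>\<close> \<nu> by (auto simp: t_def)
  define x where "x = y + (sgn \<sigma> * t) *\<^sub>R \<nu>"
  have "height i x = height i y + sgn \<sigma> * t * (\<nu> \<bullet> \<nu>)"
    unfolding height_def x_def \<nu>_def[symmetric] by (simp add: inner_diff_right inner_add_right)
  hence "\<sigma> * height i x = \<bar>\<sigma>\<bar> * t * (\<nu> \<bullet> \<nu>)" using y(2) by (simp add: abs_sgn)
  hence h: "0 < \<sigma> * height i x" using \<nu> t \<open>\<sigma> \<noteq> 0\<close> by simp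
  have "dist x y = t * norm \<nu>" using t \<open>\<sigma> \<noteq> 0\<close> by (simp add: x_def dist_norm abs_mult abs_sgn_eq)
  thus "\<exists>x\<in>half_strip i \<sigma> a b \<rho>. dist x y < e"
    using h y t unfolding half_strip_def by (intro bexI[of _ x] CollectI conjI bexI[of _ y]) auto
qed

lemma open_side_height: "z \<in> open_side i \<Longrightarrow> height i z = 0"
  using height_side open_side_subset by blast

lemma half_disc_frontier:
  assumes i: "i < n" and x: "x \<in> closure (half_strip i \<sigma> a a \<rho>)" "x \<notin> half_strip i \<sigma> a a \<rho>"
    and nb: "strip_width i a a \<rho>"
    and "\<sigma> \<noteq> 0"
  shows "x \<in> open_side i \<or> dist x a = \<rho>"
proof -
  have "half_strip i \<sigma> a a \<rho> \<subseteq> cball a \<rho> \<inter> {x. 0 \<le> \<sigma> * height i x}"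
    by (auto simp: half_strip_def dist_commute)
  moreover have "closed (cball a \<rho> \<inter> {x. 0 \<le> \<sigma> * height i x})"
    by (intro closed_Int closed_cball closed_Collect_le continuous_intros continuous_height)
  ultimately have "x \<in> cball a \<rho> \<inter> {x. 0 \<le> \<sigma> * height i x}" using x(1) closure_minimal by blast
  hence 1: "dist x a \<le> \<rho>" "0 \<le> \<sigma> * height i x" by (auto simp: dist_commute)
  show ?thesis
  proof (cases "height i x = 0")
    case True
    thus ?thesis using strip_widthD(1)[OF nb, of a x] 1 by simp
  next
    case False
    hence "0 < \<sigma> * height i x" using 1 \<open>\<sigma> \<noteq> 0\<close> by (simp add: less_le)
    thus ?thesis using x(2) 1 by (auto simp: half_strip_def)
  qed
qed

lemma height_affine: "height i ((1 - u) *\<^sub>R x + u *\<^sub>R y) = (1 - u) * height i x + u * height i y"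
proof -
  have "(1 - u) *\<^sub>R x + u *\<^sub>R y - ps ! i = (1 - u) *\<^sub>R (x - ps ! i) + u *\<^sub>R (y - ps ! i)"
    by (simp add: algebra_simps)
  thus ?thesis by (simp add: height_def inner_add_right)
qed

lemma open_segment_half_disc:
  assumes "height i u = 0" "dist u a < \<rho>" "w \<in> half_strip i \<sigma> a a \<rho>"
  shows "open_segment u w \<subseteq> half_strip i \<sigma> a a \<rho>" "u \<in> closure (half_strip i \<sigma> a a \<rho>)"
proof -
  have w: "dist w a < \<rho>" "0 < \<sigma> * height i w" using assms(3) by (auto simp: half_strip_def)
  have uw: "u \<noteq> w" using assms(1) w by auto
  show sub: "open_segment u w \<subseteq> half_strip i \<sigma> a a \<rho>"
  proof
    fix x assume x: "x \<in> open_segment u w"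
    then obtain t where t: "0 < t" "t < 1" "x = (1 - t) *\<^sub>R u + t *\<^sub>R w" by (auto simp: in_segment(2))
    have "\<sigma> * height i x = t * (\<sigma> * height i w)" unfolding t(3) height_affine assms(1) by simp
    hence "0 < \<sigma> * height i x" using t(1) w(2) by (metis mult_pos_pos)
    moreover have "x \<in> ball a \<rho>"
      using closed_segment_subset[of u "ball a \<rho>" w] x assms(2) w by (auto simp: dist_commute open_segment_def)
    ultimately show "x \<in> half_strip i \<sigma> a a \<rho>" by (simp add: half_strip_def dist_commute)
  qed
  have "u \<in> closure (open_segment u w)" using uw by simp
  thus "u \<in> closure (half_strip i \<sigma> a a \<rho>)" using closure_mono[OF sub] by blast
qed

lemma strip_width_mono: "strip_width i a b \<rho> \<Longrightarrow> 0 < \<rho>' \<Longrightarrow> \<rho>' \<le> \<rho> \<Longrightarrow> strip_width i a b \<rho>'"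
  unfolding strip_width_def by force

lemma half_strip_dist: "x \<in> half_strip i \<sigma> a a \<rho> \<Longrightarrow> dist x a < \<rho>"
  by (simp add: half_strip_def)

end

section \<open>Metric geometry of the closed cells\<close>

locale CAT0_complex =
  fixes X :: "('v, 'e, 'f) complex2" and P :: "('e, 'f) shape"
  assumes CAT0_complex2: "CAT0_complex2 X P"
begin

abbreviation \<kappa> :: real where "\<kappa> \<equiv> curv P"
abbreviation M where "M \<equiv> metric_realization X P"
abbreviation d where "d \<equiv> path_dist X P"
abbreviation \<phi> where "\<phi> \<equiv> polygon_map X P"
abbreviation md where "md \<equiv> model_dist (curv P)"
abbreviation ps where "ps R \<equiv> corners P R"
abbreviation intr where "intr R \<equiv> polygon_interior (corners P R)"
abbreviation nxt where "nxt R i \<equiv> (i + 1) mod length (corners P R)"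
abbreviation edge where "edge R i \<equiv> fst (bdry X R ! i)"
abbreviation open_side where "open_side R i \<equiv> plane_polygon.open_side (corners P R) i"

sublocale CAT0 M d
  using CAT0_complex2 by unfold_locales (simp add: CAT0_complex2_def)

lemma curv_nonpos: "\<kappa> \<le> 0"
  and len_pos: "e \<in> edges X \<Longrightarrow> 0 < len P e"
  and complex: "is_complex2 X"
  using CAT0_complex2 by (auto simp: CAT0_complex2_def polyhedral_shape_def)

lemma face_shape:
  assumes "R \<in> faces X"
  shows "plane_polygon (ps R)" "set (ps R) \<subseteq> model_plane \<kappa>" "length (bdry X R) = length (ps R)"
    and "i < length (ps R) \<Longrightarrow> md (ps R ! i) (ps R ! nxt R i) = len P (edge R i)"
    and "i < length (ps R) \<Longrightarrow> edge R i \<in> edges X"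
proof -
  show "plane_polygon (ps R)" "set (ps R) \<subseteq> model_plane \<kappa>" and l: "length (bdry X R) = length (ps R)"
    and "i < length (ps R) \<Longrightarrow> md (ps R ! i) (ps R ! nxt R i) = len P (edge R i)"
    using CAT0_complex2 assms unfolding CAT0_complex2_def polyhedral_shape_def Let_def plane_polygon_def
    by auto
  have "fst ` set (bdry X R) \<subseteq> edges X"
    using complex assms by (auto simp: is_complex2_def closed_path_def)
  thus "i < length (ps R) \<Longrightarrow> edge R i \<in> edges X" using l by (auto simp: subset_iff)
qed

lemma polygon_model: "R \<in> faces X \<Longrightarrow> polygon (ps R) \<subseteq> model_plane \<kappa>"
  using plane_polygon.polygon_subset_convex face_shape convex_model_plane[OF curv_nonpos] by blast

lemma polygon_closure: "R \<in> faces X \<Longrightarrow> polygon (ps R) = closure (intr R)"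
  using plane_polygon.polygon_closure face_shape by blast

lemma intr_polygon: "intr R \<subseteq> polygon (ps R)"
  by (auto simp: polygon_def)

lemma intr_model: "R \<in> faces X \<Longrightarrow> intr R \<subseteq> model_plane \<kappa>"
  using polygon_model intr_polygon by blast

lemma polygon_map_intr [simp]: "z \<in> intr R \<Longrightarrow> \<phi> R z = Fac R z"
  by (simp add: polygon_map_def)

lemma side_polygon: "R \<in> faces X \<Longrightarrow> i < length (ps R) \<Longrightarrow> side (ps R) i \<subseteq> polygon (ps R)"
  by (auto simp: polygon_def polygon_boundary_def)

lemma corner_polygon:
  assumes "R \<in> faces X" "i < length (ps R)"
  shows "ps R ! i \<in> polygon (ps R)" "ps R ! i \<in> model_plane \<kappa>"
proof -
  show "ps R ! i \<in> polygon (ps R)" using side_polygon[OF assms] by (auto simp: side_def)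
  thus "ps R ! i \<in> model_plane \<kappa>" using polygon_model[OF assms(1)] by blast
qed

lemma nxt_less: "R \<in> faces X \<Longrightarrow> nxt R i < length (ps R)"
  using plane_polygon.nxt_less face_shape by blast

subsection \<open>Boundary points\<close>

text \<open>The parameter, on the edge to which the \<open>i\<close>-th side is glued, of the point \<open>z\<close> of this side.\<close>

definition coord :: "'f \<Rightarrow> nat \<Rightarrow> complex \<Rightarrow> real" where
  "coord R i z = (if snd (bdry X R ! i) then md (ps R ! i) z else len P (edge R i) - md (ps R ! i) z)"

lemma polygon_map_bd:
  assumes R: "R \<in> faces X" "j < length (ps R)" "z \<in> side (ps R) j"
  obtains i where "i \<le> j" "z \<in> side (ps R) i" "\<phi> R z = edge_map X (len P) (edge R i) (coord R i z)"
proof -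
  interpret pp: plane_polygon "ps R" using face_shape R by blast
  have "z \<notin> intr R" using pp.intr_facts(4) R by (auto simp: polygon_boundary_def)
  moreover define i where "i = (LEAST i. z \<in> side (ps R) i)"
  moreover obtain e b where eb: "bdry X R ! i = (e, b)" by fastforce
  ultimately have "\<phi> R z = edge_map X (len P) (edge R i) (coord R i z)"
    by (simp add: polygon_map_def coord_def)
  moreover have "i \<le> j" "z \<in> side (ps R) i"
    unfolding i_def using R(3) by (auto intro: Least_le LeastI)
  ultimately show thesis using that by blast
qed

lemma side_md:
  assumes R: "R \<in> faces X" "i < length (ps R)" "z \<in> side (ps R) i"
  shows "md (ps R ! i) z + md z (ps R ! nxt R i) = len P (edge R i)"
  using face_shape(4)[OF R(1,2)] R nxt_less
  by (subst model_dist_additive[OF curv_nonpos, symmetric]) (auto simp: corner_polygon side_def)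

lemma open_side_coord:
  assumes R: "R \<in> faces X" "i < length (ps R)" "z \<in> open_side R i"
  shows "\<phi> R z = Edg (edge R i) (coord R i z)" "0 < coord R i z" "coord R i z < len P (edge R i)"
proof -
  interpret pp: plane_polygon "ps R" using face_shape R by blast
  have zs: "z \<in> side (ps R) i" using pp.open_side_subset R(3) by blast
  have zne: "z \<noteq> ps R ! i" "z \<noteq> ps R ! nxt R i" using R(3) by (auto simp: pp.open_side_def open_segment_def)
  have zm: "z \<in> model_plane \<kappa>" using polygon_model[OF R(1)] side_polygon[OF R(1,2)] zs by blast
  have "0 < md (ps R ! i) z" "0 < md z (ps R ! nxt R i)"
    using model_dist_pos[OF curv_nonpos] zne zm corner_polygon(2)[OF R(1)] R nxt_less[OF R(1)] by metis+
  thus c: "0 < coord R i z" "coord R i z < len P (edge R i)"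
    using side_md[OF R(1,2) zs] by (auto simp: coord_def)
  obtain i' where i': "i' \<le> i" "z \<in> side (ps R) i'" "\<phi> R z = edge_map X (len P) (edge R i') (coord R i' z)"
    using polygon_map_bd[OF R(1,2) zs] .
  hence "i' = i" using pp.open_side_disjoint[of i i' z] R by force
  thus "\<phi> R z = Edg (edge R i) (coord R i z)" using i' c by (simp add: edge_map_def)
qed

text \<open>At a corner the gluing map uses the first side that contains it, which need not be the side with the same
  index; the corner is an end of that side.\<close>

lemma corner_vertex:
  assumes R: "R \<in> faces X" "i < length (ps R)"
  obtains j v where "j < length (ps R)" "v \<in> {src X (edge R j), tgt X (edge R j)}" "\<phi> R (ps R ! i) = Vtx v"
proof -
  interpret pp: plane_polygon "ps R" using face_shape R by blast
  let ?z = "ps R ! i"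
  have "?z \<in> side (ps R) i" by (simp add: side_def)
  then obtain j where j: "j \<le> i" "?z \<in> side (ps R) j" "\<phi> R ?z = edge_map X (len P) (edge R j) (coord R j ?z)"
    using polygon_map_bd[OF R] by blast
  have jn: "j < length (ps R)" using j R by simp
  have "?z \<notin> open_side R j"
  proof
    assume a: "?z \<in> open_side R j"
    hence "j \<noteq> i" by (auto simp: pp.open_side_def open_segment_def)
    thus False using pp.open_side_disjoint[OF jn R(2) _ a] by (simp add: side_def)
  qed
  hence "?z = ps R ! j \<or> ?z = ps R ! nxt R j" using pp.side_cases j by blast
  hence "md (ps R ! j) ?z = 0 \<or> md (ps R ! j) ?z = len P (edge R j)"
    using face_shape(4)[OF R(1) jn] corner_polygon(2)[OF R(1) jn] model_dist_self[OF curv_nonpos] by metis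
  hence "coord R j ?z = 0 \<or> coord R j ?z = len P (edge R j)" by (auto simp: coord_def)
  thus thesis using that[OF jn] j(3) len_pos[OF face_shape(5)[OF R(1) jn]]
    by (auto simp: edge_map_def)
qed

lemma polygon_cases:
  assumes "R \<in> faces X" "z \<in> polygon (ps R)"
  obtains "z \<in> intr R" | i where "i < length (ps R)" "z \<in> open_side R i"
    | i where "i < length (ps R)" "z = ps R ! i"
proof -
  interpret pp: plane_polygon "ps R" using face_shape assms by blast
  consider "z \<in> intr R" | i where "i < length (ps R)" "z \<in> side (ps R) i"
    using assms by (auto simp: polygon_def polygon_boundary_def)
  thus thesis using that pp.side_cases nxt_less[OF assms(1)] by metis
qed

lemma polygon_map_M:
  assumes "R \<in> faces X" "z \<in> polygon (ps R)" shows "\<phi> R z \<in> M"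
  using polygon_cases[OF assms]
proof cases
  case 1 thus ?thesis using assms by (simp add: metric_realization_def)
next
  case (2 i) thus ?thesis using open_side_coord[OF assms(1) 2] face_shape(5)[OF assms(1)]
    by (auto simp: metric_realization_def)
next
  case (3 i)
  then obtain j v where "j < length (ps R)" "v \<in> {src X (edge R j), tgt X (edge R j)}" "\<phi> R z = Vtx v"
    using corner_vertex[OF assms(1)] by blast
  moreover have "src X ` edges X \<subseteq> verts X" "tgt X ` edges X \<subseteq> verts X"
    using complex by (auto simp: is_complex2_def)
  ultimately show ?thesis using face_shape(5)[OF assms(1)] by (fastforce simp: metric_realization_def)
qed

lemma coord_md:
  assumes R: "R \<in> faces X" "i < length (ps R)" "z \<in> side (ps R) i" "w \<in> side (ps R) i"
  shows "md z w = \<bar>coord R i z - coord R i w\<bar>"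
proof -
  let ?A = "ps R ! i" and ?B = "ps R ! nxt R i"
  have zw: "z \<in> model_plane \<kappa>" "w \<in> model_plane \<kappa>"
    using polygon_model[OF R(1)] side_polygon[OF R(1,2)] R by blast+
  have A: "?A \<in> model_plane \<kappa>" using corner_polygon[OF R(1,2)] by blast
  obtain s where s: "0 \<le> s" "s \<le> 1" "z = (1 - s) *\<^sub>R ?A + s *\<^sub>R ?B" using R(3) by (auto simp: side_def in_segment)
  obtain t where t: "0 \<le> t" "t \<le> 1" "w = (1 - t) *\<^sub>R ?A + t *\<^sub>R ?B" using R(4) by (auto simp: side_def in_segment)
  have seg: "(1 - s) *\<^sub>R A + s *\<^sub>R B \<in> closed_segment A ((1 - t) *\<^sub>R A + t *\<^sub>R B)"
    if "0 \<le> s" "s \<le> t" for s t and A B :: complex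
  proof (cases "t = 0")
    case False
    hence "(1 - s) *\<^sub>R A + s *\<^sub>R B = (1 - s / t) *\<^sub>R A + (s / t) *\<^sub>R ((1 - t) *\<^sub>R A + t *\<^sub>R B)"
      by (simp add: scaleR_add_right scaleR_left_diff_distrib scaleR_right_diff_distrib)
    moreover have "0 \<le> s / t" "s / t \<le> 1" using that False by (auto simp: divide_le_eq_1)
    ultimately show ?thesis unfolding in_segment by blast
  qed (use that in auto)
  have "md ?A w = md ?A z + md z w \<or> md ?A z = md ?A w + md w z"
    using seg[of s t ?A ?B] seg[of t s ?A ?B] s t model_dist_additive[OF curv_nonpos A] zw by (cases "s \<le> t") auto
  thus ?thesis using model_dist_nonneg[OF curv_nonpos zw] model_dist_commute[OF curv_nonpos, of z w]
    by (auto simp: coord_def)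
qed

lemma coord_surj:
  assumes R: "R \<in> faces X" "i < length (ps R)" and t: "0 < t" "t < len P (edge R i)"
  obtains z where "z \<in> open_side R i" "coord R i z = t"
proof -
  interpret pp: plane_polygon "ps R" using face_shape R by blast
  let ?A = "ps R ! i" and ?B = "ps R ! nxt R i"
  define u where "u = (if snd (bdry X R ! i) then t else len P (edge R i) - t)"
  have u: "0 < u" "u < len P (edge R i)" using t by (auto simp: u_def)
  have "continuous_on {0..1} (\<lambda>s. md ?A (linepath ?A ?B s))"
  proof (rule continuous_on_model_dist_comp[OF curv_nonpos])
    have "linepath ?A ?B ` {0..1} \<subseteq> side (ps R) i"
      by (metis path_image_def path_image_linepath side_def order_refl)
    thus "linepath ?A ?B ` {0..1} \<subseteq> model_plane \<kappa>"
      using polygon_model[OF R(1)] side_polygon[OF R] by blast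
  qed (use corner_polygon(2)[OF R] in \<open>auto intro: continuous_on_linepath\<close>)
  moreover have "md ?A (linepath ?A ?B 0) \<le> u" "u \<le> md ?A (linepath ?A ?B 1)"
    using u face_shape(4)[OF R] corner_polygon(2)[OF R] model_dist_self[OF curv_nonpos]
    by (simp_all add: linepath_def)
  ultimately obtain s where s: "0 \<le> s" "s \<le> 1" "md ?A (linepath ?A ?B s) = u"
    using IVT'[of "\<lambda>s. md ?A (linepath ?A ?B s)" 0 u 1] by auto
  let ?z = "linepath ?A ?B s"
  have zs: "?z \<in> side (ps R) i"
    unfolding side_def using s by (simp add: linepath_in_path)
  have "?z \<noteq> ?A" using u s model_dist_self[OF curv_nonpos] corner_polygon(2)[OF R] by force
  moreover have "?z \<noteq> ?B" using u s face_shape(4)[OF R] by force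
  ultimately have "?z \<in> open_side R i" using zs pp.side_cases by blast
  thus thesis using that s by (simp add: coord_def u_def split: if_splits)
qed

lemma Edg_M: "Edg e t \<in> M \<longleftrightarrow> e \<in> edges X \<and> 0 < t \<and> t < len P e"
  by (auto simp: metric_realization_def)

subsection \<open>Upper bounds for the path metric\<close>

lemma chain_nonneg: "chain X P x y L \<Longrightarrow> 0 \<le> L"
proof (induction rule: chain.induct)
  case (face_step x R z L w)
  hence "z \<in> polygon (ps R)" "w \<in> polygon (ps R)" by auto
  hence "0 \<le> md z w" using face_step polygon_model model_dist_nonneg[OF curv_nonpos] by blast
  thus ?case using face_step by simp
qed auto

lemma d_le_chain: "chain X P x y L \<Longrightarrow> d x y \<le> L"
  unfolding path_dist_def using chain_nonneg
  by (auto intro!: cInf_lower bdd_belowI[of _ 0])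

lemma d_le_md:
  assumes "R \<in> faces X" "closed_segment z w \<subseteq> polygon (ps R)"
  shows "d (\<phi> R z) (\<phi> R w) \<le> md z w"
proof -
  have "chain X P (\<phi> R z) (\<phi> R z) 0" using assms by (intro chain.refl polygon_map_M) auto
  from chain.face_step[OF this assms] show ?thesis using d_le_chain by simp
qed

lemma d_le_edge:
  assumes "e \<in> edges X" "0 < s" "s < len P e" "0 < t" "t < len P e"
  shows "d (Edg e s) (Edg e t) \<le> \<bar>s - t\<bar>"
proof -
  have "Edg e s \<in> M" using assms by (auto simp: metric_realization_def)
  hence "chain X P (Edg e s) (edge_map X (len P) e s) 0"
    using assms chain.refl[of "Edg e s"] by (simp add: edge_map_def)
  from chain.edge_step[OF this, of t] show ?thesis using d_le_chain assms by (simp add: edge_map_def)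
qed

subsection \<open>Lower bounds for the path metric\<close>

text \<open>The truncated model distance \<open>min r (md z w)\<close> in the cell \<open>R\<close>, extended by the constant \<open>r\<close>,
  grows along a chain at most by the length of the chain.\<close>

definition trunc :: "'f \<Rightarrow> complex \<Rightarrow> real \<Rightarrow> ('v, 'e, 'f) point \<Rightarrow> real" where
  "trunc R z r p = (case p of Fac R' w \<Rightarrow> if R' = R then min r (md z w) else r | _ \<Rightarrow> r)"

lemma trunc_edge: "trunc R z r (edge_map X l e t) = r"
  by (simp add: trunc_def edge_map_def)

lemma trunc_polygon_map:
  assumes R: "R \<in> faces X" and far: "\<And>w. w \<in> polygon (ps R) - intr R \<Longrightarrow> r \<le> md z w"
    and w: "R' \<in> faces X" "w \<in> polygon (ps R')"
  shows "trunc R z r (\<phi> R' w) = (if R' = R then min r (md z w) else r)"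
proof (cases "w \<in> intr R'")
  case True thus ?thesis by (simp add: trunc_def)
next
  case False
  obtain i where "i < length (ps R')" "w \<in> side (ps R') i"
    using False w by (auto simp: polygon_def polygon_boundary_def)
  then obtain j where "\<phi> R' w = edge_map X (len P) (edge R' j) (coord R' j w)"
    using polygon_map_bd[OF w(1)] by metis
  hence "trunc R z r (\<phi> R' w) = r" using trunc_edge by metis
  thus ?thesis using far[of w] False w by auto
qed

lemma trunc_le_chain:
  assumes R: "R \<in> faces X" and z: "z \<in> intr R" and r: "0 < r"
    and far: "\<And>w. w \<in> polygon (ps R) - intr R \<Longrightarrow> r \<le> md z w"
    and ch: "chain X P x y L" and x: "x = Fac R z"
  shows "trunc R z r y \<le> L"
  using ch x
proof (induction rule: chain.induct)
  case (refl x)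
  have "md z z = 0" using z intr_model[OF R] by (intro model_dist_self[OF curv_nonpos]) blast
  thus ?case using r refl.prems by (simp add: trunc_def)
next
  case (edge_step x e s L t)
  thus ?case by (simp add: trunc_edge)
next
  case (face_step x R' u L w)
  hence uw: "u \<in> polygon (ps R')" "w \<in> polygon (ps R')" by auto
  hence uwm: "u \<in> model_plane \<kappa>" "w \<in> model_plane \<kappa>" using face_step polygon_model by blast+
  have zm: "z \<in> model_plane \<kappa>" using z R intr_model by blast
  have "0 \<le> md u w" using model_dist_nonneg[OF curv_nonpos uwm] .
  thus ?case
    using face_step.IH[OF face_step.prems] model_dist_triangle[OF curv_nonpos zm uwm]
      trunc_polygon_map[OF R far face_step.hyps(2) uw(1)] trunc_polygon_map[OF R far face_step.hyps(2) uw(2)]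
    by (cases "R' = R") auto
qed

text \<open>If no chain joins the points, then \<open>path_dist\<close> has the value \<open>0\<close>; since it is a metric, the points are
  equal.\<close>

lemma trunc_le_d:
  assumes R: "R \<in> faces X" and z: "z \<in> intr R" and r: "0 < r"
    and far: "\<And>w. w \<in> polygon (ps R) - intr R \<Longrightarrow> r \<le> md z w" and p: "p \<in> M"
  shows "trunc R z r p \<le> d (Fac R z) p"
proof (cases "\<exists>L. chain X P (Fac R z) p L")
  case True
  hence "trunc R z r p \<le> Inf {L. chain X P (Fac R z) p L}"
    using trunc_le_chain[OF R z r far] by (intro cInf_greatest) auto
  thus ?thesis using True by (simp add: path_dist_def)
next
  case False
  hence "d (Fac R z) p = 0" by (simp add: path_dist_def)
  moreover have "Fac R z \<in> M" using z R by (auto simp: metric_realization_def)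
  ultimately have "p = Fac R z" using zero p by blast
  moreover have "md z z = 0" using z intr_model[OF R] by (intro model_dist_self[OF curv_nonpos]) blast
  ultimately have "trunc R z r p = 0" using r by (simp add: trunc_def)
  thus ?thesis using nonneg by simp
qed

text \<open>The truncation level \<open>r\<close> is the model distance between \<open>K\<close> and the part of the polygon outside \<open>U\<close>, positive by
  compactness.\<close>

lemma uniform_neighbourhood:
  assumes R: "R \<in> faces X" and K: "compact K" "K \<subseteq> U" and U: "open U" "U \<subseteq> intr R"
  obtains r where "0 < r"
    "\<And>z p. z \<in> K \<Longrightarrow> p \<in> M \<Longrightarrow> d (\<phi> R z) p < r \<Longrightarrow> \<exists>w\<in>U. p = Fac R w \<and> md z w \<le> d (\<phi> R z) p"
proof -
  interpret pp: plane_polygon "ps R" using face_shape R by blast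
  have "\<exists>r>0. \<forall>z\<in>K. \<forall>w\<in>polygon (ps R) - U. r \<le> md z w"
  proof (cases "K \<times> (polygon (ps R) - U) = {}")
    case True thus ?thesis by (intro exI[of _ 1]) auto
  next
    case False
    have c: "compact (K \<times> (polygon (ps R) - U))" using K U pp.compact_polygon by (intro compact_Times compact_diff)
    have sub: "K \<subseteq> model_plane \<kappa>" "polygon (ps R) - U \<subseteq> model_plane \<kappa>"
      using K U intr_model[OF R] polygon_model[OF R] by blast+
    have "continuous_on (K \<times> (polygon (ps R) - U)) (\<lambda>q. md (fst q) (snd q))"
      by (rule continuous_on_subset[OF continuous_on_model_dist[OF curv_nonpos]]) (use sub in auto)
    from continuous_attains_inf[OF c False this]
    obtain q where q: "q \<in> K \<times> (polygon (ps R) - U)"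
      "\<And>y. y \<in> K \<times> (polygon (ps R) - U) \<Longrightarrow> md (fst q) (snd q) \<le> md (fst y) (snd y)" by blast
    have "0 < md (fst q) (snd q)"
      using q(1) sub K by (intro model_dist_pos[OF curv_nonpos]) (auto simp: mem_Times_iff)
    thus ?thesis using q(2) by (intro exI[of _ "md (fst q) (snd q)"]) force
  qed
  then obtain r where r: "0 < r" "\<And>z w. z \<in> K \<Longrightarrow> w \<in> polygon (ps R) - U \<Longrightarrow> r \<le> md z w" by blast
  show thesis
  proof (rule that[OF r(1)])
    fix z p assume z: "z \<in> K" and p: "p \<in> M" and l: "d (\<phi> R z) p < r"
    have zi: "z \<in> intr R" using z K U by blast
    have "trunc R z r p \<le> d (\<phi> R z) p"
      using trunc_le_d[OF R zi r(1) _ p] r(2)[OF z] U zi by auto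
    hence t: "trunc R z r p < r" "trunc R z r p \<le> d (\<phi> R z) p" using l by auto
    then obtain w where w: "p = Fac R w" "md z w < r" "md z w \<le> d (\<phi> R z) p"
      by (auto simp: trunc_def split: point.splits if_splits)
    have "w \<in> polygon (ps R)" using p w intr_polygon by (auto simp: metric_realization_def)
    hence "w \<in> U" using r(2)[OF z, of w] w by force
    thus "\<exists>w\<in>U. p = Fac R w \<and> md z w \<le> d (\<phi> R z) p" using w by blast
  qed
qed

text \<open>Short pieces of the segment have the right length by \<open>uniform_neighbourhood\<close>, so the segment is a local
  geodesic.\<close>

lemma d_segment_intr:
  assumes R: "R \<in> faces X" and S: "closed_segment z w \<subseteq> intr R"
  shows "d (\<phi> R z) (\<phi> R w) = md z w"
proof (cases "z = w")
  case True
  have "w \<in> intr R" using S by auto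
  hence "w \<in> model_plane \<kappa>" "\<phi> R w \<in> M"
    using intr_model[OF R] polygon_map_M[OF R] intr_polygon by blast+
  thus ?thesis using True model_dist_self[OF curv_nonpos] mdist_zero by simp
next
  case False
  interpret pp: plane_polygon "ps R" using face_shape R by blast
  obtain r where r: "0 < r" "\<And>u p. u \<in> closed_segment z w \<Longrightarrow> p \<in> M \<Longrightarrow> d (\<phi> R u) p < r
      \<Longrightarrow> \<exists>v\<in>intr R. p = Fac R v \<and> md u v \<le> d (\<phi> R u) p"
    using uniform_neighbourhood[OF R _ S pp.intr_facts(1)] by auto
  define \<gamma> where "\<gamma> = linepath z w"
  have \<gamma>S: "\<gamma> s \<in> closed_segment z w" if "s \<in> {0..1}" for s
    using that by (simp add: \<gamma>_def linepath_in_path)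
  have \<gamma>m: "\<gamma> s \<in> model_plane \<kappa>" if "s \<in> {0..1}" for s
    using \<gamma>S[OF that] S intr_model[OF R] by blast
  have "continuous_on ({0..1} \<times> {0..1}) (\<lambda>q. md (\<gamma> (fst q)) (\<gamma> (snd q)))"
    by (rule continuous_on_model_dist_comp[OF curv_nonpos])
       (use \<gamma>m in \<open>auto simp: \<gamma>_def linepath_def intro!: continuous_intros\<close>)
  hence "uniformly_continuous_on ({0..1} \<times> {0..1}) (\<lambda>q. md (\<gamma> (fst q)) (\<gamma> (snd q)))"
    by (intro compact_uniformly_continuous compact_Times) auto
  then obtain \<delta> where \<delta>: "0 < \<delta>" "\<And>q q'. q \<in> {0..1} \<times> {0..1} \<Longrightarrow> q' \<in> {0..1} \<times> {0..1} \<Longrightarrow> dist q' q < \<delta>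
      \<Longrightarrow> dist (md (\<gamma> (fst q')) (\<gamma> (snd q'))) (md (\<gamma> (fst q)) (\<gamma> (snd q))) < r"
    unfolding uniformly_continuous_on_def using r(1) by metis
  have sub: "\<gamma> s \<in> closed_segment z (\<gamma> t)" "closed_segment (\<gamma> s) (\<gamma> t) \<subseteq> closed_segment z w"
    if "0 \<le> s" "s \<le> t" "t \<le> 1" for s t
  proof -
    show "closed_segment (\<gamma> s) (\<gamma> t) \<subseteq> closed_segment z w"
      using that by (intro closed_segment_subset \<gamma>S) auto
    show "\<gamma> s \<in> closed_segment z (\<gamma> t)"
    proof (cases "t = 0")
      case False
      hence "\<gamma> s = (1 - s / t) *\<^sub>R z + (s / t) *\<^sub>R \<gamma> t"
        by (simp add: \<gamma>_def linepath_def scaleR_add_right scaleR_left_diff_distrib scaleR_right_diff_distrib)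
      moreover have "0 \<le> s / t" "s / t \<le> 1" using that False by (auto simp: divide_le_eq_1)
      ultimately show ?thesis unfolding in_segment by blast
    qed (use that in \<open>auto simp: \<gamma>_def linepath_def\<close>)
  qed
  have add: "md z (\<gamma> t) - md z (\<gamma> s) = md (\<gamma> s) (\<gamma> t)" if "0 \<le> s" "s \<le> t" "t \<le> 1" for s t
    using model_dist_additive[OF curv_nonpos \<gamma>m[of 0] \<gamma>m[of t] ] sub[OF that] that
    by (simp add: \<gamma>_def linepath_0')
  have "d (\<phi> R (\<gamma> 0)) (\<phi> R (\<gamma> 1)) = md z (\<gamma> 1) - md z (\<gamma> 0)"
  proof (rule local_geodesic[where \<delta> = "\<delta> / 3"])
    show "\<phi> R (\<gamma> s) \<in> M" if "s \<in> {0..1}" for s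
      using \<gamma>S[OF that] S intr_polygon by (intro polygon_map_M R) blast
    show "md z (\<gamma> s) < md z (\<gamma> t)" if "0 \<le> s" "s < t" "t \<le> 1" for s t
    proof -
      have "\<gamma> s - \<gamma> t = (s - t) *\<^sub>R (w - z)"
        by (simp add: \<gamma>_def linepath_def algebra_simps)
      hence "\<gamma> s \<noteq> \<gamma> t" using that False by (metis eq_iff_diff_eq_0 less_irrefl scaleR_eq_0_iff)
      hence "0 < md (\<gamma> s) (\<gamma> t)" using that by (intro model_dist_pos[OF curv_nonpos] \<gamma>m) auto
      thus ?thesis using add[of s t] that by simp
    qed
    show "d (\<phi> R (\<gamma> s)) (\<phi> R (\<gamma> t)) = md z (\<gamma> t) - md z (\<gamma> s)"
      if "0 \<le> s" "s \<le> t" "t \<le> 1" "t - s \<le> 2 * (\<delta> / 3)" for s t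
    proof -
      have "dist (s, t) (s, s) < \<delta>" using that \<delta>(1) by (simp add: dist_Pair_Pair dist_real_def)
      hence "dist (md (\<gamma> s) (\<gamma> t)) (md (\<gamma> s) (\<gamma> s)) < r" using \<delta>(2)[of "(s, s)" "(s, t)"] that by simp
      hence small: "md (\<gamma> s) (\<gamma> t) < r"
        using model_dist_self[OF curv_nonpos \<gamma>m[of s]] that by (simp add: dist_real_def)
      have le: "d (\<phi> R (\<gamma> s)) (\<phi> R (\<gamma> t)) \<le> md (\<gamma> s) (\<gamma> t)"
        using sub(2)[OF that(1-3)] S intr_polygon by (intro d_le_md R) blast
      have ti: "\<gamma> t \<in> intr R" using \<gamma>S[of t] that S by auto
      have "\<exists>v\<in>intr R. \<phi> R (\<gamma> t) = Fac R v \<and> md (\<gamma> s) v \<le> d (\<phi> R (\<gamma> s)) (\<phi> R (\<gamma> t))"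
        by (rule r(2)[OF _ polygon_map_M[OF R subsetD[OF intr_polygon ti]]])
           (use \<gamma>S[of s] that le small in auto)
      hence "md (\<gamma> s) (\<gamma> t) \<le> d (\<phi> R (\<gamma> s)) (\<phi> R (\<gamma> t))" using ti by auto
      thus ?thesis using le add[OF that(1-3)] by simp
    qed
  qed (use \<delta>(1) in auto)
  thus ?thesis using model_dist_self[OF curv_nonpos \<gamma>m[of 0]] by (simp add: \<gamma>_def linepath_0' linepath_1')
qed

text \<open>Segments in \<open>C\<close> are geodesics of the right length, and both metrics are continuous up to the closure of \<open>C\<close>.
  Boundary points are reached in this way, although no neighbourhood of them in the complex is known.\<close>

lemma d_closure_convex:
  assumes R: "R \<in> faces X" and C: "convex C" "C \<subseteq> intr R" and z: "z \<in> closure C" and w: "w \<in> closure C"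
  shows "d (\<phi> R z) (\<phi> R w) = md z w"
proof -
  have CP: "closure C \<subseteq> polygon (ps R)" unfolding polygon_closure[OF R] using C(2) by (rule closure_mono)
  have Cc: "convex (closure C)" using C(1) by (rule convex_closure)
  have to_end: "((\<lambda>n. d (\<phi> R u) (\<phi> R (f n))) \<longlonglongrightarrow> 0)" if u: "u \<in> closure C" and f: "\<And>n. f n \<in> C" "f \<longlonglongrightarrow> u" for u and f :: "nat \<Rightarrow> complex"
  proof (rule tendsto_sandwich[OF _ _ tendsto_const])
    have um: "u \<in> model_plane \<kappa>" using u CP polygon_model[OF R] by blast
    show "(\<lambda>n. md u (f n)) \<longlonglongrightarrow> 0"
      using tendsto_model_dist[OF curv_nonpos tendsto_const f(2) um um] model_dist_self[OF curv_nonpos um] by simp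
    have "closed_segment u (f n) \<subseteq> polygon (ps R)" for n
      using closed_segment_subset[OF u _ Cc, of "f n"] f(1)[of n] closure_subset CP by blast
    thus "\<forall>\<^sub>F n in sequentially. d (\<phi> R u) (\<phi> R (f n)) \<le> md u (f n)"
      using d_le_md[OF R] by simp
  qed simp
  obtain f where f: "\<And>n. f n \<in> C" "f \<longlonglongrightarrow> z" using z closure_sequential by blast
  obtain g where g: "\<And>n. g n \<in> C" "g \<longlonglongrightarrow> w" using w closure_sequential by blast
  have fM: "\<phi> R (f n) \<in> M" "\<phi> R (g n) \<in> M" for n
    using polygon_map_M[OF R] f(1)[of n] g(1)[of n] closure_subset[of C] CP by blast+
  have zM: "\<phi> R z \<in> M" "\<phi> R w \<in> M" using z w CP by (auto intro!: polygon_map_M R)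
  have eq: "d (\<phi> R (f n)) (\<phi> R (g n)) = md (f n) (g n)" for n
    using closed_segment_subset[OF f(1) g(1) C(1)] C(2) by (intro d_segment_intr R) blast
  have "(\<lambda>n. md (f n) (g n)) \<longlonglongrightarrow> md z w"
    using z w CP polygon_model[OF R] by (intro tendsto_model_dist[OF curv_nonpos f(2) g(2)]) auto
  moreover have "(\<lambda>n. md (f n) (g n)) \<longlonglongrightarrow> d (\<phi> R z) (\<phi> R w)"
  proof (rule Lim_transform2[of "\<lambda>_. d (\<phi> R z) (\<phi> R w)"])
    have lim: "(\<lambda>n. d (\<phi> R z) (\<phi> R (f n)) + d (\<phi> R w) (\<phi> R (g n))) \<longlonglongrightarrow> 0"
      using tendsto_add[OF to_end[OF z f] to_end[OF w g]] by simp
    have "\<bar>d (\<phi> R z) (\<phi> R w) - md (f n) (g n)\<bar> \<le> d (\<phi> R z) (\<phi> R (f n)) + d (\<phi> R w) (\<phi> R (g n))" for n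
      unfolding eq[symmetric]
      using triangle[OF zM(1) fM(1)[of n] zM(2)] triangle[OF fM(1)[of n] fM(2)[of n] zM(2)]
        triangle[OF fM(1)[of n] zM(1) fM(2)[of n]] triangle[OF zM fM(2)[of n]]
        commute[of "\<phi> R z" "\<phi> R (f n)"] commute[of "\<phi> R w" "\<phi> R (g n)"] by linarith
    hence "\<forall>\<^sub>F n in sequentially. norm (d (\<phi> R z) (\<phi> R w) - md (f n) (g n))
        \<le> d (\<phi> R z) (\<phi> R (f n)) + d (\<phi> R w) (\<phi> R (g n))" by simp
    thus "(\<lambda>n. d (\<phi> R z) (\<phi> R w) - md (f n) (g n)) \<longlonglongrightarrow> 0"
      using lim by (rule Lim_null_comparison)
  qed simp
  ultimately show ?thesis using LIMSEQ_unique by blast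
qed

text \<open>Both points are in the closure of a half strip inside the cell \<open>R\<close>.\<close>

lemma d_edge:
  assumes R: "R \<in> faces X" "i < length (ps R)" and e: "e = edge R i"
    and s: "0 < s" "s < len P e" and t: "0 < t" "t < len P e"
  shows "d (Edg e s) (Edg e t) = \<bar>s - t\<bar>"
proof -
  interpret pp: plane_polygon "ps R" using face_shape R by blast
  obtain a where a: "a \<in> pp.open_side i" "coord R i a = s" using coord_surj[OF R] s e by blast
  obtain b where b: "b \<in> pp.open_side i" "coord R i b = t" using coord_surj[OF R] t e by blast
  obtain \<rho> where \<rho>: "pp.strip_width i a b \<rho>" by (rule pp.strip_width_exists[OF R(2) a(1) b(1)])
  hence "0 < \<rho>" by (simp add: pp.strip_width_def)
  obtain \<sigma> where \<sigma>: "\<sigma> \<noteq> 0" "pp.half_strip i \<sigma> a b \<rho> \<subseteq> polygon_interior (ps R)"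
    by (rule pp.half_strip_sign[OF R(2) a(1) \<rho>])
  have "a \<in> closure (pp.half_strip i \<sigma> a b \<rho>)" "b \<in> closure (pp.half_strip i \<sigma> a b \<rho>)"
    using a b \<open>0 < \<rho>\<close> \<sigma> pp.open_side_height by (auto intro!: pp.half_strip_closure[OF R(2)])
  hence "d (\<phi> R a) (\<phi> R b) = md a b" by (intro d_closure_convex[OF R(1) pp.convex_half_strip \<sigma>(2)])
  thus ?thesis using coord_md[OF R, of a b] a b pp.open_side_subset open_side_coord[OF R a(1)] open_side_coord[OF R b(1)] e
    by auto
qed

end

section \<open>Geodesics across an edge\<close>

lemma open_segment_near:
  fixes z a :: complex
  assumes "z \<noteq> a" "0 < e" obtains x where "x \<in> open_segment z a" "dist x a < e"
proof -
  have "a \<in> closure (open_segment z a)" using assms by simp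
  thus thesis using that assms(2) closure_approachable by blast
qed

lemma continuous_on_modulus:
  fixes f :: "'z::topological_space \<Rightarrow> real"
  assumes "\<And>q q'. q \<in> S \<Longrightarrow> q' \<in> S \<Longrightarrow> \<bar>f q' - f q\<bar> \<le> B q q'"
    and "\<And>q. q \<in> S \<Longrightarrow> (B q \<longlongrightarrow> 0) (at q within S)"
  shows "continuous_on S f"
  unfolding continuous_on_def
proof
  fix q assume q: "q \<in> S"
  have "\<forall>\<^sub>F q' in at q within S. norm (f q' - f q) \<le> B q q'"
    using assms(1)[OF q] by (auto simp: eventually_at_filter)
  hence "((\<lambda>q'. f q' - f q) \<longlongrightarrow> 0) (at q within S)"
    using assms(2)[OF q] by (rule Lim_null_comparison)
  thus "(f \<longlongrightarrow> f q) (at q within S)" by (rule LIM_zero_cancel)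
qed

context CAT0_complex begin

lemma md_small:
  assumes "a \<in> model_plane \<kappa>" "0 < e"
  obtains \<delta> where "0 < \<delta>" "\<And>x. dist x a < \<delta> \<Longrightarrow> md a x < e"
proof -
  have "((\<lambda>x. md a x) \<longlongrightarrow> md a a) (nhds a)"
    by (rule tendsto_model_dist[OF curv_nonpos tendsto_const filterlim_ident assms(1,1)])
  hence "\<forall>\<^sub>F x in nhds a. md a x < e"
    using assms model_dist_self[OF curv_nonpos assms(1)] by (auto dest: order_tendstoD(2))
  thus thesis using that unfolding eventually_nhds_metric by auto
qed

text \<open>The first point of a geodesic outside \<open>H\<close> is a limit of points of \<open>H\<close>, hence the image of a frontier point
  of \<open>H\<close>: as \<open>H\<close> is bounded, preimages of earlier points accumulate, and \<open>\<phi> R\<close> is isometric on the closure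
  of \<open>H\<close>.\<close>

lemma exit_point:
  assumes R: "R \<in> faces X" and H: "convex H" "open H" "H \<subseteq> intr R" and x: "x \<in> H"
    and p: "p \<in> M" "p \<notin> \<phi> R ` H"
  obtains z where "z \<in> closure H" "z \<notin> H" "btw (\<phi> R x) (\<phi> R z) p" "d (\<phi> R x) (\<phi> R z) = md x z"
proof -
  interpret pp: plane_polygon "ps R" using face_shape R by blast
  have CP: "closure H \<subseteq> polygon (ps R)" unfolding polygon_closure[OF R] using H(3) by (rule closure_mono)
  have HM: "\<phi> R z \<in> M" if "z \<in> closure H" for z using that CP by (intro polygon_map_M R) blast
  have xM: "\<phi> R x \<in> M" using x closure_subset HM by blast
  obtain S where "geodesic_segment M d (\<phi> R x) p S" using geodesic_exists xM p by blast
  then obtain c where c: "c ` {0..d (\<phi> R x) p} \<subseteq> M" "c 0 = \<phi> R x" "c (d (\<phi> R x) p) = p"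
    "\<And>s t. s \<in> {0..d (\<phi> R x) p} \<Longrightarrow> t \<in> {0..d (\<phi> R x) p} \<Longrightarrow> d (c s) (c t) = \<bar>s - t\<bar>"
    unfolding geodesic_segment_def by metis
  define L where "L = d (\<phi> R x) p"
  have L0: "0 \<le> L" by (simp add: L_def)
  note c = c[folded L_def]
  have cM: "c t \<in> M" if "0 \<le> t" "t \<le> L" for t using c(1) that by auto
  define T where "T = {t \<in> {0..L}. c t \<notin> \<phi> R ` H}"
  define \<tau> where "\<tau> = Inf T"
  have LT: "L \<in> T" using p c(3) L0 by (simp add: T_def)
  have bdd: "bdd_below T" by (auto simp: T_def intro!: bdd_belowI[of _ 0])
  have \<tau>L: "0 \<le> \<tau>" "\<tau> \<le> L"
    unfolding \<tau>_def using LT bdd by (auto intro: cInf_lower cInf_greatest simp: T_def)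
  have before: "c t \<in> \<phi> R ` H" if "0 \<le> t" "t < \<tau>" for t
  proof (rule ccontr)
    assume "\<not> ?thesis"
    hence "t \<in> T" using that \<tau>L by (auto simp: T_def)
    thus False using cInf_lower[OF _ bdd, of t] that by (simp add: \<tau>_def)
  qed
  have \<tau>T: "c \<tau> \<notin> \<phi> R ` H"
  proof
    assume "c \<tau> \<in> \<phi> R ` H"
    then obtain z where z: "z \<in> H" "c \<tau> = \<phi> R z" by blast
    obtain r where r: "0 < r" "\<And>u q. u \<in> {z} \<Longrightarrow> q \<in> M \<Longrightarrow> d (\<phi> R u) q < r \<Longrightarrow>
        \<exists>w\<in>H. q = Fac R w \<and> md u w \<le> d (\<phi> R u) q"
      by (rule uniform_neighbourhood[OF R _ _ H(2,3), of "{z}"]) (use z in auto)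
    obtain t where t: "t \<in> T" "t < \<tau> + r"
      using cInf_lessD[of T "\<tau> + r"] LT r(1) by (auto simp: \<tau>_def)
    have "\<tau> \<le> t" unfolding \<tau>_def by (rule cInf_lower[OF t(1) bdd])
    hence "d (\<phi> R z) (c t) < r" using c(4)[of \<tau> t] t \<tau>L z by (auto simp: T_def)
    then obtain w where "w \<in> H" "c t = Fac R w" using r(2)[of z "c t"] cM t by (auto simp: T_def)
    hence "c t \<in> \<phi> R ` H" using H(3) by (intro image_eqI[of _ _ w]) auto
    thus False using t by (simp add: T_def)
  qed
  hence \<tau>0: "0 < \<tau>" using c(2) x \<tau>L by (cases "\<tau> = 0") auto
  define t where "t n = \<tau> * (1 - 1 / real (Suc n))" for n
  have tn: "0 \<le> t n" "t n < \<tau>" for n using \<tau>0 by (auto simp: t_def)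
  have tlim: "t \<longlonglongrightarrow> \<tau>"
  proof -
    have "(\<lambda>n. \<tau> * (1 - 1 / real (Suc n))) \<longlonglongrightarrow> \<tau> * (1 - 0)"
      by (intro tendsto_intros LIMSEQ_Suc lim_1_over_n)
    thus ?thesis by (simp add: t_def[abs_def])
  qed
  have "\<forall>n. \<exists>z. z \<in> H \<and> c (t n) = \<phi> R z" using before tn by blast
  then obtain f where f: "\<And>n. f n \<in> H" "\<And>n. c (t n) = \<phi> R (f n)" by metis
  have "compact (closure H)"
    using bounded_subset[OF pp.intr_facts(2) H(3)] by simp
  then obtain z g where zg: "z \<in> closure H" "strict_mono g" "(f \<circ> g) \<longlonglongrightarrow> z"
    using f(1) closure_subset unfolding compact_def by (metis subsetD)
  have zm: "z \<in> model_plane \<kappa>" using zg(1) CP polygon_model[OF R] by blast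
  have "(\<lambda>n. md z (f (g n))) \<longlonglongrightarrow> md z z"
    using zg(3) by (intro tendsto_model_dist[OF curv_nonpos tendsto_const _ zm zm]) (simp add: o_def)
  hence lim1: "(\<lambda>n. md z (f (g n))) \<longlonglongrightarrow> 0" using model_dist_self[OF curv_nonpos zm] by simp
  have lim2: "(\<lambda>n. \<tau> - t (g n)) \<longlonglongrightarrow> 0"
    using LIMSEQ_subseq_LIMSEQ[OF tlim zg(2)] tendsto_diff[OF tendsto_const[of \<tau>]] by (fastforce simp: o_def)
  have le: "d (\<phi> R z) (c \<tau>) \<le> md z (f (g n)) + (\<tau> - t (g n))" for n
  proof -
    have "d (\<phi> R z) (c (t (g n))) = md z (f (g n))"
      unfolding f(2) by (rule d_closure_convex[OF R H(1,3) zg(1)]) (use f(1) closure_subset in blast)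
    moreover have "d (c (t (g n))) (c \<tau>) = \<tau> - t (g n)" using c(4)[of "t (g n)" \<tau>] tn[of "g n"] \<tau>L by auto
    ultimately show ?thesis
      using triangle[OF HM[OF zg(1)] cM[of "t (g n)"] cM[OF \<tau>L]] tn[of "g n"] \<tau>L by auto
  qed
  have "d (\<phi> R z) (c \<tau>) \<le> 0"
    using tendsto_add[OF lim1 lim2] le by (intro LIMSEQ_le_const[of _ 0]) auto
  hence "d (\<phi> R z) (c \<tau>) = 0" using nonneg[of "\<phi> R z" "c \<tau>"] by linarith
  hence cz: "c \<tau> = \<phi> R z" using zero[OF HM[OF zg(1)] cM[OF \<tau>L]] by simp
  have "btw (\<phi> R x) (\<phi> R z) p"
    using c(4)[of 0 \<tau>] c(4)[of \<tau> L] c(2,3) \<tau>L cz xM p HM[OF zg(1)] by (auto simp: btw_def L_def)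
  moreover have "z \<notin> H" using \<tau>T cz by blast
  moreover have "d (\<phi> R x) (\<phi> R z) = md x z"
    using x closure_subset by (intro d_closure_convex[OF R H(1,3) _ zg(1)]) blast
  ultimately show thesis using that zg(1) by blast
qed

lemma side_neighbours:
  assumes R: "R \<in> faces X" "j < length (ps R)" and b: "b \<in> open_side R j" and e: "0 < e"
  obtains b1 b2 where "b1 \<in> open_side R j" "b2 \<in> open_side R j" "dist b1 b < e" "dist b2 b < e"
    "coord R j b1 < coord R j b" "coord R j b < coord R j b2"
proof -
  interpret pp: plane_polygon "ps R" using face_shape R by blast
  let ?P = "ps R ! j" and ?Q = "ps R ! nxt R j"
  have bne: "b \<noteq> ?P" "b \<noteq> ?Q" using b by (auto simp: pp.open_side_def open_segment_def)
  have bs: "b \<in> closed_segment ?P ?Q" using b by (auto simp: pp.open_side_def open_segment_def)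
  obtain u where u: "u \<in> open_segment ?P b" "dist u b < e" using open_segment_near[of ?P b e] bne e by metis
  obtain v where v: "v \<in> open_segment ?Q b" "dist v b < e" using open_segment_near[of ?Q b e] bne e by metis
  have us: "u \<in> side (ps R) j" "v \<in> side (ps R) j"
    using closed_segment_subset[of _ "closed_segment ?P ?Q" b] bs u v by (auto simp: side_def open_segment_def)
  have sm: "side (ps R) j \<subseteq> model_plane \<kappa>" using polygon_model[OF R(1)] side_polygon[OF R] by blast
  hence m: "u \<in> model_plane \<kappa>" "v \<in> model_plane \<kappa>" "b \<in> model_plane \<kappa>" "?P \<in> model_plane \<kappa>" "?Q \<in> model_plane \<kappa>"
    using us bs unfolding side_def by blast+
  have 1: "md ?P b = md ?P u + md u b" "md ?Q b = md ?Q v + md v b"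
    using u v by (auto intro!: model_dist_additive[OF curv_nonpos] m m(5)[simplified] simp: open_segment_def)
  have pos: "0 < md ?P u" "0 < md u b" "0 < md ?Q v" "0 < md v b"
    using u v by (auto intro!: model_dist_pos[OF curv_nonpos] m m(5)[simplified] simp: open_segment_def)
  have uo: "u \<in> open_side R j" "v \<in> open_side R j"
  proof -
    have "u \<noteq> ?P" "u \<noteq> b" "v \<noteq> ?Q" "v \<noteq> b" using u v by (auto simp: open_segment_def)
    moreover have "u \<noteq> ?Q"
      using 1(1) pos side_md[OF R, of b] bs model_dist_nonneg[OF curv_nonpos m(3,5)] face_shape(4)[OF R]
      by (auto simp: side_def)
    moreover have "v \<noteq> ?P"
      using 1(2) pos side_md[OF R, of b] bs model_dist_nonneg[OF curv_nonpos m(4,3)] face_shape(4)[OF R]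
        model_dist_commute[OF curv_nonpos, of ?Q b] model_dist_commute[OF curv_nonpos, of ?Q ?P]
      by (auto simp: side_def)
    ultimately show "u \<in> open_side R j" "v \<in> open_side R j" using us pp.side_cases by blast+
  qed
  have 2: "md ?P b < md ?P v"
    using side_md[OF R us(2)] side_md[OF R, of b] bs 1(2) pos model_dist_commute[OF curv_nonpos, of ?Q b]
      model_dist_commute[OF curv_nonpos, of ?Q v] by (simp add: side_def)
  have 3: "md ?P u < md ?P b" using 1 pos by simp
  show thesis
  proof (cases "snd (bdry X R ! j)")
    case True
    thus thesis using that[of u v] uo u v 2 3 by (simp add: coord_def)
  next
    case False
    thus thesis using that[of v u] uo u v 2 3 by (simp add: coord_def)
  qed
qed

text \<open>The endpoint \<open>w\<close> runs over a connected set \<open>N\<close> joining one half of the edge to the other, and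
  every geodesic from \<open>x\<close> to \<open>N\<close> crosses the edge; hence one of them crosses it at the
  prescribed point.\<close>

lemma crossing_by_connectedness:
  assumes x: "x \<in> M" and J: "J = {t - \<mu>..t + \<mu>}" "0 \<le> \<mu>" and M: "\<And>s. s \<in> J \<Longrightarrow> Edg e s \<in> M"
    and iso: "\<And>s s'. s \<in> J \<Longrightarrow> s' \<in> J \<Longrightarrow> d (Edg e s) (Edg e s') = \<bar>s - s'\<bar>"
    and N: "compact N" "connected N" "N \<subseteq> model_plane \<kappa>"
    and fM: "\<And>w. w \<in> N \<Longrightarrow> f w \<in> M"
    and f: "\<And>w w'. w \<in> N \<Longrightarrow> w' \<in> N \<Longrightarrow> d (f w) (f w') \<le> md w w'"
    and cross: "\<And>w. w \<in> N \<Longrightarrow> \<exists>s\<in>J. btw x (Edg e s) (f w)"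
    and b1: "b1 \<in> N" "s1 \<in> J" "s1 \<le> t" "f b1 = Edg e s1"
    and b2: "b2 \<in> N" "s2 \<in> J" "t \<le> s2" "f b2 = Edg e s2"
  obtains w where "w \<in> N" "btw x (Edg e t) (f w)"
proof -
  \<comment> \<open>\<open>E (w, s)\<close> vanishes if and only if \<open>Edg e s\<close> is between \<open>x\<close> and \<open>f w\<close>\<close>
  define E where "E q = d x (Edg e (snd q)) + d (Edg e (snd q)) (f (fst q)) - d x (f (fst q))" for q
  have tri: "\<bar>d a p - d b q\<bar> \<le> d a b + d p q" if "a \<in> M" "b \<in> M" "p \<in> M" "q \<in> M" for a b p q
    using triangle[of a b p] triangle[of b q p] triangle[of b a q] triangle[of a p q] that
      commute[of a b] commute[of p q] by linarith
  have contE: "continuous_on (N \<times> J) E"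
  proof (rule continuous_on_modulus)
    fix q q' assume q: "q \<in> N \<times> J" "q' \<in> N \<times> J"
    have Ms: "Edg e (snd q) \<in> M" "Edg e (snd q') \<in> M" "f (fst q) \<in> M" "f (fst q') \<in> M"
      using q M fM by (auto simp: mem_Times_iff)
    have xx: "d x x = 0" using x by simp
    have "d (Edg e (snd q)) (Edg e (snd q')) = \<bar>snd q - snd q'\<bar>" using iso q by (auto simp: mem_Times_iff)
    moreover have "d (f (fst q)) (f (fst q')) \<le> md (fst q) (fst q')" using f q by (auto simp: mem_Times_iff)
    ultimately show "\<bar>E q' - E q\<bar> \<le> 2 * \<bar>snd q - snd q'\<bar> + 2 * md (fst q) (fst q')"
      unfolding E_def using tri[OF x x Ms(1,2)] tri[OF x x Ms(3,4)] tri[OF Ms(1,2,3,4)] xx by argo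
  next
    fix q assume q: "q \<in> N \<times> J"
    hence m: "fst q \<in> model_plane \<kappa>" using N by auto
    have 1: "((\<lambda>q'. fst q') \<longlongrightarrow> fst q) (at q within N \<times> J)" "((\<lambda>q'. snd q') \<longlongrightarrow> snd q) (at q within N \<times> J)"
      by (auto intro!: tendsto_intros tendsto_ident_at)
    have "((\<lambda>q'. 2 * \<bar>snd q - snd q'\<bar> + 2 * md (fst q) (fst q')) \<longlongrightarrow>
        2 * \<bar>snd q - snd q\<bar> + 2 * md (fst q) (fst q)) (at q within N \<times> J)"
      by (intro tendsto_intros 1 tendsto_model_dist[OF curv_nonpos tendsto_const 1(1) m m])
    thus "((\<lambda>q'. 2 * \<bar>snd q - snd q'\<bar> + 2 * md (fst q) (fst q')) \<longlongrightarrow> 0) (at q within N \<times> J)"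
      using model_dist_self[OF curv_nonpos m] by simp
  qed
  have E0: "E (w, s) = 0 \<longleftrightarrow> btw x (Edg e s) (f w)" if "w \<in> N" "s \<in> J" for w s
    using that x M fM by (auto simp: E_def btw_def)
  define S where "S I = fst ` {q \<in> N \<times> I. E q = 0}" for I
  have cl: "closed (S I)" if "I \<subseteq> J" "compact I" for I
  proof -
    have NI: "compact (N \<times> I)" using N that by (intro compact_Times)
    have "continuous_on (N \<times> I) E" by (rule continuous_on_subset[OF contE]) (use that in auto)
    hence "closed {q \<in> N \<times> I. E q = 0}"
      using NI compact_imp_closed by (intro continuous_closed_preimage_constant) auto
    hence "compact ((N \<times> I) \<inter> {q \<in> N \<times> I. E q = 0})" using NI by (intro compact_Int_closed)
    hence "compact {q \<in> N \<times> I. E q = 0}" by (simp add: Int_absorb1 Collect_conj_eq inf_commute)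
    thus ?thesis unfolding S_def
      by (intro compact_imp_closed compact_continuous_image continuous_on_fst continuous_on_id)
  qed
  let ?A = "S {t - \<mu>..t}" and ?B = "S {t..t + \<mu>}"
  have "closed ?A" "closed ?B" using J by (auto intro!: cl)
  moreover have "N \<subseteq> ?A \<union> ?B"
  proof
    fix w assume w: "w \<in> N"
    then obtain s where "s \<in> J" "btw x (Edg e s) (f w)" using cross by blast
    hence "E (w, s) = 0" "s \<in> {t - \<mu>..t} \<or> s \<in> {t..t + \<mu>}" using E0 w J by auto
    thus "w \<in> ?A \<union> ?B" using w unfolding S_def by (auto intro!: image_eqI[of w fst "(w, s)"])
  qed
  moreover have "?A \<inter> N \<noteq> {}"
  proof -
    have "E (b1, s1) = 0" using E0[OF b1(1,2)] btw_right[OF x M[OF b1(2)]] b1(4) by simp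
    hence "b1 \<in> ?A" using b1 J unfolding S_def by (intro image_eqI[of b1 fst "(b1, s1)"]) auto
    thus ?thesis using b1 by blast
  qed
  moreover have "?B \<inter> N \<noteq> {}"
  proof -
    have "E (b2, s2) = 0" using E0[OF b2(1,2)] btw_right[OF x M[OF b2(2)]] b2(4) by simp
    hence "b2 \<in> ?B" using b2 J unfolding S_def by (intro image_eqI[of b2 fst "(b2, s2)"]) auto
    thus ?thesis using b2 by blast
  qed
  ultimately have "?A \<inter> ?B \<inter> N \<noteq> {}" using N(2) unfolding connected_closed by blast
  then obtain w where w: "w \<in> N" "w \<in> ?A" "w \<in> ?B" by blast
  have SD: "\<exists>s\<in>I. E (w, s) = 0" if "w \<in> S I" for w I using that by (auto simp: S_def)
  obtain u where u: "u \<in> {t - \<mu>..t}" "E (w, u) = 0" using SD[OF w(2)] by blast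
  obtain v where v: "v \<in> {t..t + \<mu>}" "E (w, v) = 0" using SD[OF w(3)] by blast
  have in_J: "u \<in> J" "v \<in> J" "t \<in> J" using u v J by auto
  \<comment> \<open>the geodesic from \<open>x\<close> to \<open>f w\<close> contains the part of the edge from \<open>u\<close> to \<open>v\<close>\<close>
  have "btw (Edg e u) (Edg e t) (Edg e v)"
    using iso[OF in_J(1,3)] iso[OF in_J(3,2)] iso[OF in_J(1,2)] M in_J u v by (auto simp: btw_def)
  hence "btw x (Edg e t) (f w)"
    using btw_merge[of x "Edg e u" "f w" "Edg e v"] E0[OF w(1) in_J(1)] E0[OF w(1) in_J(2)] u v by blast
  thus thesis using that w by blast
qed

text \<open>The set \<open>N\<close> to which \<open>crossing_by_connectedness\<close> applies consists of two segments in \<open>R'\<close> that lead from one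
  half of \<open>e\<close> through the interior of the cell to the other half. Geodesics from \<open>x\<close> to points of \<open>N\<close> leave the half
  disc \<open>H\<close> at \<open>a\<close> through its diameter, because they are too short to reach the arc.\<close>

lemma crossing:
  assumes R: "R \<in> faces X" "i < length (ps R)" and R': "R' \<in> faces X" "j < length (ps R')"
    and ne: "(R, i) \<noteq> (R', j)" and e: "edge R i = e" "edge R' j = e"
    and a: "a \<in> open_side R i" and z: "z \<in> intr R" "open_segment z a \<subseteq> intr R"
  obtains x b w where "x \<in> open_segment z a" "b \<in> open_side R' j" "\<phi> R' b = \<phi> R a" "w \<in> intr R'"
    "open_segment b w \<subseteq> intr R'" "btw (\<phi> R x) (\<phi> R a) (\<phi> R' w)"
proof -
  interpret p: plane_polygon "ps R" using face_shape R by blast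
  interpret q: plane_polygon "ps R'" using face_shape R' by blast
  define t where "t = coord R i a"
  note a_co = open_side_coord[OF R a, unfolded e(1), folded t_def]
  obtain b where b: "b \<in> open_side R' j" "coord R' j b = t"
    using coord_surj[OF R', of t] a_co e by auto
  have b_co: "\<phi> R' b = Edg e t" using open_side_coord[OF R' b(1)] b e by simp
  have a_s: "a \<in> side (ps R) i" and b_s: "b \<in> side (ps R') j"
    using p.open_side_subset a q.open_side_subset b by blast+
  have am: "a \<in> model_plane \<kappa>" and bm: "b \<in> model_plane \<kappa>"
    using a_s b_s polygon_model side_polygon R R' by blast+
  have ab: "a \<noteq> b" if "R = R'" using that ne p.open_side_disjoint[OF R(2) _ _ a, of j] b_s R' by auto
  \<comment> \<open>half discs at \<open>a\<close> and \<open>b\<close> of a common radius, disjoint if they lie in the same cell\<close>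
  obtain \<rho>1 where \<rho>1: "p.strip_width i a a \<rho>1" by (rule p.strip_width_exists[OF R(2) a a])
  obtain \<rho>2 where \<rho>2: "q.strip_width j b b \<rho>2" by (rule q.strip_width_exists[OF R'(2) b(1) b(1)])
  define \<rho> where "\<rho> = min (min \<rho>1 \<rho>2) (if R = R' then dist a b / 2 else 1)"
  have "0 < \<rho>1" "0 < \<rho>2" using \<rho>1 \<rho>2 by (simp_all add: p.strip_width_def q.strip_width_def)
  hence \<rho>: "0 < \<rho>" "\<rho> \<le> \<rho>1" "\<rho> \<le> \<rho>2" "R = R' \<Longrightarrow> \<rho> \<le> dist a b / 2" using ab by (auto simp: \<rho>_def)
  have wd: "p.strip_width i a a \<rho>" "q.strip_width j b b \<rho>"
    using p.strip_width_mono[OF \<rho>1 \<rho>(1,2)] q.strip_width_mono[OF \<rho>2 \<rho>(1,3)] .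
  \<comment> \<open>short geodesics from \<open>a\<close> into \<open>R\<close> stay in the disc of radius \<open>\<rho>\<close>\<close>
  obtain \<mu>0 where \<mu>0: "0 < \<mu>0" "\<And>u. u \<in> polygon (ps R) \<Longrightarrow> \<rho> \<le> dist u a \<Longrightarrow> \<mu>0 \<le> md a u"
  proof (cases "polygon (ps R) - ball a \<rho> = {}")
    case True
    have "dist u a < \<rho>" if "u \<in> polygon (ps R)" for u
      using subsetD[of "polygon (ps R)" "ball a \<rho>" u] True that by (simp add: dist_commute)
    thus thesis using that[of 1] by force
  next
    case False
    have sub: "polygon (ps R) - ball a \<rho> \<subseteq> model_plane \<kappa>" using polygon_model R by blast
    have cont: "continuous_on (polygon (ps R) - ball a \<rho>) (md a)"
      using continuous_on_model_dist_comp[OF curv_nonpos continuous_on_const continuous_on_id, of a _]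
        sub am by (auto simp: image_subset_iff)
    have "compact (polygon (ps R) - ball a \<rho>)" using p.compact_polygon by (intro compact_diff) auto
    from continuous_attains_inf[OF this False cont] obtain u where
      u: "u \<in> polygon (ps R) - ball a \<rho>" "\<And>v. v \<in> polygon (ps R) - ball a \<rho> \<Longrightarrow> md a u \<le> md a v" by blast
    moreover have "0 < md a u" using u(1) sub \<rho> am by (intro model_dist_pos[OF curv_nonpos]) auto
    ultimately show thesis using that[of "md a u"] by (auto simp: dist_commute)
  qed
  define \<mu> where "\<mu> = min \<mu>0 (min t (len P e - t) / 2)"
  have \<mu>: "0 < \<mu>" "\<mu> \<le> \<mu>0" "\<mu> < t" "t + \<mu> < len P e" using \<mu>0(1) a_co(2,3) by (auto simp: \<mu>_def min_def field_simps)
  define J where "J = {t - \<mu>..t + \<mu>}"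
  have J: "0 < s" "s < len P e" if "s \<in> J" for s using that \<mu> by (auto simp: J_def)
  have eX: "e \<in> edges X" using face_shape(5)[OF R] e by simp
  have JM: "Edg e s \<in> M" if "s \<in> J" for s using J[OF that] eX by (auto simp: metric_realization_def)
  have tJ: "t \<in> J" using \<mu> by (simp add: J_def)
  have iso: "d (Edg e s) (Edg e s') = \<bar>s - s'\<bar>" if "s \<in> J" "s' \<in> J" for s s'
    using d_edge[OF R e(1)[symmetric]] J that by blast
  obtain \<delta>1 where \<delta>1: "0 < \<delta>1" "\<And>u. dist u a < \<delta>1 \<Longrightarrow> md a u < \<mu> / 3" using md_small[OF am, of "\<mu> / 3"] \<mu> by auto
  obtain \<delta>2 where \<delta>2: "0 < \<delta>2" "\<And>u. dist u b < \<delta>2 \<Longrightarrow> md b u < \<mu> / 3" using md_small[OF bm, of "\<mu> / 3"] \<mu> by auto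
  have za: "z \<noteq> a" using z(1) a_s p.intr_facts(4) R(2) by (auto simp: polygon_boundary_def)
  obtain x where x: "x \<in> open_segment z a" "dist x a < min \<rho> \<delta>1"
    by (rule open_segment_near[OF za, of "min \<rho> \<delta>1"]) (use \<rho> \<delta>1 in auto)
  have xi: "x \<in> intr R" using x z by blast
  have hx: "p.height i x \<noteq> 0"
  proof
    assume "p.height i x = 0"
    hence "x \<in> open_side R i" using p.strip_widthD(1)[OF wd(1), of a x] x by simp
    thus False using xi p.intr_facts(4) p.open_side_subset R(2) by (auto simp: polygon_boundary_def)
  qed
  define H where "H = p.half_strip i (p.height i x) a a \<rho>"
  have xH: "x \<in> H" unfolding H_def p.half_strip_def using x hx by (auto simp: zero_less_mult_iff)
  have HR: "H \<subseteq> intr R" using p.half_strip_interior[OF R(2) wd(1)] xH xi unfolding H_def by blast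
  have Hc: "convex H" "open H" unfolding H_def by (rule p.convex_half_strip p.open_half_strip)+
  have xm: "x \<in> model_plane \<kappa>" using xi intr_model[OF R(1)] by blast
  have xM: "\<phi> R x \<in> M" using xi intr_polygon by (intro polygon_map_M R) blast
  have clH: "u \<in> closure H" if "p.height i u = 0" "dist u a < \<rho>" for u
    using p.open_segment_half_disc(2)[OF that, of x] xH by (simp add: H_def)
  have dxa: "d (\<phi> R x) (\<phi> R a) = md x a"
    using d_closure_convex[OF R(1) Hc(1) HR, of x a] xH closure_subset clH[of a] p.open_side_height[OF a] \<rho> by auto
  have xa3: "md x a < \<mu> / 3" using \<delta>1(2)[of x] x model_dist_commute[OF curv_nonpos, of x a] by simp
  obtain \<sigma> where \<sigma>: "\<sigma> \<noteq> 0" "q.half_strip j \<sigma> b b \<rho> \<subseteq> intr R'" by (rule q.half_strip_sign[OF R'(2) b(1) wd(2)])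
  define H' where "H' = q.half_strip j \<sigma> b b \<rho>"
  have H'R: "H' \<subseteq> intr R'" using \<sigma> by (simp add: H'_def)
  have H'c: "convex H'" unfolding H'_def by (rule q.convex_half_strip)
  have hb: "q.height j b = 0" using q.open_side_height[OF b(1)] .
  have "b \<in> closure H'" unfolding H'_def
    by (rule q.half_strip_closure[OF R'(2)]) (use hb \<rho> \<sigma> in auto)
  then obtain w0 where w0: "w0 \<in> H'" "dist w0 b < min \<rho> \<delta>2"
    using \<rho> \<delta>2 unfolding closure_approachable by (metis min_less_iff_conj)
  obtain b1 b2 where b12: "b1 \<in> open_side R' j" "b2 \<in> open_side R' j"
    "dist b1 b < min \<rho> \<delta>2" "dist b2 b < min \<rho> \<delta>2" "coord R' j b1 < t" "t < coord R' j b2"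
    using side_neighbours[OF R' b(1), of "min \<rho> \<delta>2"] \<rho> \<delta>2 b(2) by auto
  define N where "N = closed_segment b1 w0 \<union> closed_segment w0 b2"
  have Nball: "dist w b < min \<rho> \<delta>2" if "w \<in> N" for w
  proof -
    have "closed_segment b1 w0 \<subseteq> ball b (min \<rho> \<delta>2)" "closed_segment w0 b2 \<subseteq> ball b (min \<rho> \<delta>2)"
      using b12 w0 by (intro closed_segment_subset; simp add: dist_commute)+
    thus ?thesis using that by (auto simp: N_def dist_commute)
  qed
  have seg: "open_segment u w \<subseteq> H'" "u \<in> closure H'" if "q.height j u = 0" "dist u b < \<rho>" "w \<in> H'" for u w
    using q.open_segment_half_disc[of j u b \<rho> w \<sigma>] that by (simp_all add: H'_def)
  have hb12: "q.height j b1 = 0" "q.height j b2 = 0" using q.open_side_height b12 by blast+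
  have NH: "w \<in> H' \<or> w = b1 \<or> w = b2" if "w \<in> N" for w
    using that seg(1)[OF hb12(1) _ w0(1)] seg(1)[OF hb12(2) _ w0(1)] b12 w0
    by (auto simp: N_def open_segment_def closed_segment_commute)
  have NclH: "w \<in> closure H'" if "w \<in> N" for w
    using NH[OF that] seg(2)[OF hb12(1) _ w0(1)] seg(2)[OF hb12(2) _ w0(1)] b12 closure_subset by auto
  have clH'P: "closure H' \<subseteq> polygon (ps R')" unfolding polygon_closure[OF R'(1)] using H'R by (rule closure_mono)
  have wM: "\<phi> R' w \<in> M" if "w \<in> N" for w using NclH[OF that] clH'P by (intro polygon_map_M R') blast
  have wd_iso: "d (\<phi> R' w) (\<phi> R' w') = md w w'" if "w \<in> N" "w' \<in> N" for w w'
    using that by (intro d_closure_convex[OF R'(1) H'c H'R] NclH)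
  have dbw: "d (\<phi> R' b) (\<phi> R' w) < \<mu> / 3" if "w \<in> N" for w
  proof -
    have "d (\<phi> R' b) (\<phi> R' w) = md b w"
      using d_closure_convex[OF R'(1) H'c H'R \<open>b \<in> closure H'\<close> NclH[OF that]] .
    thus ?thesis using \<delta>2(2)[of w] Nball[OF that] by simp
  qed
  have yM: "Edg e t \<in> M" using JM tJ by blast
  have dxw: "d (\<phi> R x) (\<phi> R' w) < 2 * \<mu> / 3" if "w \<in> N" for w
    using triangle[OF xM yM wM[OF that]] dbw[OF that] dxa xa3 b_co a_co by simp
  have side_coord: "\<phi> R' u = Edg e (coord R' j u)" if "u \<in> open_side R' j" for u
    using open_side_coord[OF R' that] e by simp
  have coJ: "coord R' j u \<in> J" if "u \<in> {b1, b2}" for u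
  proof -
    have uN: "u \<in> N" and us: "u \<in> side (ps R') j" using that b12 q.open_side_subset by (auto simp: N_def)
    have "md b u < \<mu> / 3" using dbw[OF uN] \<delta>2(2)[of u] Nball[OF uN] by simp
    hence "\<bar>t - coord R' j u\<bar> < \<mu>" using coord_md[OF R' b_s us] b(2) \<mu>(1) by linarith
    thus ?thesis by (auto simp: J_def)
  qed
  have cross: "\<exists>s\<in>J. btw (\<phi> R x) (Edg e s) (\<phi> R' w)" if w: "w \<in> N" for w
  proof (cases "w \<in> H'")
    case False
    hence "w \<in> {b1, b2}" using NH[OF w] by blast
    moreover from this have "\<phi> R' w = Edg e (coord R' j w)" using side_coord b12 by blast
    ultimately show ?thesis using coJ btw_right[OF xM wM[OF w]] by force
  next
    case True
    have "\<phi> R' w \<notin> \<phi> R ` H"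
    proof
      assume "\<phi> R' w \<in> \<phi> R ` H"
      then obtain v where v: "v \<in> H" "\<phi> R' w = \<phi> R v" by blast
      moreover have "v \<in> intr R" "w \<in> intr R'" using v(1) HR True H'R by blast+
      ultimately have u: "R = R'" "w \<in> H" by auto
      hence "dist w a < \<rho>" "dist w b < \<rho>" using True unfolding H_def H'_def
        by (auto simp: p.half_strip_dist q.half_strip_dist)
      thus False using \<rho>(4)[OF u(1)] dist_triangle2[of a b w] by (simp add: dist_commute)
    qed
    then obtain u where u: "u \<in> closure H" "u \<notin> H" "btw (\<phi> R x) (\<phi> R u) (\<phi> R' w)" "d (\<phi> R x) (\<phi> R u) = md x u"
      by (rule exit_point[OF R(1) Hc HR xH wM[OF w]])
    have uP: "u \<in> polygon (ps R)" using u(1) closure_mono[OF HR] polygon_closure[OF R(1)] by blast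
    hence um: "u \<in> model_plane \<kappa>" using polygon_model R by blast
    have "md x u \<le> d (\<phi> R x) (\<phi> R' w)" using u(3,4) nonneg[of "\<phi> R u" "\<phi> R' w"] unfolding btw_def by linarith
    hence "md x u < 2 * \<mu> / 3" using dxw[OF w] by linarith
    hence "md a u < \<mu>"
      using model_dist_triangle[OF curv_nonpos am xm um] xa3 model_dist_commute[OF curv_nonpos, of x a] by linarith
    hence "dist u a \<noteq> \<rho>" using \<mu>0(2)[OF uP] \<mu> by force
    hence us: "u \<in> open_side R i"
      using p.half_disc_frontier[OF R(2) _ _ wd(1) hx, of u] u by (simp add: H_def)
    have "md a u = \<bar>t - coord R i u\<bar>" unfolding t_def
      using us p.open_side_subset by (intro coord_md[OF R a_s]) blast
    hence "coord R i u \<in> J" using \<open>md a u < \<mu>\<close> by (auto simp: J_def)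
    moreover have "\<phi> R u = Edg e (coord R i u)" using open_side_coord[OF R us] e by simp
    ultimately show ?thesis using u(3) by auto
  qed
  obtain w where w: "w \<in> N" "btw (\<phi> R x) (Edg e t) (\<phi> R' w)"
  proof (rule crossing_by_connectedness[of "\<phi> R x" J t \<mu> e N "\<phi> R'" b1 "coord R' j b1" b2 "coord R' j b2"])
    show "compact N" "connected N" unfolding N_def by (auto intro!: connected_Un)
    show "N \<subseteq> model_plane \<kappa>" using NclH clH'P polygon_model[OF R'(1)] by blast
  qed (use xM \<mu> JM iso wM wd_iso cross coJ b12 side_coord in \<open>auto simp: J_def[symmetric] N_def[symmetric], auto simp: J_def N_def\<close>)
  \<comment> \<open>if \<open>w\<close> were an end of \<open>N\<close>, a geodesic from \<open>x\<close> would run along the edge after it has met it at \<open>a\<close>\<close>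
  have "w \<in> H'"
  proof (rule ccontr)
    assume "w \<notin> H'"
    hence wb: "w \<in> {b1, b2}" using NH w by blast
    define s where "s = coord R' j w"
    have s: "s \<in> J" "s \<noteq> t" "\<phi> R' w = Edg e s" using coJ[OF wb] wb b12 side_coord by (auto simp: s_def)
    obtain a1 where a1: "a1 \<in> open_side R i" "coord R i a1 = s" using coord_surj[OF R, of s] J[OF s(1)] e by auto
    have a1s: "a1 \<in> side (ps R) i" using p.open_side_subset a1 by blast
    have a1P: "a1 \<in> polygon (ps R)" using a1s side_polygon[OF R] by blast
    have wN: "d (Edg e t) (Edg e s) < \<mu> / 3" using dbw[OF w(1)] b_co s by simp
    have maa1: "md a a1 = d (Edg e t) (Edg e s)" using coord_md[OF R a_s a1s] iso[OF tJ s(1)] a1(2) by (simp add: t_def)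
    have "dist a1 a < \<rho>" using \<mu>0(2)[OF a1P] maa1 wN \<mu> by force
    hence cl: "a1 \<in> closure H" using clH p.open_side_height[OF a1(1)] by blast
    have "\<phi> R a1 = Edg e s" using open_side_coord[OF R a1(1)] a1 e by simp
    hence "d (\<phi> R x) (Edg e s) = md x a1"
      using d_closure_convex[OF R(1) Hc(1) HR, of x a1] xH closure_subset cl by auto
    hence "md x a1 = md x a + md a a1" using w(2) dxa maa1 s(3) a_co by (simp add: btw_def)
    hence "a \<in> closed_segment x a1"
      using model_dist_eq_imp_segment[OF curv_nonpos xm am] a1P polygon_model[OF R(1)] by blast
    then obtain u where u: "0 \<le> u" "u \<le> 1" "a = (1 - u) *\<^sub>R x + u *\<^sub>R a1" by (auto simp: in_segment)
    have "(1 - u) * p.height i x = 0"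
      using p.height_affine[of i u x a1] p.open_side_height[OF a] p.open_side_height[OF a1(1)] u(3) by simp
    hence "a = a1" using hx u by simp
    thus False using a1 s by (simp add: t_def)
  qed
  moreover have "open_segment b w \<subseteq> intr R'" using seg(1)[OF hb _ \<open>w \<in> H'\<close>] \<rho> H'R by auto
  ultimately show thesis using that[OF x(1) b(1)] w H'R b_co a_co by auto
qed

end

section \<open>Continuing geodesics until they meet a free face\<close>

context CAT0_complex begin

text \<open>The segment from \<open>b\<close> to \<open>w\<close> is prolonged beyond \<open>w\<close> until it leaves the bounded open set \<open>intr R\<close>.\<close>

lemma shoot:
  assumes R: "R \<in> faces X" and b: "b \<noteq> w" "open_segment b w \<subseteq> intr R" and w: "w \<in> intr R"
  obtains z where "z \<in> polygon (ps R)" "z \<notin> intr R" "w \<in> open_segment b z" "open_segment b z \<subseteq> intr R"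
proof -
  interpret p: plane_polygon "ps R" using face_shape R by blast
  obtain r where r: "0 < r" "w + r *\<^sub>R (w - b) \<in> frontier (intr R)"
    "\<And>e. 0 \<le> e \<Longrightarrow> e < r \<Longrightarrow> w + e *\<^sub>R (w - b) \<in> interior (intr R)"
    using ray_to_frontier[of "intr R" w "w - b"] p.intr_facts w b by (auto simp: interior_open)
  define z where "z = w + r *\<^sub>R (w - b)"
  have zb: "z - b = (1 + r) *\<^sub>R (w - b)" by (simp add: z_def algebra_simps)
  hence zne: "b \<noteq> z" using b r by auto
  have lin: "(1 - s) *\<^sub>R b + s *\<^sub>R z = b + (s * (1 + r)) *\<^sub>R (w - b)" for s
  proof -
    have "(1 - s) *\<^sub>R b + s *\<^sub>R z = b + s *\<^sub>R (z - b)" by (simp add: algebra_simps)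
    thus ?thesis by (simp add: zb)
  qed
  have "w = (1 - 1 / (1 + r)) *\<^sub>R b + (1 / (1 + r)) *\<^sub>R z" unfolding lin using r by simp
  moreover have "0 < 1 / (1 + r)" "1 / (1 + r) < 1" using r by auto
  ultimately have ws: "w \<in> open_segment b z" unfolding in_segment(2) using zne by blast
  have "open_segment b z \<subseteq> intr R"
  proof
    fix v assume "v \<in> open_segment b z"
    then obtain s where s: "0 < s" "s < 1" "v = (1 - s) *\<^sub>R b + s *\<^sub>R z" by (auto simp: in_segment(2))
    define m where "m = s * (1 + r)"
    have v: "v = b + m *\<^sub>R (w - b)" using s lin by (simp add: m_def)
    have m: "0 < m" "m < 1 + r" using s r by (auto simp: m_def)
    show "v \<in> intr R"
    proof (cases "m < 1")
      case True
      have "v = (1 - m) *\<^sub>R b + m *\<^sub>R w" by (simp add: v algebra_simps)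
      hence "v \<in> open_segment b w" unfolding in_segment(2) using True m b by blast
      thus ?thesis using b by blast
    next
      case False
      have "v = w + (m - 1) *\<^sub>R (w - b)" by (simp add: v algebra_simps)
      thus ?thesis using r(3)[of "m - 1"] m False interior_subset by auto
    qed
  qed
  moreover have "z \<in> polygon (ps R)" "z \<notin> intr R"
    using r(2) p.intr_facts by (auto simp: z_def polygon_def)
  ultimately show thesis using that ws by blast
qed

lemma btw_segment:
  assumes R: "R \<in> faces X" and S: "open_segment z a \<subseteq> intr R" and x: "x \<in> open_segment z a"
  shows "btw (\<phi> R z) (\<phi> R x) (\<phi> R a)"
proof -
  have "z \<noteq> a" using x by auto
  hence cl: "closure (open_segment z a) = closed_segment z a" by simp
  have P: "closed_segment z a \<subseteq> polygon (ps R)"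
    using closure_mono[OF S] cl polygon_closure[OF R] by simp
  have in_cl: "z \<in> closed_segment z a" "a \<in> closed_segment z a" "x \<in> closed_segment z a"
    using x by (auto simp: open_segment_def)
  have iso: "d (\<phi> R u) (\<phi> R v) = md u v" if "u \<in> closed_segment z a" "v \<in> closed_segment z a" for u v
    using d_closure_convex[OF R convex_open_segment S] that cl by auto
  have "md z a = md z x + md x a"
    using in_cl P polygon_model[OF R] by (intro model_dist_additive[OF curv_nonpos]) blast+
  thus ?thesis using iso in_cl P polygon_map_M[OF R] by (auto simp: btw_def)
qed

end

text \<open>The cells of a finite-edged subcomplex, and a geodesic direction, given by the points \<open>q\<close> and
  \<open>x0\<close>, in which no geodesic from \<open>q\<close> runs into a vertex.\<close>

locale geodesic_direction = CAT0_complex X P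
  for X :: "('v, 'e, 'f) complex2" and P :: "('e, 'f) shape" +
  fixes F :: "'f set" and E :: "'e set" and q x0 :: "('v, 'e, 'f) point"
  assumes F: "F \<subseteq> faces X" and E: "finite E" "\<And>R. R \<in> F \<Longrightarrow> fst ` set (bdry X R) \<subseteq> E"
    and generic: "\<And>e v. e \<in> E \<Longrightarrow> v \<in> {src X e, tgt X e} \<Longrightarrow> \<not> btw q x0 (Vtx v)"
begin

definition free_in :: "'e \<Rightarrow> 'f \<Rightarrow> bool" where
  "free_in e R \<longleftrightarrow> count_list (map fst (bdry X R)) e = 1 \<and>
     (\<forall>R'\<in>F. R' \<noteq> R \<longrightarrow> e \<notin> fst ` set (bdry X R'))"

text \<open>A geodesic from \<open>q\<close> in the given direction reaches the edge glued to the \<open>i\<close>-th side of \<open>R\<close> along a straight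
  segment of \<open>R\<close>.\<close>

definition arrives :: "'f \<Rightarrow> nat \<Rightarrow> complex \<Rightarrow> bool" where
  "arrives R i a \<longleftrightarrow> R \<in> F \<and> i < length (ps R) \<and> a \<in> open_side R i \<and> btw q x0 (\<phi> R a) \<and>
     (\<exists>z. z \<in> intr R \<and> open_segment z a \<subseteq> intr R \<and> btw q (\<phi> R z) (\<phi> R a))"

definition crossed :: "('v, 'e, 'f) point \<Rightarrow> 'e set" where
  "crossed y = {e \<in> E. \<exists>s. 0 < s \<and> s < len P e \<and> btw q (Edg e s) y}"

lemma edge_E: "R \<in> F \<Longrightarrow> i < length (ps R) \<Longrightarrow> edge R i \<in> E"
  using E(2)[of R] F face_shape(3)[of R] by (auto simp: image_subset_iff)

lemma shoot_arrives:
  assumes R: "R \<in> F" and b: "b \<noteq> w" "open_segment b w \<subseteq> intr R" and w: "w \<in> intr R"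
    and dir: "\<And>z. btw (\<phi> R b) (\<phi> R w) (\<phi> R z) \<Longrightarrow> btw q x0 (\<phi> R z) \<and> btw q (\<phi> R w) (\<phi> R z)"
  obtains i z where "arrives R i z" "btw (\<phi> R b) (\<phi> R w) (\<phi> R z)"
proof -
  have RX: "R \<in> faces X" using R F by blast
  obtain z where z: "z \<in> polygon (ps R)" "z \<notin> intr R" "w \<in> open_segment b z" "open_segment b z \<subseteq> intr R"
    using shoot[OF RX b w] .
  have bt: "btw (\<phi> R b) (\<phi> R w) (\<phi> R z)" using btw_segment[OF RX z(4,3)] .
  have wz: "open_segment w z \<subseteq> intr R"
    using z(3,4) subset_open_segment[of w z b z] by (auto simp: open_segment_def)
  from polygon_cases[OF RX z(1)] show thesis
  proof cases
    case 1 thus ?thesis using z by simp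
  next
    case (2 i)
    thus ?thesis using that[of i z] dir[OF bt] bt w wz R unfolding arrives_def by blast
  next
    case (3 i)
    then obtain j v where jv: "j < length (ps R)" "v \<in> {src X (edge R j), tgt X (edge R j)}" "\<phi> R z = Vtx v"
      using corner_vertex[OF RX] by blast
    thus ?thesis using generic[OF edge_E[OF R jv(1)] jv(2)] dir[OF bt] by simp
  qed
qed

lemma not_free_other_side:
  assumes R: "R \<in> F" "i < length (ps R)" and nf: "\<not> free_in (edge R i) R"
  obtains R' j where "R' \<in> F" "j < length (ps R')" "edge R' j = edge R i" "(R, i) \<noteq> (R', j)"
proof (cases "count_list (map fst (bdry X R)) (edge R i) = 1")
  case True
  then obtain R' where R': "R' \<in> F" "R' \<noteq> R" "edge R i \<in> fst ` set (bdry X R')"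
    using nf by (auto simp: free_in_def)
  then obtain j where "j < length (bdry X R')" "edge R' j = edge R i" by (auto simp: in_set_conv_nth)
  thus thesis using that[of R' j] R' F face_shape(3)[of R'] by auto
next
  case False
  let ?xs = "map fst (bdry X R)"
  have l: "length ?xs = length (ps R)" using R F face_shape(3)[of R] by auto
  have c: "count_list ?xs (edge R i) = card {k. k < length ?xs \<and> ?xs ! k = edge R i}"
    by (simp only: count_list_eq_length_filter length_filter_conv_card eq_commute)
  have "\<exists>j. j < length ?xs \<and> ?xs ! j = edge R i \<and> j \<noteq> i"
  proof (rule ccontr)
    assume "\<not> ?thesis"
    hence "{k. k < length ?xs \<and> ?xs ! k = edge R i} = {i}" using R(2) l by auto
    thus False using c False by simp
  qed
  then obtain j where "j < length ?xs" "?xs ! j = edge R i" "j \<noteq> i" by blast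
  thus thesis using that[of R j] R l by simp
qed

text \<open>Geodesics are unique, and between two points of an edge the geodesic runs along the edge.\<close>

lemma edge_met_once:
  assumes R: "R \<in> faces X" "i < length (ps R)" "e = edge R i"
    and s: "0 < s" "s < len P e" and t: "0 < t" "t < len P e" and bt: "btw (Edg e s) (Fac R' w) (Edg e t)"
  shows False
proof -
  define \<alpha> where "\<alpha> = d (Edg e s) (Fac R' w)"
  have iso: "d (Edg e s) (Edg e u) = \<bar>s - u\<bar>" "d (Edg e u) (Edg e t) = \<bar>u - t\<bar>"
    if "0 < u" "u < len P e" for u using d_edge[OF R] s t that by blast+
  have a: "0 \<le> \<alpha>" "\<alpha> \<le> \<bar>s - t\<bar>"
  proof -
    show "0 \<le> \<alpha>" by (simp add: \<alpha>_def)
    have "\<alpha> + d (Fac R' w) (Edg e t) = \<bar>s - t\<bar>" using bt iso(1)[OF t] by (simp add: btw_def \<alpha>_def)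
    thus "\<alpha> \<le> \<bar>s - t\<bar>" using nonneg[of "Fac R' w" "Edg e t"] by linarith
  qed
  define u where "u = (if s \<le> t then s + \<alpha> else s - \<alpha>)"
  have u: "0 < u" "u < len P e" "\<bar>s - u\<bar> = \<alpha>" "\<bar>s - u\<bar> + \<bar>u - t\<bar> = \<bar>s - t\<bar>"
    using a s t by (auto simp: u_def)
  have uM: "Edg e u \<in> M" using u face_shape(5)[OF R(1,2)] R(3) by (auto simp: metric_realization_def)
  have "btw (Edg e s) (Edg e u) (Edg e t)"
    using uM btw_M[OF bt] iso[OF u(1,2)] iso(1)[OF t] u(4) by (simp add: btw_def)
  hence "btw (Edg e s) (Fac R' w) (Edg e u)"
    using btw_linear[OF bt] iso(1)[OF u(1,2)] u(3) by (simp add: \<alpha>_def)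
  hence "d (Fac R' w) (Edg e u) = 0" using iso(1)[OF u(1,2)] u(3) by (simp add: btw_def \<alpha>_def)
  thus False using zero[of "Fac R' w" "Edg e u"] btw_M[OF bt] uM by simp
qed

lemma crossed_mono: "btw q y y' \<Longrightarrow> crossed y \<subseteq> crossed y'"
  unfolding crossed_def using btw_trans by blast

text \<open>The geodesic is continued across the edge and then straight to the boundary of the next cell. The edge reached
  there has not been met before, by \<open>edge_met_once\<close>.\<close>

lemma continue:
  assumes ar: "arrives R i a" and nf: "\<not> free_in (edge R i) R"
  obtains R' i' a' where "arrives R' i' a'" "crossed (\<phi> R a) \<subset> crossed (\<phi> R' a')"
proof -
  obtain z where R: "R \<in> F" "i < length (ps R)" and a: "a \<in> open_side R i" "btw q x0 (\<phi> R a)"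
    and z: "z \<in> intr R" "open_segment z a \<subseteq> intr R" "btw q (\<phi> R z) (\<phi> R a)"
    using ar unfolding arrives_def by blast
  have RX: "R \<in> faces X" using R F by blast
  obtain R' j where R': "R' \<in> F" "j < length (ps R')" "edge R' j = edge R i" "(R, i) \<noteq> (R', j)"
    using not_free_other_side[OF R nf] .
  have R'X: "R' \<in> faces X" using R' F by blast
  let ?y = "\<phi> R a"
  obtain x b w where x: "x \<in> open_segment z a" and b: "b \<in> open_side R' j" "\<phi> R' b = ?y"
    and w: "w \<in> intr R'" "open_segment b w \<subseteq> intr R'" "btw (\<phi> R x) ?y (\<phi> R' w)"
    using crossing[OF RX R(2) R'X R'(2,4) HOL.refl R'(3) a(1) z(1,2)] .
  have xi: "x \<in> intr R" using x z by blast
  have y: "?y = Edg (edge R i) (coord R i a)" using open_side_coord[OF RX R(2) a(1)] by blast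
  have "btw ?y (\<phi> R x) (\<phi> R z)" using btw_sym[OF btw_segment[OF RX z(2) x]] .
  hence qx: "btw q (\<phi> R x) ?y" using btw_sym[OF btw_trans[OF _ btw_sym[OF z(3)]]] by blast
  have ext: "btw q ?y (\<phi> R' c)" if "btw (\<phi> R' b) (\<phi> R' w) (\<phi> R' c)" for c
    using btw_extend[OF qx _ _ _ w(3)] that xi w(1) y b(2) by auto
  have "b \<noteq> w" using b y w by force
  then obtain i' a' where a': "arrives R' i' a'" "btw (\<phi> R' b) (\<phi> R' w) (\<phi> R' a')"
  proof (rule shoot_arrives[OF R'(1) _ w(2,1)])
    fix c assume c: "btw (\<phi> R' b) (\<phi> R' w) (\<phi> R' c)"
    show "btw q x0 (\<phi> R' c) \<and> btw q (\<phi> R' w) (\<phi> R' c)"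
      using btw_trans[OF a(2) ext[OF c]] btw_sym[OF btw_trans[OF btw_sym[OF c] btw_sym[OF ext[OF c, folded b(2)]]]]
      by blast
  qed
  have qy: "btw q ?y (\<phi> R' a')" using ext a' by blast
  let ?e = "edge R' i'"
  have i': "i' < length (ps R')" "a' \<in> open_side R' i'" using a'(1) by (auto simp: arrives_def)
  note y' = open_side_coord[OF R'X i']
  have "?e \<in> crossed (\<phi> R' a')"
    unfolding crossed_def using edge_E[OF R'(1) i'(1)] y' btw_right[OF btw_M(1,3)[OF qy]] by auto
  moreover have "?e \<notin> crossed ?y"
  proof
    assume "?e \<in> crossed ?y"
    then obtain s where s: "0 < s" "s < len P ?e" "btw q (Edg ?e s) ?y" by (auto simp: crossed_def)
    have "btw (Edg ?e s) ?y (\<phi> R' a')" using btw_inner[OF s(3) qy] .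
    hence "btw (Edg ?e s) (\<phi> R' w) (\<phi> R' a')"
      using btw_sym[OF btw_trans[OF btw_sym[OF a'(2)[unfolded b(2)]] btw_sym]] by blast
    thus False using edge_met_once[OF R'X i'(1) HOL.refl s(1,2) y'(2,3)] y'(1) w(1) by simp
  qed
  ultimately have "crossed ?y \<subset> crossed (\<phi> R' a')" using crossed_mono[OF qy] by blast
  thus thesis using that a'(1) by blast
qed

text \<open>The number of edges not yet crossed decreases.\<close>

lemma free_face_reached:
  assumes "arrives R i a"
  shows "\<exists>R i a. arrives R i a \<and> free_in (edge R i) R"
  using assms
proof (induction "card (E - crossed (\<phi> R a))" arbitrary: R i a rule: less_induct)
  case less
  show ?case
  proof (cases "free_in (edge R i) R")
    case False
    then obtain R' i' a' where a': "arrives R' i' a'" "crossed (\<phi> R a) \<subset> crossed (\<phi> R' a')"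
      using continue[OF less.prems] by blast
    have "crossed (\<phi> R' a') \<subseteq> E" by (auto simp: crossed_def)
    hence "E - crossed (\<phi> R' a') \<subset> E - crossed (\<phi> R a)" using a'(2) by blast
    hence "card (E - crossed (\<phi> R' a')) < card (E - crossed (\<phi> R a))" using E(1) by (intro psubset_card_mono) auto
    thus ?thesis using less.hyps a'(1) by blast
  qed (use less.prems in blast)
qed

lemma geodesic_to_free_face:
  assumes C: "C \<in> F" and z: "z0 \<noteq> z1" "closed_segment z0 z1 \<subseteq> intr C" and q: "q = \<phi> C z0" "x0 = \<phi> C z1"
  obtains R e t where "R \<in> F" "e \<in> E" "free_in e R" "0 < t" "t < len P e"
    "Edg e t \<in> closed_cell X P R" "btw q x0 (Edg e t)"
proof -
  have "open_segment z0 z1 \<subseteq> intr C" "z1 \<in> intr C" using z by (auto simp: open_segment_def)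
  then obtain i a where "arrives C i a"
    using shoot_arrives[OF C z(1)] q by metis
  then obtain R i a where R: "arrives R i a" "free_in (edge R i) R" using free_face_reached by blast
  hence RF: "R \<in> F" "i < length (ps R)" "a \<in> open_side R i" "btw q x0 (\<phi> R a)" by (auto simp: arrives_def)
  have RX: "R \<in> faces X" using RF F by blast
  interpret p: plane_polygon "ps R" using face_shape RX by blast
  note y = open_side_coord[OF RX RF(2,3)]
  have "a \<in> polygon (ps R)" using p.open_side_subset RF side_polygon[OF RX] by blast
  hence "Edg (edge R i) (coord R i a) \<in> closed_cell X P R" unfolding closed_cell_def y(1)[symmetric] by blast
  thus thesis using that[OF RF(1) edge_E[OF RF(1,2)] R(2) y(2,3)] RF(4) y(1) by simp
qed

end

section \<open>The directions at an interior point\<close>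

context CAT0_complex begin

lemma Fac_closed_cell: "R \<in> faces X \<Longrightarrow> Fac R' w \<in> closed_cell X P R \<Longrightarrow> R' = R"
proof -
  assume R: "R \<in> faces X" and "Fac R' w \<in> closed_cell X P R"
  then obtain z where z: "z \<in> polygon (ps R)" "Fac R' w = \<phi> R z" by (auto simp: closed_cell_def)
  from polygon_cases[OF R z(1)] show ?thesis
  proof cases
    case (2 i) thus ?thesis using open_side_coord(1)[OF R 2] z by simp
  next
    case (3 i)
    then obtain v where "\<phi> R z = Vtx v" using corner_vertex[OF R] by metis
    thus ?thesis using z by simp
  qed (use z in simp)
qed

text \<open>The directions at an interior point of \<open>C\<close>, parametrized by the unit circle \<open>S\<close>, would fall into two
  disjoint open parts: those near directions leading to \<open>A\<close> and those near directions leading to \<open>B\<close>.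
  Directions of geodesics to vertices and their opposites are
  discarded, so that for a good direction the opposite one is good too.\<close>

lemma two_free_cells_impossible:
  assumes convex: "\<And>R. R \<in> faces X \<Longrightarrow> convex_cell X P R"
    and F: "F \<subseteq> faces X" and E: "finite E" "E \<subseteq> edges X" "\<And>R. R \<in> F \<Longrightarrow> fst ` set (bdry X R) \<subseteq> E"
    and C: "C \<in> F"
    and free: "\<And>R e. R \<in> F \<Longrightarrow> e \<in> E \<Longrightarrow> count_list (map fst (bdry X R)) e = 1 \<Longrightarrow>
      (\<forall>R'\<in>F. R' \<noteq> R \<longrightarrow> e \<notin> fst ` set (bdry X R')) \<Longrightarrow> R \<noteq> C \<and> (R = A \<or> R = B)"
  shows False
proof -
  have CX: "C \<in> faces X" using C F by blast
  interpret p: plane_polygon "ps C" using face_shape CX by blast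
  obtain z0 where z0: "z0 \<in> intr C" using p.intr_facts by blast
  obtain \<epsilon> where \<epsilon>: "0 < \<epsilon>" "cball z0 \<epsilon> \<subseteq> intr C" using p.intr_facts(1) z0 open_contains_cball by blast
  define q where "q = \<phi> C z0"
  define \<zeta> where "\<zeta> u = z0 + \<epsilon> *\<^sub>R u" for u :: complex
  define \<xi> where "\<xi> u = \<phi> C (\<zeta> u)" for u
  define S where "S = sphere (0::complex) 1"
  have \<zeta>ball: "\<zeta> u \<in> cball z0 \<epsilon>" if "u \<in> S" for u using that \<epsilon> by (simp add: \<zeta>_def S_def dist_norm)
  have \<zeta>i: "\<zeta> u \<in> intr C" if "u \<in> S" for u using \<zeta>ball[OF that] \<epsilon> by blast
  have \<zeta>ne: "\<zeta> u \<noteq> z0" if "u \<in> S" for u using that \<epsilon> by (auto simp: \<zeta>_def S_def)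
  have zm: "z0 \<in> model_plane \<kappa>" "\<And>u. u \<in> S \<Longrightarrow> \<zeta> u \<in> model_plane \<kappa>"
    using \<zeta>i z0 intr_model[OF CX] by blast+
  have qM: "q \<in> M" using z0 intr_polygon unfolding q_def by (intro polygon_map_M CX) blast
  have \<xi>M: "\<xi> u \<in> M" if "u \<in> S" for u
    using \<zeta>i[OF that] intr_polygon unfolding \<xi>_def by (intro polygon_map_M CX) blast
  have iso: "d (\<phi> C z) (\<phi> C w) = md z w" if "z \<in> cball z0 \<epsilon>" "w \<in> cball z0 \<epsilon>" for z w
    using closed_segment_subset[OF that convex_cball] \<epsilon> by (intro d_segment_intr CX) blast
  have z0b: "z0 \<in> cball z0 \<epsilon>" using \<epsilon> by simp
  have d\<xi>: "d q (\<xi> u) = md z0 (\<zeta> u)" if "u \<in> S" for u unfolding q_def \<xi>_def by (rule iso[OF z0b \<zeta>ball[OF that]])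
  have d\<xi>\<xi>: "d (\<xi> u) (\<xi> v) = md (\<zeta> u) (\<zeta> v)" if "u \<in> S" "v \<in> S" for u v
    unfolding \<xi>_def using that by (intro iso \<zeta>ball)
  have S_minus: "- u \<in> S" if "u \<in> S" for u using that by (simp add: S_def)
  have cont\<zeta>: "continuous_on T \<zeta>" for T unfolding \<zeta>_def by (intro continuous_intros)

  \<comment> \<open>all but finitely many directions avoid the vertices\<close>
  define bad where "bad = {u \<in> S. \<exists>e\<in>E. \<exists>v\<in>{src X e, tgt X e}. btw q (\<xi> u) (Vtx v)}"
  have unique: "u = u'" if "u \<in> S" "u' \<in> S" "btw q (\<xi> u) y" "btw q (\<xi> u') y" "d q (\<xi> u) \<le> d q (\<xi> u')" for u u' y
  proof -
    \<comment> \<open>on one geodesic the nearer point \<open>\<zeta> u\<close> lies on the segment from \<open>z0\<close> to \<open>\<zeta> u'\<close>\<close>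
    have "btw q (\<xi> u) (\<xi> u')" using btw_linear that by blast
    hence "md z0 (\<zeta> u') = md z0 (\<zeta> u) + md (\<zeta> u) (\<zeta> u')" using d\<xi> d\<xi>\<xi> that by (simp add: btw_def)
    hence "\<zeta> u \<in> closed_segment z0 (\<zeta> u')"
      using model_dist_eq_imp_segment[OF curv_nonpos zm(1)] zm that by blast
    then obtain s where s: "0 \<le> s" "s \<le> 1" "\<zeta> u = (1 - s) *\<^sub>R z0 + s *\<^sub>R \<zeta> u'" by (auto simp: in_segment)
    have "\<epsilon> *\<^sub>R u = \<epsilon> *\<^sub>R (s *\<^sub>R u')" using s(3) by (simp add: \<zeta>_def algebra_simps)
    hence us: "u = s *\<^sub>R u'" using scaleR_cancel_left[of \<epsilon> u "s *\<^sub>R u'"] \<epsilon>(1) by blast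
    hence "s = 1" using that s by (simp add: S_def)
    thus ?thesis using us by simp
  qed
  have "finite bad"
  proof -
    have fin: "finite {u \<in> S. btw q (\<xi> u) y}" for y
    proof (cases "{u \<in> S. btw q (\<xi> u) y} = {}")
      case False
      then obtain u where u: "u \<in> S" "btw q (\<xi> u) y" by blast
      hence "{u \<in> S. btw q (\<xi> u) y} \<subseteq> {u}" using unique by (smt (verit) mem_Collect_eq singletonI subsetI)
      thus ?thesis using finite_subset by blast
    qed (simp only: finite.emptyI)
    have "bad \<subseteq> (\<Union>e\<in>E. \<Union>v\<in>{src X e, tgt X e}. {u \<in> S. btw q (\<xi> u) (Vtx v)})" by (auto simp: bad_def)
    moreover have "finite (\<Union>e\<in>E. \<Union>v\<in>{src X e, tgt X e}. {u \<in> S. btw q (\<xi> u) (Vtx v)})"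
      using E fin by (intro finite_UN_I) auto
    ultimately show ?thesis by (rule finite_subset)
  qed
  define good where "good = S - bad - uminus ` bad"
  have good: "u \<in> S" "u \<notin> bad" "- u \<in> good" if "u \<in> good" for u
    using that S_minus[of u] by (auto simp: good_def image_iff)
  have dense: "\<exists>u'\<in>good. dist u u' < e" if "u \<in> S" "0 < e" for u e
  proof -
    have "infinite (S \<inter> ball u e)"
    proof -
      have "S \<noteq> {x}" for x
      proof
        assume "S = {x}"
        moreover have "1 \<in> S" "- 1 \<in> S" by (simp_all add: S_def)
        ultimately have "(1::complex) = - 1" by (metis singletonD)
        thus False by simp
      qed
      moreover have "connected S" unfolding S_def by (intro connected_sphere) simp
      ultimately have "u islimpt S" using connected_imp_perfect that(1) by blast
      thus ?thesis using that(2) islimpt_eq_infinite_ball by blast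
    qed
    moreover have "finite (bad \<union> uminus ` bad)" using \<open>finite bad\<close> by simp
    ultimately have "infinite (S \<inter> ball u e - (bad \<union> uminus ` bad))" by (rule Diff_infinite_finite[rotated])
    then obtain u' where "u' \<in> S \<inter> ball u e - (bad \<union> uminus ` bad)" by (metis ex_in_conv finite.emptyI)
    thus ?thesis by (auto simp: good_def)
  qed

  \<comment> \<open>the distance is bounded so that the error in \<open>almost_straight\<close> is uniform\<close>
  define D where "D = (\<Sum>e\<in>E. d q (Edg e (len P e / 2)) + len P e)"
  have D_summand: "0 \<le> d q (Edg e (len P e / 2)) + len P e" if "e \<in> E" for e
    using len_pos[of e] E(2) that nonneg[of q "Edg e (len P e / 2)"] by (smt (verit) subsetD)
  have D: "d q (Edg e t) \<le> D" if "e \<in> E" "0 < t" "t < len P e" for e t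
  proof -
    have eX: "e \<in> edges X" using E that by blast
    have l: "0 < len P e / 2" "len P e / 2 < len P e" using len_pos[OF eX] by auto
    have Ms: "Edg e (len P e / 2) \<in> M" "Edg e t \<in> M" using eX l that by (simp_all add: Edg_M)
    have "d (Edg e (len P e / 2)) (Edg e t) \<le> len P e"
      using d_le_edge[OF eX l that(2,3)] that l by linarith
    hence "d q (Edg e t) \<le> d q (Edg e (len P e / 2)) + len P e" using triangle[OF qM Ms] by linarith
    also have "\<dots> \<le> D" unfolding D_def
      using E that D_summand by (intro member_le_sum[of e E]) auto
    finally show ?thesis .
  qed
  have D0: "0 \<le> D" unfolding D_def by (intro sum_nonneg D_summand)
  define hits where "hits R u \<longleftrightarrow> R \<in> F \<and> R \<noteq> C \<and> (\<exists>y\<in>closed_cell X P R. btw q (\<xi> u) y \<and> d q y \<le> D)" for R u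
  have hit: "hits A u \<or> hits B u" if u: "u \<in> good" for u
  proof -
    interpret g: geodesic_direction X P F E q "\<xi> u"
      using F E good(1,2)[OF u] by unfold_locales (auto simp: bad_def)
    have "closed_segment z0 (\<zeta> u) \<subseteq> intr C"
      using closed_segment_subset[OF z0b \<zeta>ball[OF good(1)[OF u]] convex_cball] \<epsilon> by blast
    then obtain R e t where R: "R \<in> F" "e \<in> E" "g.free_in e R" "0 < t" "t < len P e"
      "Edg e t \<in> closed_cell X P R" "btw q (\<xi> u) (Edg e t)"
      using g.geodesic_to_free_face[OF C \<zeta>ne[OF good(1)[OF u], symmetric] _ q_def \<xi>_def] by blast
    hence "R \<noteq> C \<and> (R = A \<or> R = B)" using free[OF R(1,2)] by (simp add: g.free_in_def)
    moreover from this have "hits R u" unfolding hits_def using R D[OF R(2,4,5)] by blast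
    ultimately show ?thesis by blast
  qed

  \<comment> \<open>a convex cell is not met in two almost opposite directions\<close>
  obtain r where r: "0 < r" "\<And>z p. z \<in> {z0} \<Longrightarrow> p \<in> M \<Longrightarrow> d (\<phi> C z) p < r \<Longrightarrow>
      \<exists>w\<in>intr C. p = Fac C w \<and> md z w \<le> d (\<phi> C z) p"
    by (rule uniform_neighbourhood[OF CX _ _ p.intr_facts(1), of "{z0}"]) (use z0 in auto)
  have S_ne: "S \<noteq> {}" and S_cpt: "compact S" by (auto simp: S_def)
  have "continuous_on S (\<lambda>u. md z0 (\<zeta> u))"
    by (rule continuous_on_model_dist_comp[OF curv_nonpos continuous_on_const cont\<zeta>]) (use zm in auto)
  from continuous_attains_inf[OF S_cpt S_ne this] obtain u0 where
    u0: "u0 \<in> S" "\<And>u. u \<in> S \<Longrightarrow> md z0 (\<zeta> u0) \<le> md z0 (\<zeta> u)" by blast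
  define s where "s = md z0 (\<zeta> u0)"
  have s: "0 < s" unfolding s_def using u0 zm \<zeta>ne by (intro model_dist_pos[OF curv_nonpos]) (auto dest: sym)
  \<comment> \<open>chosen such that \<open>D * sqrt (4 * \<eta> / s) = D * r / (D + 1) < r\<close>\<close>
  define \<eta> where "\<eta> = s * (r / (2 * (D + 1)))\<^sup>2"
  have \<eta>: "0 < \<eta>" using s r D0 by (simp add: \<eta>_def)
  \<comment> \<open>the excess in the triangle inequality; it vanishes for opposite directions\<close>
  define f where "f = (\<lambda>(u, v). md z0 (\<zeta> u) + md z0 (\<zeta> v) - md (\<zeta> u) (\<zeta> v))"
  have "continuous_on (S \<times> S) f" unfolding f_def case_prod_beta
    by (intro continuous_intros continuous_on_model_dist_comp[OF curv_nonpos]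
          continuous_on_compose2[OF cont\<zeta>[of UNIV]]) (use zm in auto)
  hence "uniformly_continuous_on (S \<times> S) f" by (intro compact_uniformly_continuous compact_Times S_cpt)
  then obtain \<delta> where \<delta>: "0 < \<delta>" "\<And>a b. a \<in> S \<times> S \<Longrightarrow> b \<in> S \<times> S \<Longrightarrow> dist b a < \<delta> \<Longrightarrow> dist (f b) (f a) < \<eta>"
    unfolding uniformly_continuous_on_def using \<eta> by metis
  have f0: "f (u, - u) = 0" if "u \<in> S" for u
  proof -
    have "z0 = (1 - 1/2) *\<^sub>R \<zeta> u + (1/2) *\<^sub>R \<zeta> (- u)" by (simp add: \<zeta>_def algebra_simps flip: scaleR_left_distrib)
    hence "z0 \<in> closed_segment (\<zeta> u) (\<zeta> (- u))" unfolding in_segment by (intro exI[of _ "1/2"]) simp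
    thus ?thesis using model_dist_additive[OF curv_nonpos zm(2)[OF that] zm(2)[OF S_minus[OF that]]]
        model_dist_commute[OF curv_nonpos, of "\<zeta> u" z0] by (simp add: f_def)
  qed
  have opposite: False if h: "hits R u" "hits R v" and uv: "u \<in> S" "v \<in> S" "dist v (- u) < \<delta>" for R u v
  proof -
    obtain y y' where y: "y \<in> closed_cell X P R" "btw q (\<xi> u) y" "d q y \<le> D"
      "y' \<in> closed_cell X P R" "btw q (\<xi> v) y'" "d q y' \<le> D" and RF: "R \<in> F" "R \<noteq> C"
      using h unfolding hits_def by blast
    have RX: "R \<in> faces X" using RF F by blast
    let ?s = "d q (\<xi> u)" and ?t = "d q (\<xi> v)"
    have st: "s \<le> ?s" "s \<le> ?t" using u0(2) uv d\<xi> by (auto simp: s_def)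
    have ne: "\<xi> u \<noteq> q" "\<xi> v \<noteq> q" using st s zero[OF qM qM] by auto
    have "dist (f (u, v)) (f (u, - u)) < \<eta>"
      using uv S_minus by (intro \<delta>(2)) (auto simp: dist_Pair_Pair)
    hence "?s + ?t - \<eta> \<le> d (\<xi> u) (\<xi> v)"
      using f0[OF uv(1)] d\<xi> d\<xi>\<xi> uv by (simp add: f_def dist_real_def)
    then obtain p where p: "btw y p y'" "d q p \<le> D * sqrt (2 * \<eta> * (?s + ?t) / (?s * ?t))"
      using almost_straight[OF y(2) ne(1) y(5) ne(2) _ y(3,6)] by blast
    have "2 * \<eta> * (?s + ?t) / (?s * ?t) \<le> 4 * \<eta> / s"
    proof -
      have sp: "0 < ?s" "0 < ?t" using st s by linarith+
      have "(?s + ?t) / (?s * ?t) = 1 / ?s + 1 / ?t" using sp by (simp add: field_simps)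
      also have "\<dots> \<le> 1 / s + 1 / s" using st s by (intro add_mono divide_left_mono) auto
      finally have "2 * \<eta> * ((?s + ?t) / (?s * ?t)) \<le> 2 * \<eta> * (2 / s)" using \<eta> by (intro mult_left_mono) auto
      thus ?thesis by simp
    qed
    also have "4 * \<eta> / s = (r / (D + 1))\<^sup>2" 
    proof -
      have "r / (2 * (D + 1)) = (1 / 2) * (r / (D + 1))" by (simp only: times_divide_times_eq mult_1)
      thus ?thesis using s unfolding \<eta>_def by (simp only: power_mult_distrib) (simp add: power2_eq_square)
    qed
    finally have "sqrt (2 * \<eta> * (?s + ?t) / (?s * ?t)) \<le> r / (D + 1)"
      using r D0 by (intro real_le_lsqrt) auto
    hence "d q p \<le> D * (r / (D + 1))" using p(2) D0 by (meson mult_left_mono order_trans)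
    also have "\<dots> < r" using r D0 by (simp add: field_simps)
    finally obtain w where "p = Fac C w" using r(2)[of z0 p] btw_M[OF p(1)] by (auto simp: q_def)
    moreover have "p \<in> closed_cell X P R"
      using convex_btw[OF _ y(1,4) p(1)] convex[OF RX] by (simp add: convex_cell_def)
    ultimately show False using Fac_closed_cell[OF RX] RF(2) by blast
  qed

  \<comment> \<open>hence the circle of directions splits into two open parts\<close>
  define V where "V R = (\<Union>u \<in> {u \<in> good. hits R u}. ball u (\<delta> / 2))" for R
  have "open (V A)" "open (V B)" by (auto simp: V_def)
  moreover have "S \<subseteq> V A \<union> V B"
  proof
    fix u assume "u \<in> S"
    then obtain u' where "u' \<in> good" "dist u u' < \<delta> / 2" using dense \<delta>(1) by (meson half_gt_zero)
    thus "u \<in> V A \<union> V B" using hit[of u'] by (auto simp: V_def dist_commute)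
  qed
  moreover have flip: "hits B (- u)" if "u \<in> good" "hits A u" for u
    using hit[OF good(3)[OF that(1)]] opposite[OF that(2), of "- u"] good(1)[OF that(1)] S_minus \<delta>(1) by auto
  moreover have flip': "hits A (- u)" if "u \<in> good" "hits B u" for u
    using hit[OF good(3)[OF that(1)]] opposite[OF that(2), of "- u"] good(1)[OF that(1)] S_minus \<delta>(1) by auto
  moreover have "V A \<inter> V B \<inter> S = {}"
  proof (rule ccontr)
    assume "V A \<inter> V B \<inter> S \<noteq> {}"
    then obtain u v w where uv: "u \<in> good" "hits A u" "v \<in> good" "hits B v" "dist u w < \<delta> / 2" "dist v w < \<delta> / 2"
      by (auto simp: V_def)
    have "dist (- v) (- u) < \<delta>" using dist_triangle2[of v u w] uv by (simp add: dist_minus)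
    thus False using opposite[OF uv(2) flip'[OF uv(3,4)]] good(1) uv S_minus by blast
  qed
  moreover have in_V: "V R \<inter> S \<noteq> {}" if "u \<in> good" "hits R u" for R u
  proof -
    have "u \<in> V R" unfolding V_def using that \<delta>(1) by (intro UN_I[of u]) auto
    thus ?thesis using good(1)[OF that(1)] by blast
  qed
  moreover have "V A \<inter> S \<noteq> {}" "V B \<inter> S \<noteq> {}"
  proof -
    obtain u where u: "u \<in> good" using dense[of 1 1] by (auto simp: S_def)
    show "V A \<inter> S \<noteq> {}" "V B \<inter> S \<noteq> {}"
      using hit[OF u] in_V[OF u] in_V[OF good(3)[OF u]] flip[OF u] flip'[OF u] by blast+
  qed
  ultimately have "\<not> connected S" unfolding connected_def by blast
  moreover have "connected S" unfolding S_def by (intro connected_sphere) simp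
  ultimately show False by simp
qed

end

section \<open>Compact subcomplexes have finitely many edges\<close>

lemma oriented_edge_map_realization:
  assumes Z: "is_complex2 Z" and "e \<in> edges Z" "0 \<le> t" "t \<le> 1"
  shows "oriented_edge_map Z (\<lambda>_. 1) (e, b) t \<in> realization Z"
  using assms by (auto simp: edge_map_def realization_def is_complex2_def)

lemma oriented_edge_map_midpoint:
  "oriented_edge_map Z (\<lambda>_. 1) (e, b) t = Edg e' (1/2) \<Longrightarrow> t = 1/2"
  by (auto simp: edge_map_def split: if_splits)

lemma Edg_realization: "Edg e t \<in> realization Y \<longleftrightarrow> e \<in> edges Y \<and> 0 < t \<and> t < 1"
  by (auto simp: realization_def)

text \<open>The midpoints of any set of edges form a closed set: in every disc they have finitely many preimages, at most one on
  each arc of the boundary circle.\<close>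

lemma weakly_open_remove_midpoints:
  assumes Z: "is_complex2 Z"
  shows "weakly_open Z (realization Z - {Edg e (1/2) | e. e \<in> S})"
  unfolding weakly_open_def
proof (intro conjI ballI)
  let ?U = "realization Z - {Edg e (1/2) | e. e \<in> S}"
  show "?U \<subseteq> realization Z" by blast
  fix e assume e: "e \<in> edges Z"
  have "{0..1} \<inter> edge_map Z (\<lambda>_. 1) e -` ?U = {0..1} \<inter> - (if e \<in> S then {1/2} else {})"
  proof -
    have "edge_map Z (\<lambda>_. 1) e t \<in> realization Z" if "t \<in> {0..1}" for t
      using oriented_edge_map_realization[OF Z e, of t True] that by simp
    moreover have "edge_map Z (\<lambda>_. 1) e t \<in> {Edg e (1/2) | e. e \<in> S} \<longleftrightarrow> t = 1/2 \<and> e \<in> S" for t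
      by (auto simp: edge_map_def)
    ultimately have "t \<in> {0..1} \<inter> edge_map Z (\<lambda>_. 1) e -` ?U \<longleftrightarrow> t \<in> {0..1} \<inter> - (if e \<in> S then {1/2} else {})" for t
      unfolding Int_iff vimage_eq Diff_iff by auto
    thus ?thesis by blast
  qed
  thus "openin (top_of_set {0..1}) ({0..1} \<inter> edge_map Z (\<lambda>_. 1) e -` ?U)"
    by (simp only:) (intro openin_open_Int open_Compl, simp)
next
  let ?U = "realization Z - {Edg e (1/2) | e. e \<in> S}"
  fix R assume R: "R \<in> faces Z"
  let ?n = "length (bdry Z R)"
  have cp: "bdry Z R \<noteq> []" "fst ` set (bdry Z R) \<subseteq> edges Z"
    using Z R by (auto simp: is_complex2_def closed_path_def)
  define s where "s z = real ?n * Arg2pi z / (2 * pi)" for z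
  have s: "0 \<le> s z" "s z < real ?n" for z
  proof -
    have "Arg2pi z < 2 * pi" "0 \<le> Arg2pi z" using Arg2pi by auto
    thus "0 \<le> s z" "s z < real ?n" using cp by (auto simp: s_def field_simps)
  qed
  have idx: "nat \<lfloor>s z\<rfloor> < ?n" for z using s[of z] by linarith
  have dm: "disc_map Z R z = oriented_edge_map Z (\<lambda>_. 1) (bdry Z R ! nat \<lfloor>s z\<rfloor>) (frac (s z))"
    if "norm z = 1" for z using that by (simp add: disc_map_def s_def Let_def)
  have real: "disc_map Z R z \<in> realization Z" if "z \<in> cball 0 1" for z
  proof (cases "norm z < 1")
    case True thus ?thesis using R by (simp add: disc_map_def realization_def)
  next
    case False
    hence n1: "norm z = 1" using that by simp
    obtain e b where eb: "bdry Z R ! nat \<lfloor>s z\<rfloor> = (e, b)" by fastforce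
    hence "e \<in> edges Z" using cp(2) nth_mem[OF idx[of z]] by force
    thus ?thesis unfolding dm[OF n1] eb
      using oriented_edge_map_realization[OF Z] frac_ge_0[of "s z"] frac_lt_1[of "s z"] by (simp add: less_imp_le)
  qed
  define W where "W = {z. norm z = 1 \<and> disc_map Z R z \<in> {Edg e (1/2) | e. e \<in> S}}"
  have "W \<subseteq> (\<lambda>i. cis (2 * pi * (real i + 1/2) / real ?n)) ` {..<?n}"
  proof
    fix z assume "z \<in> W"
    then obtain e where n1: "norm z = 1" and de: "disc_map Z R z = Edg e (1/2)" by (auto simp: W_def)
    have "frac (s z) = 1/2"
      using de dm[OF n1] oriented_edge_map_midpoint[of Z "fst (bdry Z R ! nat \<lfloor>s z\<rfloor>)" "snd (bdry Z R ! nat \<lfloor>s z\<rfloor>)" "frac (s z)" e] by simp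
    hence "s z = real (nat \<lfloor>s z\<rfloor>) + 1/2" using s(1)[of z] by (simp add: frac_def)
    hence "Arg2pi z = 2 * pi * (real (nat \<lfloor>s z\<rfloor>) + 1/2) / real ?n"
      using cp unfolding s_def by (simp add: field_simps)
    moreover have "z = cis (Arg2pi z)" using Arg2pi_eq[of z] n1 by (simp add: cis_conv_exp mult.commute)
    ultimately have "z = cis (2 * pi * (real (nat \<lfloor>s z\<rfloor>) + 1/2) / real ?n)" by simp
    thus "z \<in> (\<lambda>i. cis (2 * pi * (real i + 1/2) / real ?n)) ` {..<?n}"
      using idx[of z] by (intro image_eqI[of _ _ "nat \<lfloor>s z\<rfloor>"]) auto
  qed
  hence "finite W" by (rule finite_subset) simp
  hence "openin (top_of_set (cball 0 1)) (cball 0 1 \<inter> - W)"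
    by (intro openin_open_Int open_Compl finite_imp_closed)
  moreover have "cball 0 1 \<inter> disc_map Z R -` ?U = cball 0 1 \<inter> - W"
  proof -
    have "z \<in> W \<longleftrightarrow> disc_map Z R z \<in> {Edg e (1/2) | e. e \<in> S}" if "z \<in> cball 0 1" for z
    proof (cases "norm z < 1")
      case True thus ?thesis by (auto simp: W_def disc_map_def)
    next
      case False thus ?thesis using that by (auto simp: W_def)
    qed
    thus ?thesis using real by blast
  qed
  ultimately show "openin (top_of_set (cball 0 1)) (cball 0 1 \<inter> disc_map Z R -` ?U)" by simp
qed

text \<open>The sets \<open>U f\<close>, each containing the midpoint of a single edge \<open>f\<close>, form an open cover without smaller
  subcover.\<close>

lemma compact_subcomplex_finite_edges:
  assumes Z: "is_complex2 Z" and Y: "compact_subcomplex Y Z"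
  shows "finite (edges Y)"
proof (cases "edges Y = {}")
  case False
  define U where "U f = realization Z - {Edg e (1/2) | e. e \<in> edges Z - {f}}" for f
  have sub: "subcomplex Y Z" and cpt: "compactin (weak_topology Z) (realization Y)"
    using Y by (auto simp: compact_subcomplex_def)
  have YZ: "realization Y \<subseteq> realization Z" using sub by (auto simp: subcomplex_def realization_def)
  have op: "openin (weak_topology Z) (U f)" for f
    unfolding openin_weak_topology U_def by (rule weakly_open_remove_midpoints[OF Z])
  have "realization Y \<subseteq> \<Union> (U ` edges Y)"
  proof
    fix p assume p: "p \<in> realization Y"
    show "p \<in> \<Union> (U ` edges Y)"
    proof (cases "\<exists>e \<in> edges Z. p = Edg e (1/2)")
      case True
      then obtain e where e: "p = Edg e (1/2)" by blast
      hence "e \<in> edges Y" using p by (simp add: Edg_realization)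
      thus ?thesis using e p YZ by (auto simp: U_def)
    next
      case no: False
      thus ?thesis using False p YZ by (auto simp: U_def)
    qed
  qed
  then obtain \<F> where "finite \<F>" "\<F> \<subseteq> U ` edges Y" "realization Y \<subseteq> \<Union> \<F>"
    using cpt op unfolding compactin_def by (metis (no_types, lifting) imageE)
  then obtain G where G: "G \<subseteq> edges Y" "finite G" "realization Y \<subseteq> \<Union> (U ` G)"
    by (metis finite_subset_image)
  have "edges Y \<subseteq> G"
  proof
    fix e assume e: "e \<in> edges Y"
    hence "Edg e (1/2) \<in> realization Y" by (simp add: Edg_realization)
    then obtain f where f: "f \<in> G" "Edg e (1/2) \<in> U f" using G(3) by blast
    have "e \<in> edges Z" using e sub by (auto simp: subcomplex_def)
    hence "e = f" using f(2) by (auto simp: U_def)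
    thus "e \<in> G" using f by simp
  qed
  thus ?thesis using G finite_subset by blast
qed simp

section \<open>Duplicate 2-cells\<close>

lemma rotate_back: obtains m where "rotate m (rotate k p) = p"
proof -
  have "rotate (length p - k mod length p) (rotate k p) = rotate (length p - k mod length p + k mod length p) p"
    by (metis rotate_conv_mod rotate_rotate)
  also have "\<dots> = p"
    by (cases "p = []") (simp_all add: mod_less_divisor less_imp_le)
  finally show thesis using that by blast
qed

lemma inverse_path_inverse: "inverse_path (inverse_path p) = p"
  by (simp add: inverse_path_def rev_map comp_def case_prod_beta)

lemma inverse_path_rotate: obtains m where "inverse_path (rotate k p) = rotate m (inverse_path p)"
proof -
  let ?q = "map (\<lambda>(e, b). (e, \<not> b)) p"
  obtain m where m: "rotate m (rotate k ?q) = ?q" using rotate_back .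
  obtain r where r: "rotate r (rev (rotate k ?q)) = rev (rotate m (rotate k ?q))"
  proof -
    let ?l = "length (rotate k ?q)"
    have "rotate (?l - m mod ?l) (rev (rotate k ?q)) = rev (rotate (?l - (?l - m mod ?l) mod ?l) (rotate k ?q))"
      by (rule rotate_rev)
    also have "rotate (?l - (?l - m mod ?l) mod ?l) (rotate k ?q) = rotate m (rotate k ?q)"
    proof (cases "p = []")
      case False
      hence "0 < ?l" by simp
      hence "(?l - (?l - m mod ?l) mod ?l) mod ?l = m mod ?l"
        by (cases "m mod ?l = 0") (simp_all add: less_imp_le)
      thus ?thesis by (metis rotate_conv_mod)
    qed simp
    finally show thesis using that by blast
  qed
  obtain s where "rotate s (rotate r (rev (rotate k ?q))) = rev (rotate k ?q)" using rotate_back .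
  hence "rev (rotate k ?q) = rotate s (rev ?q)" using r m by simp
  thus thesis using that[of s] by (simp add: inverse_path_def rotate_map)
qed

lemma same_cycle_sym: assumes "same_cycle p q" shows "same_cycle q p"
proof -
  obtain k where "q = rotate k p \<or> q = rotate k (inverse_path p)" using assms by (auto simp: same_cycle_def)
  thus ?thesis
  proof
    assume "q = rotate k p"
    thus ?thesis using rotate_back[of k p] unfolding same_cycle_def by metis
  next
    assume q: "q = rotate k (inverse_path p)"
    obtain m where "rotate m q = inverse_path p" using rotate_back q by metis
    hence "inverse_path (rotate m q) = p" by (simp add: inverse_path_inverse)
    thus ?thesis using inverse_path_rotate[of m q] unfolding same_cycle_def by metis
  qed
qed

lemma same_cycle_trans: assumes "same_cycle p q" "same_cycle q r" shows "same_cycle p r"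
proof -
  obtain k where k: "q = rotate k p \<or> q = rotate k (inverse_path p)" using assms by (auto simp: same_cycle_def)
  obtain l where l: "r = rotate l q \<or> r = rotate l (inverse_path q)" using assms by (auto simp: same_cycle_def)
  have *: "\<exists>m. inverse_path (rotate i u) = rotate m (inverse_path u)" for i u using inverse_path_rotate by metis
  from k l show ?thesis unfolding same_cycle_def using *[of k p] *[of k "inverse_path p"]
    by (metis rotate_rotate inverse_path_inverse)
qed

text \<open>This makes the classes disjoint, so that distinct classes have distinct representatives.\<close>

lemma equiv_duplicates: "equiv (faces X) (duplicates X)"
proof (rule equivI)
  have "same_cycle p p" for p unfolding same_cycle_def by (rule exI[of _ 0]) simp
  thus "refl_on (faces X) (duplicates X)" by (auto simp: refl_on_def duplicates_def)
  show "duplicates X \<subseteq> faces X \<times> faces X" by (auto simp: duplicates_def)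
  show "sym (duplicates X)" by (auto simp: sym_def duplicates_def intro: same_cycle_sym)
  show "trans (duplicates X)" by (auto simp: trans_def duplicates_def intro: same_cycle_trans)
qed

lemma representative:
  assumes "C \<in> faces X // duplicates X" shows "(SOME R. R \<in> C) \<in> C" "(SOME R. R \<in> C) \<in> faces X"
proof -
  show "(SOME R. R \<in> C) \<in> C"
    using in_quotient_imp_non_empty[OF equiv_duplicates assms] by (simp add: some_in_eq)
  thus "(SOME R. R \<in> C) \<in> faces X" using in_quotient_imp_subset[OF equiv_duplicates assms] by blast
qed

lemma representative_inj:
  "inj_on (\<lambda>C. SOME R. R \<in> C) (faces X // duplicates X)"
proof (rule inj_onI)
  fix C C' assume C: "C \<in> faces X // duplicates X" "C' \<in> faces X // duplicates X"
    and eq: "(SOME R. R \<in> C) = (SOME R. R \<in> C')"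
  show "C = C'"
    using quotient_disj[OF equiv_duplicates C] representative(1)[OF C(1)] representative(1)[OF C(2)] eq by auto
qed

lemma is_complex2_identify_duplicates:
  assumes "is_complex2 X" shows "is_complex2 (identify_duplicates X)"
proof -
  have t: "terminal (identify_duplicates X) a = terminal X a" "initial (identify_duplicates X) a = initial X a" for a
    by (cases a; simp add: identify_duplicates_def)+
  have "closed_path X (bdry X (SOME R. R \<in> C))" if "C \<in> faces X // duplicates X" for C
    using assms representative(2)[OF that] by (simp add: is_complex2_def)
  thus ?thesis using assms
    unfolding is_complex2_def closed_path_def t by (simp add: identify_duplicates_def)
qed

section \<open>Collapsing cells\<close>

lemma has_at_least_iff: "has_at_least m A \<longleftrightarrow> (finite A \<longrightarrow> m \<le> card A)"
  unfolding has_at_least_def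
  by (metis card_mono infinite_arbitrarily_large obtain_subset_with_card_n)

theorem proposition5p13:
  fixes X :: "('v, 'e, 'f) complex2" and P :: "('e, 'f) shape"
  assumes "CAT0_complex2 X P"
    and "\<forall>R \<in> faces X. convex_cell X P R"
  shows "n_collapsing 3 X"
  unfolding n_collapsing_def
proof (intro allI impI, elim conjE)
  fix m :: nat and Y
  assume m: "m \<le> 3" and Y: "compact_subcomplex Y (identify_duplicates X)" and many: "has_at_least m (faces Y)"
  interpret CAT0_complex X P using assms(1) by unfold_locales
  define rep where "rep = (\<lambda>C :: 'f set. SOME R. R \<in> C)"
  have sub: "subcomplex Y (identify_duplicates X)" using Y by (simp add: compact_subcomplex_def)
  have Yd: "faces Y \<subseteq> faces X // duplicates X" "edges Y \<subseteq> edges X" "bdry Y C = bdry X (rep C)" for C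
    using sub by (auto simp: subcomplex_def identify_duplicates_def rep_def)
  have inj: "inj_on rep (faces Y)"
    using inj_on_subset[OF representative_inj Yd(1)] by (simp add: rep_def)
  have finE: "finite (edges Y)"
    using compact_subcomplex_finite_edges[OF is_complex2_identify_duplicates[OF complex] Y] .
  show "has_at_least m (collapsing_faces Y)"
  proof (rule ccontr)
    assume "\<not> has_at_least m (collapsing_faces Y)"
    hence fin: "finite (collapsing_faces Y)" and less: "card (collapsing_faces Y) < m"
      by (auto simp: has_at_least_iff)
    \<comment> \<open>at most two cells collapse, and some cell \<open>C\<close> does not\<close>
    have "card (collapsing_faces Y) \<le> 2" using less m by simp
    then obtain A B where AB: "collapsing_faces Y \<subseteq> {A, B}"
    proof -
      obtain xs where xs: "set xs = collapsing_faces Y" "length xs = card (collapsing_faces Y)"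
        using finite_distinct_list[OF fin] distinct_card by metis
      have "length xs \<le> 2" using xs(2) \<open>card (collapsing_faces Y) \<le> 2\<close> by simp
      then consider "xs = []" | a where "xs = [a]" | a b where "xs = [a, b]"
        by (cases xs rule: remdups_adj.cases) auto
      thus thesis using that xs(1) by cases auto
    qed
    have "\<not> faces Y \<subseteq> collapsing_faces Y"
    proof
      assume "faces Y \<subseteq> collapsing_faces Y"
      hence "finite (faces Y)" "card (faces Y) \<le> card (collapsing_faces Y)"
        using fin by (auto intro: finite_subset card_mono)
      thus False using many less by (simp add: has_at_least_iff)
    qed
    then obtain C where C: "C \<in> faces Y" "C \<notin> collapsing_faces Y" by blast
    show False
    proof (rule two_free_cells_impossible[of "rep ` faces Y" "edges Y" "rep C" "rep A" "rep B"])
      show "rep ` faces Y \<subseteq> faces X" using Yd(1) representative(2) by (auto simp: rep_def)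
      show "fst ` set (bdry X R) \<subseteq> edges Y" if "R \<in> rep ` faces Y" for R
      proof -
        obtain C' where "C' \<in> faces Y" "R = rep C'" using \<open>R \<in> rep ` faces Y\<close> by blast
        moreover have "is_complex2 Y" using sub by (simp add: subcomplex_def)
        ultimately show ?thesis by (auto simp: is_complex2_def closed_path_def Yd(3))
      qed
      fix R e
      assume "R \<in> rep ` faces Y" and e: "e \<in> edges Y" and c: "count_list (map fst (bdry X R)) e = 1"
        and other: "\<forall>R'\<in>rep ` faces Y. R' \<noteq> R \<longrightarrow> e \<notin> fst ` set (bdry X R')"
      then obtain C' where C': "C' \<in> faces Y" "R = rep C'" by blast
      have "free_face_of Y e C'"
        unfolding free_face_of_def Yd(3)
      proof (intro conjI ballI impI)
        fix C'' assume C'': "C'' \<in> faces Y" "C'' \<noteq> C'"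
        hence "rep C'' \<noteq> R" using inj C' by (auto dest: inj_onD)
        thus "e \<notin> fst ` set (bdry X (rep C''))" using other C'' by blast
      qed (use e c C' in auto)
      hence "C' \<in> collapsing_faces Y" using C' by (auto simp: collapsing_faces_def)
      thus "R \<noteq> rep C \<and> (R = rep A \<or> R = rep B)"
        using AB C C' inj by (auto dest: inj_onD)
    qed (use assms(2) finE Yd(2) C in auto)
  qed
qed

end
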